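(* Assume the Riemann Hypothesis. Then for every $\varepsilon>0$ and every real number $x>5$, $$E_{\mu}(x)\ll x^{\frac{439}{1032}+\varepsilon},$$ where the implied constant depends only on $\varepsilon$.
   Context: $\mu$ is the Möbius function, $\zeta$ is the Riemann zeta-function, $\zeta'$ is its first derivative, and $\gamma$ is the Euler--Mascheroni constant. Define $$S_{\mu}(x)=\sum_{mn\le x}\mu(\gcd(m,n)),$$ the sum running over all ordered pairs $(m,n)$ of positive integers with $mn\le x$. The error term $E_{\mu}(x)$ is defined by $$E_{\mu}(x)=S_{\mu}(x)-\frac{x}{\zeta^{2}(2)}\left(\log x+2\gamma-1-4\frac{\zeta'(2)}{\zeta(2)}\right).$$ *)

theory Defs
  imports "HOL-Complex_Analysis.Complex_Analysis" "HOL-Computational_Algebra.Squarefree"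
begin

section \<open>The Riemann zeta function\<close>

text \<open>
  The zeta function is the analytic continuation to the punctured plane of the Dirichlet series
  \<open>\<Sum>n\<ge>1. n\<^sup>-\<^sup>s\<close>, \<open>Re s > 1\<close>.  The value at the pole \<open>1\<close> is fixed to be \<open>0\<close> by convention, which
  makes the continuation unique.  Existence and uniqueness are proved below.
\<close>

definition zeta_continuation :: "(complex \<Rightarrow> complex) \<Rightarrow> bool" where
  "zeta_continuation f \<longleftrightarrow> f holomorphic_on - {1} \<and> f 1 = 0 \<and>
     (\<forall>s. Re s > 1 \<longrightarrow> (\<lambda>n. 1 / of_nat (Suc n) powr s) sums f s)"

definition zeta :: "complex \<Rightarrow> complex" where
  "zeta = (THE f. zeta_continuation f)"


subsection \<open>Uniqueness\<close>

lemma zeta_continuation_unique: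
  assumes f: "zeta_continuation f" and g: "zeta_continuation g"
  shows "f = g"
proof
  fix s
  show "f s = g s"
  proof (cases "s = 1")
    case True
    then show ?thesis using f g by (simp add: zeta_continuation_def)
  next
    case False
    show ?thesis
    proof (rule analytic_continuation_open[where f = f and g = g and s = "{s. Re s > 1}" and s' = "- {1}"])
      show "{s. 1 < Re s} \<noteq> {}" by (auto intro: exI[of _ 2])
      show "connected (- {1::complex})" by (simp add: connected_punctured_universe)
      show "f z = g z" if "z \<in> {s. 1 < Re s}" for z
        using that f g by (auto simp: zeta_continuation_def intro: sums_unique2)
    qed (use f g False in \<open>auto simp: zeta_continuation_def open_halfspace_Re_gt\<close>)
  qed
qed


subsection \<open>Existence\<close>

lemma holomorphic_on_suminf_local:
  fixes f :: "nat \<Rightarrow> complex \<Rightarrow> complex"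
  assumes "open S" and hol: "\<And>n. f n holomorphic_on S"
    and M: "\<And>x. x \<in> S \<Longrightarrow> \<exists>d>0. cball x d \<subseteq> S \<and> (\<exists>M. summable M \<and> (\<forall>n. \<forall>z\<in>cball x d. norm (f n z) \<le> M n))"
  shows "(\<lambda>z. \<Sum>n. f n z) holomorphic_on S"
proof (rule holomorphic_uniform_sequence[where f = "\<lambda>n z. \<Sum>i<n. f i z"])
  show "open S" by fact
  show "(\<lambda>z. \<Sum>i<n. f i z) holomorphic_on S" for n
    by (intro holomorphic_intros hol)
  show "\<exists>d>0. cball x d \<subseteq> S \<and> uniform_limit (cball x d) (\<lambda>n z. \<Sum>i<n. f i z) (\<lambda>z. \<Sum>n. f n z) sequentially"
    if "x \<in> S" for x
    using M[OF that] by (metis Weierstrass_m_test)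
qed

lemma summable_Suc_powr:
  assumes "c < -1"
  shows "summable (\<lambda>n. real (Suc n) powr c)"
  using assms summable_real_powr_iff[of c] by (subst (asm) summable_Suc_iff[symmetric]) simp

lemma norm_Suc_powr: "norm (of_nat (Suc n) powr (s :: complex)) = real (Suc n) powr Re s"
  by (subst norm_powr_real_powr) auto

lemma zeta_series_summable:
  assumes "Re s > 1"
  shows "summable (\<lambda>n. 1 / of_nat (Suc n) powr (s :: complex))"
proof (rule summable_norm_cancel)
  show "summable (\<lambda>n. norm (1 / of_nat (Suc n) powr s))"
    using summable_Suc_powr[of "- Re s"] assms
    by (simp add: norm_divide norm_Suc_powr powr_minus_divide del: of_nat_Suc)
qed

lemma cball_Re_bounds:
  assumes "z \<in> cball x d"
  shows "Re z \<ge> Re x - d" "Re z \<le> Re x + d"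
  using assms abs_Re_le_cmod[of "x - z"] by (auto simp: dist_norm)

lemma zeta_series_holomorphic:
  "(\<lambda>s. \<Sum>n. 1 / of_nat (Suc n) powr s) holomorphic_on {s :: complex. Re s > 1}"
proof (rule holomorphic_on_suminf_local)
  show "open {s :: complex. Re s > 1}" by (simp add: open_halfspace_Re_gt)
  show "(\<lambda>s. 1 / of_nat (Suc n) powr s) holomorphic_on {s :: complex. Re s > 1}" for n
    by (intro holomorphic_intros) (auto simp del: of_nat_Suc)
  fix x :: complex assume x: "x \<in> {s. Re s > 1}"
  define d where "d = (Re x - 1) / 2"
  have d: "d > 0" using x by (simp add: d_def)
  have re: "Re z \<ge> 1 + d" if "z \<in> cball x d" for z
    using cball_Re_bounds(1)[OF that] unfolding d_def by (simp add: field_simps)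
  have "norm (1 / of_nat (Suc n) powr z) \<le> real (Suc n) powr - (1 + d)" if "z \<in> cball x d" for n z
  proof -
    have "norm (1 / of_nat (Suc n) powr z) = real (Suc n) powr - Re z"
      by (simp add: norm_divide norm_Suc_powr powr_minus_divide del: of_nat_Suc)
    also have "\<dots> \<le> real (Suc n) powr - (1 + d)"
      using re[OF that] by (intro powr_mono) auto
    finally show ?thesis .
  qed
  moreover have "summable (\<lambda>n. real (Suc n) powr - (1 + d))"
    using d by (intro summable_Suc_powr) auto
  moreover have "cball x d \<subseteq> {s. Re s > 1}"
    using re d by force
  ultimately show "\<exists>d>0. cball x d \<subseteq> {s. 1 < Re s} \<and>
      (\<exists>M. summable M \<and> (\<forall>n. \<forall>z\<in>cball x d. norm (1 / of_nat (Suc n) powr z) \<le> M n))"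
    using d by blast
qed

text \<open>
  The continuation proceeds strip by strip: summing the Taylor expansion of \<open>(n + 1) powr (1 - s)\<close>
  around \<open>n\<close> over all \<open>n \<ge> 1\<close> expresses \<open>(s - 1) * zeta s\<close> through values further to the right and
  a remainder series that converges in a larger half-plane.
\<close>

definition zeta_rem :: "nat \<Rightarrow> nat \<Rightarrow> complex \<Rightarrow> complex" where
  "zeta_rem K n s = of_nat (Suc (Suc n)) powr (1 - s) -
     (\<Sum>i\<le>K. ((1 - s) gchoose i) * of_nat (Suc n) powr (1 - s - of_nat i))"

lemma zeta_rem_bound:
  assumes "Re s \<ge> - real K"
  shows "norm (zeta_rem K n s) \<le>
           real (Suc K) * norm ((1 - s) gchoose (Suc K)) * real (Suc n) powr (- Re s - real K)"
proof -
  define a where "a = 1 - s"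
  define f where "f = (\<lambda>i z. fact i * (a gchoose i) * (z :: complex) powr (a - of_nat i))"
  define N where "N = Suc n"
  define S where "S = complex_of_real ` {real N..real (Suc N)}"
  define B where "B = fact (Suc K) * norm (a gchoose (Suc K)) * real N powr (Re a - real (Suc K))"
  have S_eq: "S = closed_segment (complex_of_real (real N)) (complex_of_real (real (Suc N)))"
    by (subst closed_segment_of_real) (simp add: S_def closed_segment_eq_real_ivl)
  have "norm (f 0 (of_nat (Suc N)) - (\<Sum>i\<le>K. f i (of_nat N) * (of_nat (Suc N) - of_nat N) ^ i / fact i))
          \<le> B * norm (of_nat (Suc N) - of_nat N :: complex) ^ Suc K / fact K"
  proof (rule complex_Taylor)
    show "convex S" unfolding S_eq by simp
    show "(f i has_field_derivative f (Suc i) x) (at x within S)" if "x \<in> S" for i x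
    proof -
      have "x \<notin> \<real>\<^sub>\<le>\<^sub>0" using that by (auto simp: S_def N_def complex_nonpos_Reals_iff)
      then have "((\<lambda>z. fact i * (a gchoose i) * z powr (a - of_nat i)) has_field_derivative
                 fact i * (a gchoose i) * ((a - of_nat i) * x powr (a - of_nat i - 1))) (at x)"
        by (intro DERIV_cmult has_field_derivative_powr)
      moreover have "fact i * (a gchoose i) * ((a - of_nat i) * x powr (a - of_nat i - 1)) = f (Suc i) x"
      proof -
        have "of_nat (Suc i) * (a gchoose Suc i) = (a gchoose i) * (a - of_nat i)"
          using gbinomial_mult_1'[of a i] by (simp add: algebra_simps)
        then have "fact (Suc i) * (a gchoose Suc i) = fact i * ((a gchoose i) * (a - of_nat i))"
          by (simp add: fact_Suc mult.assoc mult.left_commute del: of_nat_Suc)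
        moreover have "a - of_nat (Suc i) = a - of_nat i - 1" by simp
        ultimately show ?thesis unfolding f_def by (simp only: mult.assoc)
      qed
      ultimately show ?thesis unfolding f_def by (metis has_field_derivative_at_within)
    qed
    show "norm (f (Suc K) x) \<le> B" if "x \<in> S" for x
    proof -
      from that obtain t where t: "x = of_real t" "t \<ge> real N" "t > 0" by (auto simp: S_def N_def)
      have "norm (f (Suc K) x) = fact (Suc K) * norm (a gchoose (Suc K)) * t powr (Re a - real (Suc K))"
        using t by (simp add: f_def norm_mult norm_powr_real_powr del: of_nat_Suc fact_Suc)
      also have "\<dots> \<le> B"
        unfolding B_def using t assms by (intro mult_left_mono powr_mono2') (auto simp: a_def N_def)
      finally show ?thesis .
    qed
    show "of_nat N \<in> S" "of_nat (Suc N) \<in> S"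
      by (auto simp: S_def intro: image_eqI[of _ _ "real N"] image_eqI[of _ _ "real (Suc N)"])
  qed
  moreover have "f 0 (of_nat (Suc N)) - (\<Sum>i\<le>K. f i (of_nat N) * (of_nat (Suc N) - of_nat N) ^ i / fact i)
      = zeta_rem K n s"
    by (simp add: f_def zeta_rem_def N_def a_def)
  moreover have "B * norm (of_nat (Suc N) - of_nat N :: complex) ^ Suc K / fact K =
      real (Suc K) * norm (a gchoose (Suc K)) * real N powr (Re a - real (Suc K))"
    by (simp add: B_def fact_Suc field_simps)
  moreover have "Re a - real (Suc K) = - Re s - real K" by (simp add: a_def)
  ultimately show ?thesis unfolding a_def[symmetric] N_def[symmetric] by (simp only:)
qed

lemma gbinomial_holomorphic: "(\<lambda>s. (1 - s) gchoose i) holomorphic_on (A :: complex set)"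
  unfolding gbinomial_prod_rev by (intro holomorphic_intros) auto

lemma zeta_rem_holomorphic_aux: "zeta_rem K n holomorphic_on A"
  unfolding zeta_rem_def
  by (intro holomorphic_intros gbinomial_holomorphic) (auto simp del: of_nat_Suc)

lemma zeta_rem_series_holomorphic:
  "(\<lambda>s. \<Sum>n. zeta_rem K n s) holomorphic_on {s. Re s > 1 - real K}"
proof (rule holomorphic_on_suminf_local)
  show "open {s :: complex. Re s > 1 - real K}" by (simp add: open_halfspace_Re_gt)
  show "zeta_rem K n holomorphic_on {s. Re s > 1 - real K}" for n
    by (rule zeta_rem_holomorphic_aux)
  fix x :: complex assume x: "x \<in> {s. Re s > 1 - real K}"
  define d where "d = (Re x - (1 - real K)) / 2"
  have d: "d > 0" using x by (simp add: d_def)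
  have re: "Re z \<ge> 1 - real K + d" if "z \<in> cball x d" for z
    using cball_Re_bounds(1)[OF that] unfolding d_def by (simp add: field_simps)
  have "compact ((\<lambda>z. (1 - z) gchoose (Suc K)) ` cball x d)"
    by (intro compact_continuous_image holomorphic_on_imp_continuous_on gbinomial_holomorphic) auto
  then obtain C where C: "\<And>z. z \<in> cball x d \<Longrightarrow> norm ((1 - z) gchoose (Suc K)) \<le> C"
    by (meson bounded_iff compact_imp_bounded imageI)
  have "norm (zeta_rem K n z) \<le> real (Suc K) * C * real (Suc n) powr - (1 + d)"
    if z: "z \<in> cball x d" for n z
  proof -
    have "norm (zeta_rem K n z) \<le>
           real (Suc K) * norm ((1 - z) gchoose (Suc K)) * real (Suc n) powr (- Re z - real K)"
      using re[OF z] d by (intro zeta_rem_bound) auto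
    also have "\<dots> \<le> real (Suc K) * C * real (Suc n) powr - (1 + d)"
      using re[OF z] C[OF z] order_trans[OF norm_ge_zero C[OF z]]
      by (intro mult_mono powr_mono) auto
    finally show ?thesis .
  qed
  moreover have "summable (\<lambda>n. real (Suc K) * C * real (Suc n) powr - (1 + d))"
    using d by (intro summable_mult summable_Suc_powr) auto
  moreover have "cball x d \<subseteq> {s. Re s > 1 - real K}"
    using re d by force
  ultimately show "\<exists>d>0. cball x d \<subseteq> {s. 1 - real K < Re s} \<and>
      (\<exists>M. summable M \<and> (\<forall>n. \<forall>z\<in>cball x d. norm (zeta_rem K n z) \<le> M n))"
    using d by blast
qed

definition zeta_dir :: "complex \<Rightarrow> complex" where
  "zeta_dir s = (\<Sum>n. 1 / of_nat (Suc n) powr s)"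

lemma zeta_dir_sums: "Re s > 1 \<Longrightarrow> (\<lambda>n. 1 / of_nat (Suc n) powr s) sums zeta_dir s"
  unfolding zeta_dir_def by (intro summable_sums zeta_series_summable)

lemma zeta_dir_recurrence:
  assumes s: "Re s > 1"
  shows "(s - 1) * zeta_dir s = 1 +
    (\<Sum>i\<in>{2..Suc (Suc k)}. ((1 - s) gchoose i) * zeta_dir (s + of_nat i - 1)) + (\<Sum>n. zeta_rem (Suc (Suc k)) n s)"
proof -
  define K where "K = Suc (Suc k)"
  have "(\<lambda>n. of_nat (Suc n) powr (1 - s)) \<longlonglongrightarrow> 0"
  proof (rule tendsto_norm_zero_cancel)
    have "(\<lambda>n. real (Suc n) powr Re (1 - s)) \<longlonglongrightarrow> 0"
      using s by (intro tendsto_neg_powr filterlim_compose[OF filterlim_real_sequentially] filterlim_Suc) auto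
    then show "(\<lambda>n. norm (of_nat (Suc n) powr (1 - s))) \<longlonglongrightarrow> 0"
      by (simp only: norm_Suc_powr)
  qed
  from telescope_sums[OF this]
  have 1: "(\<lambda>n. of_nat (Suc (Suc n)) powr (1 - s) - of_nat (Suc n) powr (1 - s)) sums (-1)"
    by simp
  have 2: "(\<lambda>n. \<Sum>i\<in>{1..K}. ((1 - s) gchoose i) * of_nat (Suc n) powr (1 - s - of_nat i)) sums
           (\<Sum>i\<in>{1..K}. ((1 - s) gchoose i) * zeta_dir (s + of_nat i - 1))"
  proof (intro sums_sum sums_mult)
    fix i assume "i \<in> {1..K}"
    then have "Re (s + of_nat i - 1) > 1" using s by auto
    from zeta_dir_sums[OF this]
    show "(\<lambda>n. of_nat (Suc n) powr (1 - s - of_nat i)) sums zeta_dir (s + of_nat i - 1)"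
      by (simp add: powr_minus_divide[symmetric] algebra_simps del: of_nat_Suc)
  qed
  have "(\<lambda>n. zeta_rem K n s) sums (-1 - (\<Sum>i\<in>{1..K}. ((1 - s) gchoose i) * zeta_dir (s + of_nat i - 1)))"
  proof -
    have "{..K} = insert 0 {1..K}" by auto
    then have "zeta_rem K n s = of_nat (Suc (Suc n)) powr (1 - s) - of_nat (Suc n) powr (1 - s) -
        (\<Sum>i\<in>{1..K}. ((1 - s) gchoose i) * of_nat (Suc n) powr (1 - s - of_nat i))" for n
      by (simp add: zeta_rem_def del: of_nat_Suc)
    then show ?thesis using sums_diff[OF 1 2] by simp
  qed
  then have "(\<Sum>n. zeta_rem K n s) = -1 - (\<Sum>i\<in>{1..K}. ((1 - s) gchoose i) * zeta_dir (s + of_nat i - 1))"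
    by (rule sums_unique[symmetric])
  moreover have "{1..K} = insert 1 {2..K}" by (auto simp: K_def)
  then have "(\<Sum>i\<in>{1..K}. ((1 - s) gchoose i) * zeta_dir (s + of_nat i - 1)) =
      (1 - s) * zeta_dir s + (\<Sum>i\<in>{2..K}. ((1 - s) gchoose i) * zeta_dir (s + of_nat i - 1))"
    by simp
  ultimately show ?thesis unfolding K_def[symmetric] by (simp add: left_diff_distrib)
qed

lemma zeta_halfplane:
  "\<exists>g. g holomorphic_on {s. Re s > 1 - real k} \<and> (\<forall>s. Re s > 1 \<longrightarrow> g s = (s - 1) * zeta_dir s)"
proof (induction k)
  case 0
  have "(\<lambda>s. (s - 1) * zeta_dir s) holomorphic_on {s. Re s > 1}"
    unfolding zeta_dir_def by (intro holomorphic_intros zeta_series_holomorphic)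
  then show ?case by auto
next
  case (Suc k)
  then obtain g where g: "g holomorphic_on {s. Re s > 1 - real k}"
    and g_eq: "\<And>s. Re s > 1 \<Longrightarrow> g s = (s - 1) * zeta_dir s" by blast
  define h where "h = (\<lambda>s. 1 -
     (\<Sum>i\<in>{2..Suc (Suc k)}. ((1 - s) gchoose (i - 1)) / of_nat i * g (s + of_nat i - 1)) +
     (\<Sum>n. zeta_rem (Suc (Suc k)) n s))"
  let ?S = "{s. Re s > 1 - real (Suc k)}"
  have shift: "(\<lambda>s. g (s + of_nat i - 1)) holomorphic_on ?S" if "i \<in> {2..Suc (Suc k)}" for i
  proof -
    have "(g \<circ> (\<lambda>s. s + of_nat i - 1)) holomorphic_on ?S"
      using that by (intro holomorphic_on_compose_gen[OF _ g] holomorphic_intros) auto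
    then show ?thesis by (simp add: o_def)
  qed
  have "(\<lambda>s. \<Sum>n. zeta_rem (Suc (Suc k)) n s) holomorphic_on ?S"
    using zeta_rem_series_holomorphic[of "Suc (Suc k)"] by (rule holomorphic_on_subset) auto
  then have "h holomorphic_on ?S"
    unfolding h_def by (intro holomorphic_intros shift gbinomial_holomorphic) auto
  moreover have "h s = (s - 1) * zeta_dir s" if s: "Re s > 1" for s
  proof -
    have "((1 - s) gchoose i) * zeta_dir (s + of_nat i - 1) =
          - (((1 - s) gchoose (i - 1)) / of_nat i * g (s + of_nat i - 1))"
      if i: "i \<in> {2..Suc (Suc k)}" for i
    proof -
      from i obtain j where j: "i = Suc j" by (cases i) auto
      have "((1 - s) gchoose Suc j) * of_nat (Suc j) = ((1 - s) gchoose j) * (1 - s - of_nat j)"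
        using gbinomial_mult_1'[of "1 - s" j] by (simp add: algebra_simps)
      then have "(1 - s) gchoose i = ((1 - s) gchoose j) * (1 - s - of_nat j) / of_nat i"
        unfolding j by (simp add: field_simps del: of_nat_Suc)
      moreover have "g (s + of_nat i - 1) = (s + of_nat i - 2) * zeta_dir (s + of_nat i - 1)"
        using i s by (subst g_eq) (auto simp: algebra_simps)
      moreover have "c * (1 - s - of_nat j) / d * z = - (c / d * ((s + of_nat i - 2) * z))" for c d z :: complex
        by (simp add: j divide_simps) algebra
      ultimately show ?thesis by (simp add: j del: of_nat_Suc)
    qed
    then show ?thesis
      unfolding h_def zeta_dir_recurrence[OF s, of k] by (simp add: sum_negf)
  qed
  ultimately show ?case by blast
qed

lemma zeta_continuation_exists: "\<exists>f. zeta_continuation f"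
proof -
  define H where "H = (\<lambda>k :: nat. {s :: complex. Re s > 1 - real k})"
  obtain g where g: "\<And>k. g k holomorphic_on H k"
    and g_eq: "\<And>k s. Re s > 1 \<Longrightarrow> g k s = (s - 1) * zeta_dir s"
    using zeta_halfplane unfolding H_def by metis
  have openH: "open (H k)" for k by (simp add: H_def open_halfspace_Re_gt)
  have agree: "g k s = g m s" if "s \<in> H k" "s \<in> H m" for k m s
  proof (rule analytic_continuation_open[where f = "g k" and g = "g m" and s = "{s. Re s > 1}" and s' = "H k \<inter> H m"])
    show "{s. 1 < Re s} \<noteq> {}" by (auto intro: exI[of _ 2])
    show "connected (H k \<inter> H m)"
      unfolding H_def by (intro convex_connected convex_Int convex_halfspace_Re_gt)
    show "g k holomorphic_on H k \<inter> H m" "g m holomorphic_on H k \<inter> H m"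
      using g by (auto intro: holomorphic_on_subset)
  qed (use that openH in \<open>auto simp: open_halfspace_Re_gt g_eq H_def\<close>)
  define k where "k = (\<lambda>s :: complex. SOME k. s \<in> H k)"
  have k: "s \<in> H (k s)" for s
  proof -
    obtain m :: nat where "real m > 1 - Re s" using reals_Archimedean2 by blast
    then have "s \<in> H m" by (simp add: H_def)
    then show ?thesis unfolding k_def by (rule someI)
  qed
  define G where "G = (\<lambda>s. g (k s) s)"
  have "G holomorphic_on UNIV"
  proof -
    have "G field_differentiable at s" for s
    proof -
      have "G holomorphic_on H (k s)"
      proof (rule holomorphic_transform[OF g[of "k s"]])
        show "g (k s) t = G t" if "t \<in> H (k s)" for t
          unfolding G_def by (rule agree[OF that k])
      qed
      from holomorphic_on_imp_differentiable_at[OF this openH k] show ?thesis .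
    qed
    then show ?thesis by (simp add: holomorphic_on_def)
  qed
  then have "(\<lambda>s. G s / (s - 1)) holomorphic_on - {1}"
    by (intro holomorphic_intros) (auto intro: holomorphic_on_subset)
  moreover have "(\<lambda>n. 1 / of_nat (Suc n) powr s) sums (G s / (s - 1))" if "Re s > 1" for s
  proof -
    have "s \<noteq> 1" using that by auto
    then have "G s / (s - 1) = zeta_dir s" using that by (simp add: G_def g_eq)
    then show ?thesis using zeta_dir_sums[OF that] by (simp only:)
  qed
  ultimately have "zeta_continuation (\<lambda>s. G s / (s - 1))"
    by (simp add: zeta_continuation_def del: of_nat_Suc)
  then show ?thesis by blast
qed

lemma zeta_continuation_zeta: "zeta_continuation zeta"
  unfolding zeta_def
  by (rule theI'[of zeta_continuation]) (use zeta_continuation_exists zeta_continuation_unique in blast)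

lemma zeta_holomorphic: "zeta holomorphic_on - {1}"
  and zeta_sums: "Re s > 1 \<Longrightarrow> (\<lambda>n. 1 / of_nat (Suc n) powr s) sums zeta s"
  using zeta_continuation_zeta by (auto simp: zeta_continuation_def)


subsection \<open>Values on the real half-line\<close>

lemma zeta_real:
  assumes "x > 1"
  shows "zeta (of_real x) \<in> \<real>"
proof -
  have "(\<lambda>n. 1 / of_nat (Suc n) powr complex_of_real x) sums zeta (of_real x)"
    using assms by (intro zeta_sums) auto
  moreover have "1 / of_nat (Suc n) powr complex_of_real x = of_real (1 / real (Suc n) powr x)" for n
    by (simp add: powr_of_real[symmetric])
  ultimately have "(\<lambda>n. complex_of_real (1 / real (Suc n) powr x)) sums zeta (of_real x)"
    by simp
  then have "(\<lambda>n. Im (complex_of_real (1 / real (Suc n) powr x))) sums Im (zeta (of_real x))"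
    by (rule sums_Im)
  then have "Im (zeta (of_real x)) = 0"
    using sums_unique2 sums_zero by (metis (no_types, lifting) Im_complex_of_real sums_cong)
  then show ?thesis by (simp add: complex_is_Real_iff)
qed

lemma deriv_zeta_real:
  assumes "x > 1"
  shows "deriv zeta (of_real x) \<in> \<real>"
proof -
  have "(zeta has_field_derivative deriv zeta (of_real x)) (at (of_real x))"
    using assms by (intro holomorphic_derivI[OF zeta_holomorphic]) auto
  then have "((\<lambda>h. (zeta (of_real x + h) - zeta (of_real x)) / h) \<longlongrightarrow> deriv zeta (of_real x)) (at 0)"
    by (simp add: DERIV_def)
  moreover have "filterlim complex_of_real (at 0) (at_right 0)"
    unfolding filterlim_at
    by (auto simp: eventually_at_filter intro!: tendsto_eq_intros)
  ultimately have "((\<lambda>h. (zeta (of_real x + of_real h) - zeta (of_real x)) / of_real h) \<longlongrightarrow>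
      deriv zeta (of_real x)) (at_right (0 :: real))"
    by (rule filterlim_compose)
  moreover have "eventually (\<lambda>h. (zeta (of_real x + of_real h) - zeta (of_real x)) / of_real h \<in> \<real>) (at_right (0 :: real))"
    unfolding eventually_at_filter
    using assms zeta_real[of "x + _"]
    by (intro always_eventually) (auto simp flip: of_real_add intro!: Reals_divide Reals_diff zeta_real)
  ultimately show ?thesis
    by (intro Lim_in_closed_set[OF closed_complex_Reals _ _, rotated 2]) auto
qed


section \<open>The Riemann Hypothesis\<close>

definition Riemann_Hypothesis :: bool where
  "Riemann_Hypothesis \<longleftrightarrow> (\<forall>s. zeta s = 0 \<and> 0 < Re s \<and> Re s < 1 \<longrightarrow> Re s = 1 / 2)"


section \<open>The summatory function and its error term\<close>

definition moebius_mu :: "nat \<Rightarrow> int" where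
  "moebius_mu n = (if squarefree n then (-1) ^ card (prime_factors n) else 0)"

definition S_mu :: "real \<Rightarrow> int" where
  "S_mu x = (\<Sum>(m, n) \<in> {(m, n). m > 0 \<and> n > 0 \<and> real (m * n) \<le> x}. moebius_mu (gcd m n))"

text \<open>
  By \<open>zeta_real\<close> and \<open>deriv_zeta_real\<close>, \<open>zeta 2\<close> and \<open>deriv zeta 2\<close> are real, so that taking real parts below
  is only a change of type.
\<close>

definition E_mu :: "real \<Rightarrow> real" where
  "E_mu x = real_of_int (S_mu x) -
     x / (Re (zeta 2))\<^sup>2 *
       (ln x + 2 * euler_mascheroni - 1 - 4 * (Re (deriv zeta 2) / Re (zeta 2)))"

lemma finite_S_mu: "finite {(m, n). m > 0 \<and> n > 0 \<and> real (m * n) \<le> x}"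
proof (rule finite_subset)
  show "{(m, n). m > 0 \<and> n > 0 \<and> real (m * n) \<le> x} \<subseteq> {..nat \<lfloor>x\<rfloor>} \<times> {..nat \<lfloor>x\<rfloor>}"
  proof (rule subsetI)
    fix p assume "p \<in> {(m, n). m > 0 \<and> n > 0 \<and> real (m * n) \<le> x}"
    then obtain m n where p: "p = (m, n)" "0 < m" "0 < n" and le: "real (m * n) \<le> x" by blast
    then have 1: "m \<le> m * n" "n \<le> m * n" by auto
    have 2: "m * n \<le> nat \<lfloor>x\<rfloor>" using le by (rule le_nat_floor)
    show "p \<in> {..nat \<lfloor>x\<rfloor>} \<times> {..nat \<lfloor>x\<rfloor>}"
      using le_trans[OF 1(1) 2] le_trans[OF 1(2) 2] p by simp
  qed
qed auto

end

theory Submission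
  imports Defs "HOL-Number_Theory.Prime_Powers"
begin

text \<open>
  Let \<open>g = \<mu> * \<mu>\<close> (Dirichlet convolution), with Dirichlet series \<open>1 / \<zeta>(s)\<^sup>2\<close>, and let \<open>\<Delta>\<close> be the error term of
  the Dirichlet divisor problem, extended to all positive reals. Since \<open>\<mu> = 1 * g\<close>, the error term is
  \<open>E(x) = \<Sum>\<^sub>d g(d) \<Delta>(x / d\<^sup>2)\<close>. Split the weight \<open>1\<close> smoothly as \<open>max 0 (1 - d/y) + min 1 (d/y)\<close> with
  \<open>y = x powr (1/5)\<close>.

  The first part is estimated by \<open>\<Delta>(u) = O(u powr (1/3) (log u)\<^sup>2)\<close>, which Vinogradov's elementary method gives:
  \<open>u/n\<close> is nearly linear with rational slope \<open>a/q\<close> on blocks of length \<open>q\<close>, the sawtooth sum over a block is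
  bounded, and blocks with small \<open>q\<close> are rare.

  For the second part, the Riemann Hypothesis bounds \<open>\<zeta>\<close> and \<open>1/\<zeta>\<close> by \<open>\<bar>t\<bar> powr \<epsilon>\<close> to the right of the critical line.
  Moving contours of Perron integrals with kernel \<open>1 / (z (z + 1))\<close>, the weighted tail of
  \<open>1 / \<zeta>(2s)\<^sup>2\<close> is \<open>O(y powr (-1/2) \<bar>t\<bar> powr \<epsilon>)\<close> near the critical line, where the integral against \<open>\<zeta>(s)\<^sup>2\<close> then gives
  about \<open>x powr (1/2) y powr (-1/2)\<close>. Both parts are below \<open>x powr (17/40)\<close>, and \<open>17/40 < 439/1032\<close>.
\<close>

section \<open>The Dirichlet divisor problem\<close>

text \<open>If \<open>\<Delta>(u)\<close> is \<open>O(u powr \<theta>)\<close>, the part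
  \<open>d \<le> y\<close> is about \<open>x powr \<theta> * y powr (1 - 2 * \<theta>)\<close>, so
  the trivial exponent 1/2 would save nothing over \<open>x powr (1/2)\<close>. With 1/3 the two
  parts are about \<open>(x * y) powr (1/3)\<close> and \<open>(x / y) powr (1/2)\<close>, which
  balance at \<open>x powr (2/5)\<close> for the chosen \<open>y\<close>; the gap up to 17/40 pays
  for logarithms, for the size of \<open>g\<close>, and for staying 1/100 to the right of the
  critical line. The obstacle in the second part is convergence: a sharp Perron integral converges
  only conditionally. Two devices keep every integral absolutely convergent. The linear weight in
  \<open>d\<close> is a Riesz mean, whence the second factor in the kernel. In \<open>x\<close>, the
  divisor sum is exactly a difference of its integral, and the corresponding difference of kernels
  can be made to decay slightly faster than \<open>1 / \<bar>t\<bar>\<close> at the cost of a small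
  power of \<open>x\<close>.\<close>

lemma sum_add_div_eq:
  fixes m :: int
  assumes "q > 0"
  shows "(\<Sum>j<q. (m + int j) div int q) = m"
proof -
  define F where "F = (\<lambda>m. \<Sum>j<q. (m + int j) div int q)"
  \<comment> \<open>Sliding the window by one drops \<open>m div q\<close> and gains
    \<open>(m + q) div q\<close>, which is larger by exactly 1.\<close>
  have step: "F (m + 1) = F m + 1" for m
  proof -
    have "F m + (m + int q) div int q = (\<Sum>j<Suc q. (m + int j) div int q)"
      by (simp add: F_def)
    also have "\<dots> = m div int q + F (m + 1)"
      by (subst sum.lessThan_Suc_shift) (simp add: F_def algebra_simps)
    finally show ?thesis using assms by simp
  qed
  have "F m = m"
  proof (induction m rule: int_induct[where k = 0])
    case base
    then show ?case by (simp add: F_def)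
  next
    case (step1 i)
    then show ?case using step[of i] by simp
  next
    case (step2 i)
    then show ?case using step[of "i - 1"] by simp
  qed
  then show ?thesis by (simp add: F_def)
qed

text \<open>Hermite's identity. Each floor is the integer division of
  \<open>\<lfloor>q * x\<rfloor> + j\<close> by \<open>q\<close>, so the previous lemma evaluates
  the complete sum without any error growing with \<open>q\<close>.\<close>

lemma sum_floor_add_divide:
  fixes x :: real
  assumes "q > 0"
  shows "(\<Sum>j<q. \<lfloor>x + real j / real q\<rfloor>) = \<lfloor>real q * x\<rfloor>"
proof -
  have "\<lfloor>x + real j / real q\<rfloor> = (\<lfloor>real q * x\<rfloor> + int j) div int q" for j
  proof -
    have "x + real j / real q = (real q * x + real j) / real_of_int (int q)"
      using assms by (simp add: field_simps)
    then show ?thesis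
      by (simp only: floor_divide_real_eq_div) (simp add: floor_divide_real_eq_div)
  qed
  then show ?thesis using sum_add_div_eq[OF assms] by simp
qed

lemma bij_betw_mult_mod:
  fixes a :: int
  assumes "q > 0" "coprime a (int q)"
  shows "bij_betw (\<lambda>r. nat ((a * int r) mod int q)) {..<q} {..<q}"
proof -
  have inj: "inj_on (\<lambda>r. nat ((a * int r) mod int q)) {..<q}"
  proof (rule inj_onI)
    fix r s assume rs: "r \<in> {..<q}" "s \<in> {..<q}"
      "nat ((a * int r) mod int q) = nat ((a * int s) mod int q)"
    then have "(a * int r) mod int q = (a * int s) mod int q"
      using assms(1) by (simp add: eq_nat_nat_iff)
    then have "int q dvd a * (int r - int s)"
      by (simp add: mod_eq_dvd_iff right_diff_distrib)
    then have "int q dvd int r - int s"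
      using assms(2) by (simp add: coprime_commute coprime_dvd_mult_right_iff)
    then have "int r mod int q = int s mod int q" by (simp add: mod_eq_dvd_iff)
    then show "r = s" using rs by (simp flip: of_nat_mod)
  qed
  have "(\<lambda>r. nat ((a * int r) mod int q)) ` {..<q} \<subseteq> {..<q}"
    using assms(1) by (auto simp: nat_less_iff)
  with inj show ?thesis
    by (simp add: bij_betw_def endo_inj_surj)
qed

text \<open>Since \<open>a\<close> is invertible modulo \<open>q\<close>, the phases
  \<open>a * r / q\<close> run through all \<open>j / q\<close> up to integers, and Hermite's
  identity applies. Perturbations of size \<open>2 / q\<close> act at worst like moving
  \<open>b\<close> by that much, hence \<open>q * b\<close> by 2: the floors are sandwiched between
  two exact sums, and the total stays bounded however large \<open>q\<close> is.\<close>

lemma sum_frac_linear_block: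
  fixes b :: real and d :: "nat \<Rightarrow> real" and a :: int
  assumes q: "q > 0" "coprime a (int q)" and d: "\<And>r. r < q \<Longrightarrow> \<bar>d r\<bar> \<le> 2 / real q"
  shows "\<bar>\<Sum>r<q. (frac (b + of_int a * real r / real q + d r) - 1 / 2)\<bar> \<le> 5"
proof -
  define j where "j = (\<lambda>r. nat ((a * int r) mod int q))"
  have bij: "bij_betw j {..<q} {..<q}" unfolding j_def by (rule bij_betw_mult_mod[OF q])
  have ar: "of_int a * real r / real q = of_int ((a * int r) div int q) + real (j r) / real q" for r
  proof -
    have "a * int r = int q * ((a * int r) div int q) + int (j r)"
      using q(1) by (simp add: j_def)
    then have "real_of_int (a * int r) = real_of_int (int q * ((a * int r) div int q) + int (j r))"
      by simp
    then show ?thesis using q(1) by (simp add: field_simps)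
  qed
  define S where "S = (\<Sum>r<q. \<lfloor>b + real (j r) / real q + d r\<rfloor>)"
  have sumj: "(\<Sum>r<q. h (j r)) = (\<Sum>i<q. h i)" for h :: "nat \<Rightarrow> 'b :: comm_monoid_add"
    using sum.reindex_bij_betw[OF bij, of h] by simp
  have S1: "S \<le> \<lfloor>real q * (b + 2 / real q)\<rfloor>"
  proof -
    have "S \<le> (\<Sum>r<q. \<lfloor>(b + 2 / real q) + real (j r) / real q\<rfloor>)"
      unfolding S_def
    proof (intro sum_mono floor_mono)
      fix r assume "r \<in> {..<q}"
      then have "d r \<le> 2 / real q" using d[of r] by auto
      then show "b + real (j r) / real q + d r \<le> b + 2 / real q + real (j r) / real q" by simp
    qed
    then show ?thesis using sumj[of "\<lambda>i. \<lfloor>(b + 2 / real q) + real i / real q\<rfloor>"]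
      sum_floor_add_divide[OF q(1), of "b + 2 / real q"] by simp
  qed
  have S2: "S \<ge> \<lfloor>real q * (b - 2 / real q)\<rfloor>"
  proof -
    have "S \<ge> (\<Sum>r<q. \<lfloor>(b - 2 / real q) + real (j r) / real q\<rfloor>)"
      unfolding S_def
    proof (intro sum_mono floor_mono)
      fix r assume "r \<in> {..<q}"
      then have "d r \<ge> - (2 / real q)" using d[of r] by auto
      then show "b + real (j r) / real q + d r \<ge> b - 2 / real q + real (j r) / real q" by simp
    qed
    then show ?thesis using sumj[of "\<lambda>i. \<lfloor>(b - 2 / real q) + real i / real q\<rfloor>"]
      sum_floor_add_divide[OF q(1), of "b - 2 / real q"] by simp
  qed
  have q1: "real q * (b + 2 / real q) = real q * b + 2" "real q * (b - 2 / real q) = real q * b - 2"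
    using q(1) by (simp_all add: field_simps)
  have dsum: "\<bar>\<Sum>r<q. d r\<bar> \<le> 2"
  proof -
    have "\<bar>\<Sum>r<q. d r\<bar> \<le> (\<Sum>r<q. 2 / real q)"
      using d by (intro sum_norm_le[where 'a = real, unfolded real_norm_def]) auto
    then show ?thesis using q(1) by simp
  qed
  \<comment> \<open>The integer \<open>(a * int r) div int q\<close> disappears inside
    \<open>frac\<close>.\<close>
  have eq: "frac (b + of_int a * real r / real q + d r) - 1 / 2 =
      (b - 1 / 2) + real (j r) / real q + d r - of_int \<lfloor>b + real (j r) / real q + d r\<rfloor>" for r
  proof -
    have "b + of_int a * real r / real q + d r =
        (b + real (j r) / real q + d r) + of_int ((a * int r) div int q)"
      unfolding ar by simp
    then show ?thesis by (simp only: frac_def floor_add_int[symmetric] of_int_add)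
  qed
  have "(\<Sum>i<q. real i / real q) = (real q - 1) / 2"
  proof -
    have "(\<Sum>i<q. real i) = real q * (real q - 1) / 2"
      by (induction q) (auto simp: field_simps)
    then show ?thesis using q(1) by (simp flip: sum_divide_distrib)
  qed
  then have "(\<Sum>r<q. (frac (b + of_int a * real r / real q + d r) - 1 / 2)) =
      real q * (b - 1 / 2) + (real q - 1) / 2 + (\<Sum>r<q. d r) - of_int S"
    unfolding eq S_def using sumj[of "\<lambda>i. real i / real q"]
    by (simp add: sum.distrib sum_subtractf)
  also have "\<dots> = (real q * b - of_int S) - 1 / 2 + (\<Sum>r<q. d r)" by (simp add: field_simps)
  finally show ?thesis using dsum S1 S2 unfolding q1 by linarith
qed

text \<open>By \<open>u / (M + r) = u / M - r * u / M\<^sup>2 + u * r\<^sup>2 / (M\<^sup>2 * (M +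
  r))\<close> the arguments are nearly linear in \<open>r\<close>. The condition on \<open>N\<close>
  makes the quadratic term at most \<open>1 / q\<close>, and replacing the slope by
  \<open>a / q\<close> costs at most another \<open>1 / q\<close>; together this is the tolerance of
  \<open>sum_frac_linear_block\<close>.\<close>

lemma sum_frac_block:
  fixes u :: real
  assumes "u > 0" "K > 0" "K \<le> M" "q > 0" "coprime a (int q)" "q \<le> N" "N > 0"
    and N: "u * real N ^ 3 \<le> real K ^ 3"
    and a: "\<bar>real q * (u / real M ^ 2) - of_int a\<bar> \<le> 1 / real N"
  shows "\<bar>\<Sum>r<q. (frac (u / real (M + r)) - 1 / 2)\<bar> \<le> 5"
proof -
  define d where "d = (\<lambda>r. u / real (M + r) - u / real M + of_int a * real r / real q)"
  have M: "real M > 0" using assms by auto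
  have dr: "\<bar>d r\<bar> \<le> 2 / real q" if r: "r < q" for r
  proof -
    have e: "d r = u * real r ^ 2 / (real M ^ 2 * real (M + r)) - real r / real q * (real q * (u / real M ^ 2) - of_int a)"
    proof -
      have "u / (real M + real r) - u / real M =
          u * real r ^ 2 / (real M ^ 2 * (real M + real r)) - real r * (u / real M ^ 2)"
        using M by (simp add: divide_simps power2_eq_square add_pos_nonneg) (simp add: algebra_simps)
      moreover have "real r / real q * (real q * (u / real M ^ 2) - of_int a) = real r * (u / real M ^ 2) - of_int a * real r / real q"
        using \<open>q > 0\<close> by (simp add: right_diff_distrib)
      ultimately show ?thesis unfolding d_def by simp
    qed
    have "u * real r ^ 2 / (real M ^ 2 * real (M + r)) \<le> u * real q ^ 2 / real K ^ 3"
    proof (rule frac_le)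
      show "u * real r ^ 2 \<le> u * real q ^ 2" using r assms by (intro mult_left_mono power_mono) auto
      have "real K ^ 2 * real K \<le> real M ^ 2 * real (M + r)"
        using assms by (intro mult_mono power_mono) auto
      then show "real K ^ 3 \<le> real M ^ 2 * real (M + r)" by (simp add: power3_eq_cube power2_eq_square)
    qed (use assms in auto)
    also have "\<dots> \<le> u * real q ^ 2 / (u * real q ^ 3)"
    proof (rule divide_left_mono)
      have "u * real q ^ 3 \<le> u * real N ^ 3" using assms by (intro mult_left_mono power_mono) auto
      then show "u * real q ^ 3 \<le> real K ^ 3" using N by linarith
    qed (use assms in auto)
    also have "\<dots> = 1 / real q" using assms by (simp add: power3_eq_cube power2_eq_square)
    finally have 1: "u * real r ^ 2 / (real M ^ 2 * real (M + r)) \<le> 1 / real q" .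
    have h1: "0 \<le> u * real r ^ 2 / (real M ^ 2 * real (M + r))" using assms by simp
    have "\<bar>real r / real q * (real q * (u / real M ^ 2) - of_int a)\<bar> \<le> 1 * (1 / real N)"
      unfolding abs_mult using a r assms by (intro mult_mono) auto
    also have "\<dots> \<le> 1 / real q" using assms by (simp add: frac_le)
    finally have 2: "\<bar>real r / real q * (real q * (u / real M ^ 2) - of_int a)\<bar> \<le> 1 / real q" .
    have "2 / real q = 1 / real q + 1 / real q" by simp
    moreover have "\<bar>x - y\<bar> \<le> 2 / real q" if "0 \<le> x" "x \<le> 1 / real q" "\<bar>y\<bar> \<le> 1 / real q" for x y
      using that calculation by linarith
    ultimately show ?thesis unfolding e using 1 h1 2 by blast
  qed
  have "\<bar>\<Sum>r<q. (frac (u / real M + of_int (- a) * real r / real q + d r) - 1 / 2)\<bar> \<le> 5"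
    using assms dr by (intro sum_frac_linear_block) auto
  moreover have "u / real M + of_int (- a) * real r / real q + d r = u / real (M + r)" for r
    by (simp add: d_def)
  ultimately show ?thesis by simp
qed

section \<open>Vinogradov's tiling of a dyadic range\<close>

text \<open>The length of a block depends on where it starts, so blocks are laid one after another;
  the leftover is shorter than one block and is bounded trivially by \<open>N\<close>. The
  separation of the starting points is kept for counting the blocks that share a
  denominator.\<close>

lemma greedy_tiling:
  fixes F :: "nat \<Rightarrow> real" and q :: "nat \<Rightarrow> nat"
  assumes F: "\<And>n. \<bar>F n\<bar> \<le> 1"
    and q: "\<And>M. m \<le> M \<Longrightarrow> M < m + L \<Longrightarrow> 0 < q M \<and> q M \<le> N \<and> \<bar>\<Sum>r<q M. F (M + r)\<bar> \<le> c"
    and c: "c \<ge> 0"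
  shows "\<exists>B \<subseteq> {m..<m + L}. (\<forall>M\<in>B. \<forall>M'\<in>B. M < M' \<longrightarrow> M + q M \<le> M') \<and>
           \<bar>\<Sum>n\<in>{m..<m + L}. F n\<bar> \<le> c * real (card B) + real N"
  using q
proof (induction L arbitrary: m rule: less_induct)
  case (less L)
  show ?case
  proof (cases "L = 0 \<or> L < q m")
    case True
    have "L \<le> N" using True less.prems[of m] by (cases "L = 0") auto
    have "\<bar>\<Sum>n\<in>{m..<m + L}. F n\<bar> \<le> (\<Sum>n\<in>{m..<m + L}. 1)"
      using F by (intro sum_norm_le[where 'a = real, unfolded real_norm_def]) auto
    then show ?thesis using \<open>L \<le> N\<close> c by (intro exI[of _ "{}"]) auto
  next
    case False
    then have L: "q m \<le> L" "L > 0" by auto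
    have qm: "0 < q m" "\<bar>\<Sum>r<q m. F (m + r)\<bar> \<le> c" using less.prems[of m] L by auto
    have "\<exists>B \<subseteq> {m + q m..<(m + q m) + (L - q m)}. (\<forall>M\<in>B. \<forall>M'\<in>B. M < M' \<longrightarrow> M + q M \<le> M') \<and>
           \<bar>\<Sum>n\<in>{m + q m..<(m + q m) + (L - q m)}. F n\<bar> \<le> c * real (card B) + real N"
      using L qm by (intro less.IH less.prems) auto
    then obtain B where B: "B \<subseteq> {m + q m..<m + L}" "\<And>M M'. M \<in> B \<Longrightarrow> M' \<in> B \<Longrightarrow> M < M' \<Longrightarrow> M + q M \<le> M'"
      "\<bar>\<Sum>n\<in>{m + q m..<m + L}. F n\<bar> \<le> c * real (card B) + real N"
      using L by auto
    have fin: "finite B" "m \<notin> B" using B(1) qm finite_subset by auto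
    have "(\<Sum>n\<in>{m..<m + L}. F n) = (\<Sum>n\<in>{m..<m + q m}. F n) + (\<Sum>n\<in>{m + q m..<m + L}. F n)"
      using L by (simp add: sum.atLeastLessThan_concat)
    moreover have "(\<Sum>n\<in>{m..<m + q m}. F n) = (\<Sum>r<q m. F (m + r))"
      using sum.shift_bounds_nat_ivl[of F 0 m "q m"] by (simp add: add.commute lessThan_atLeast0)
    ultimately have "\<bar>\<Sum>n\<in>{m..<m + L}. F n\<bar> \<le> c + (c * real (card B) + real N)"
      using qm B(3) by linarith
    also have "\<dots> = c * real (card (insert m B)) + real N" using fin by (simp add: algebra_simps)
    finally have 1: "\<bar>\<Sum>n\<in>{m..<m + L}. F n\<bar> \<le> c * real (card (insert m B)) + real N" .
    have 2: "insert m B \<subseteq> {m..<m + L}" using B(1) L by fastforce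
    have 3: "M + q M \<le> M'" if "M \<in> insert m B" "M' \<in> insert m B" "M < M'" for M M'
    proof (cases "M = m")
      case True
      then have "M' \<in> B" using that by auto
      then show ?thesis using True B(1) by auto
    next
      case False
      then have "M \<in> B" using that by auto
      moreover from this have "M' \<in> B" using that B(1) by auto
      ultimately show ?thesis using B(2) that by blast
    qed
    show ?thesis using 1 2 3 by blast
  qed
qed

text \<open>\<open>M div q\<close> is injective on a \<open>q\<close>-separated set, and its values
  span at most about \<open>L / q\<close>.\<close>

lemma card_separated_le:
  fixes S :: "nat set" and L :: real
  assumes "finite S" "q > 0" and sep: "\<And>M M'. M \<in> S \<Longrightarrow> M' \<in> S \<Longrightarrow> M < M' \<Longrightarrow> M + q \<le> M'"
    and L: "\<And>M M'. M \<in> S \<Longrightarrow> M' \<in> S \<Longrightarrow> M < M' \<Longrightarrow> real M' - real M \<le> L" "L \<ge> 0"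
  shows "real (card S) \<le> L / real q + 2"
proof (cases "S = {}")
  case True
  then show ?thesis using L by simp
next
  case False
  have lt: "M div q < M' div q" if "M \<in> S" "M' \<in> S" "M < M'" for M M'
  proof -
    have "(M + q) div q \<le> M' div q" using sep[OF that] by (rule div_le_mono)
    then show ?thesis using assms(2) by simp
  qed
  have "inj_on (\<lambda>M. M div q) S"
  proof (rule inj_onI)
    fix M M' assume "M \<in> S" "M' \<in> S" "M div q = M' div q"
    then show "M = M'" using lt[of M M'] lt[of M' M] by (cases M M' rule: linorder_cases) auto
  qed
  moreover have "(\<lambda>M. M div q) ` S \<subseteq> {Min S div q..Max S div q}"
    using assms(1) by (auto intro!: div_le_mono)
  ultimately have "card S \<le> card {Min S div q..Max S div q}" by (rule card_inj_on_le) simp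
  then have card: "card S \<le> Suc (Max S div q) - Min S div q" by simp
  have "Min S \<le> Max S" using assms(1) False by simp
  then have "Min S div q \<le> Max S div q" by (rule div_le_mono)
  with card have 1: "real (card S) \<le> real (Max S div q) - real (Min S div q) + 1"
    by linarith
  have MM: "real (Max S) - real (Min S) \<le> L"
  proof (cases "Min S = Max S")
    case False
    then have "Min S < Max S" using \<open>Min S \<le> Max S\<close> by simp
    then show ?thesis using L(1) assms(1) \<open>S \<noteq> {}\<close> by simp
  qed (use L in simp)
  have "real (Max S div q) \<le> real (Max S) / real q" by (rule of_nat_div_le_of_nat)
  moreover have "real (Min S div q) \<ge> real (Min S) / real q - 1"
    using floor_divide_of_nat_eq[of "Min S" q, where 'a = real]
      floor_correct[of "real (Min S) / real q"] by (simp only: of_int_of_nat_eq) linarith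
  moreover have "real (Max S) / real q - real (Min S) / real q \<le> L / real q"
    using MM by (simp add: divide_right_mono flip: diff_divide_distrib)
  ultimately show ?thesis using 1 by linarith
qed

text \<open>Each tile costs a constant, so it remains to count tiles. Those with the same
  approximation \<open>b / k\<close> start where \<open>u / M\<^sup>2\<close> is within
  \<open>1 / (k * N)\<close> of \<open>b / k\<close>. As \<open>u / M\<^sup>2\<close> decreases at a
  rate of order \<open>u / K ^ 3\<close> on the range, these points lie in an interval of length
  \<open>O(K ^ 3 / (u * N * k))\<close> and are \<open>k\<close>-separated. Summing over numerators
  and denominators leaves \<open>w\<close> times a harmonic sum.\<close>

lemma sum_frac_dyadic:
  fixes u w :: real
  assumes u: "u \<ge> 1" and w: "w = u powr (1 / 3)" and K: "w \<le> real K" "real K ^ 2 \<le> u"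
    and m: "K \<le> m" "m \<le> 2 * K"
  shows "\<bar>\<Sum>n\<in>{K<..m}. (frac (u / real n) - 1 / 2)\<bar> \<le> 520 * w * (1 + ln u)"
proof -
  have w1: "w \<ge> 1" unfolding w using u by (simp add: ge_one_powr_ge_zero)
  have w3: "w ^ 3 = u" unfolding w using u by (simp add: powr_powr flip: powr_realpow)
  have Kpos: "real K > 0" using K w1 by linarith
  \<comment> \<open>The longest blocks allowed: as \<open>w ^ 3 = u\<close>, this is the largest
    \<open>N\<close> with \<open>u * N ^ 3 \<le> K ^ 3\<close>.\<close>
  define N where "N = nat \<lfloor>real K / w\<rfloor>"
  have Kw: "real K / w \<ge> 1" using K w1 by simp
  have N1: "real N \<le> real K / w" using Kw by (simp add: N_def)
  have N2: "real N \<ge> real K / w / 2"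
  proof -
    have "real N > real K / w - 1" using Kw by (simp add: N_def)
    moreover have "real N \<ge> 1" using Kw by (simp add: N_def)
    moreover have "n \<ge> t / 2" if "n > t - 1" "n \<ge> 1" for n t :: real
      using that by (cases "t \<ge> 2") auto
    ultimately show ?thesis by blast
  qed
  have N0: "N > 0" using N2 Kw by (cases "N = 0") auto
  have Nw: "real N \<le> w"
  proof -
    have Nw: "real N \<le> real K / w" by fact
    also have "\<dots> \<le> (real K / w) ^ 2" using Kw by (intro self_le_power) auto
    also have "\<dots> \<le> u / w ^ 2" using K by (simp add: power_divide divide_right_mono)
    also have "\<dots> = w" using w1 by (simp flip: w3 add: power3_eq_cube power2_eq_square)
    finally show ?thesis .
  qed
  have uN: "u * real N ^ 3 \<le> real K ^ 3"
  proof -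
    have "real N ^ 3 \<le> (real K / w) ^ 3" using N1 by (intro power_mono) auto
    then have "u * real N ^ 3 \<le> u * (real K / w) ^ 3" using u by (intro mult_left_mono) auto
    also have "\<dots> = real K ^ 3" using u by (simp add: power_divide w3)
    finally show ?thesis .
  qed
  have "\<exists>a q. coprime a (int q) \<and> 0 < q \<and> q \<le> N \<and> \<bar>real q * (u / real M ^ 2) - of_int a\<bar> \<le> 1 / real N" for M
  proof -
    obtain h k where hk: "coprime h k" "0 < k" "k \<le> int N" "\<bar>real_of_int k * (u / real M ^ 2) - real_of_int h\<bar> < 1 / real N"
      using Dirichlet_approx_coprime[OF N0, of "u / real M ^ 2"] by blast
    then show ?thesis by (intro exI[of _ h] exI[of _ "nat k"]) auto
  qed
  then obtain a q where aq: "\<And>M. coprime (a M) (int (q M))" "\<And>M. 0 < q M" "\<And>M. q M \<le> N"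
    "\<And>M. \<bar>real (q M) * (u / real M ^ 2) - of_int (a M)\<bar> \<le> 1 / real N" by metis
  let ?F = "\<lambda>n. frac (u / real n) - 1 / 2"
  have "\<exists>B \<subseteq> {Suc K..<Suc K + (m - K)}. (\<forall>M\<in>B. \<forall>M'\<in>B. M < M' \<longrightarrow> M + q M \<le> M') \<and>
           \<bar>\<Sum>n\<in>{Suc K..<Suc K + (m - K)}. ?F n\<bar> \<le> 5 * real (card B) + real N"
  proof (rule greedy_tiling)
    show "\<bar>?F n\<bar> \<le> 1" for n
      using frac_ge_0[of "u / real n"] frac_lt_1[of "u / real n"] unfolding abs_le_iff by linarith
    show "0 < q M \<and> q M \<le> N \<and> \<bar>\<Sum>r<q M. ?F (M + r)\<bar> \<le> 5" if "Suc K \<le> M" for M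
      using sum_frac_block[of u K M "q M" "a M" N] aq[of M] that u Kpos N0 uN by auto
  qed auto
  moreover have ivl: "{Suc K..<Suc K + (m - K)} = {K<..m}" using m by auto
  ultimately obtain B where B: "B \<subseteq> {K<..m}" "\<And>M M'. M \<in> B \<Longrightarrow> M' \<in> B \<Longrightarrow> M < M' \<Longrightarrow> M + q M \<le> M'"
    "\<bar>\<Sum>n\<in>{K<..m}. ?F n\<bar> \<le> 5 * real (card B) + real N" unfolding ivl by blast
  have finB: "finite B" using B(1) finite_subset by auto
  \<comment> \<open>The possible numerators for denominator \<open>k\<close>: starting points exceed
    \<open>K\<close>, so \<open>u / M\<^sup>2\<close> is below \<open>u / K\<^sup>2\<close>, and the
    error of the approximation adds at most 1.\<close>
  define A where "A = (\<lambda>k::nat. {0..\<lfloor>real k * (u / real K ^ 2)\<rfloor> + 1})"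
  define cl where "cl = (\<lambda>k b. {M \<in> B. q M = k \<and> a M = b})"
  have B_sub: "B \<subseteq> (\<Union>k\<in>{1..N}. \<Union>b\<in>A k. cl k b)"
  proof
    fix M assume M: "M \<in> B"
    then have MK: "real K < real M" using B(1) by auto
    have q1: "1 / real N \<le> 1" using N0 by simp
    have "0 < real (q M) * (u / real M ^ 2)" using aq(2)[of M] u MK by simp
    then have "real_of_int (a M) > -1" using aq(4)[of M] q1 by linarith
    then have a0: "a M \<ge> 0" by linarith
    have "real (q M) * (u / real M ^ 2) \<le> real (q M) * (u / real K ^ 2)"
      using u MK Kpos by (intro mult_left_mono divide_left_mono power_mono mult_pos_pos) auto
    then have "real_of_int (a M) \<le> real (q M) * (u / real K ^ 2) + 1" using aq(4)[of M] q1 by linarith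
    then have "a M \<le> \<lfloor>real (q M) * (u / real K ^ 2) + 1\<rfloor>" by (simp only: le_floor_iff)
    then have "a M \<in> A (q M)" using a0 by (simp add: A_def)
    moreover have "q M \<in> {1..N}" using aq(2,3)[of M] by auto
    ultimately show "M \<in> (\<Union>k\<in>{1..N}. \<Union>b\<in>A k. cl k b)" using M by (auto simp: cl_def)
  qed
  have cl: "real (card (cl k b)) \<le> 16 * real K ^ 3 / (u * real N) / real k ^ 2 + 2" if k: "k \<in> {1..N}" for k b
  proof -
    define L where "L = 16 * real K ^ 3 / (u * real N * real k)"
    have "real (card (cl k b)) \<le> L / real k + 2"
    proof (rule card_separated_le)
      show "finite (cl k b)" using finB by (simp add: cl_def)
      show "k > 0" using k by simp
      show "M + k \<le> M'" if "M \<in> cl k b" "M' \<in> cl k b" "M < M'" for M M'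
        using B(2)[of M M'] that by (auto simp: cl_def)
      show "L \<ge> 0" using u by (simp add: L_def)
      fix M M' assume MM: "M \<in> cl k b" "M' \<in> cl k b" "M < M'"
      have b: "K < M" "M' \<le> 2 * K" "M < M'" using MM B(1) m by (auto simp: cl_def)
      have pos: "real M > 0" "real M' > 0" using b by auto
      have "\<bar>real k * (u / real M ^ 2) - of_int b\<bar> \<le> 1 / real N" "\<bar>real k * (u / real M' ^ 2) - of_int b\<bar> \<le> 1 / real N"
        using aq(4)[of M] aq(4)[of M'] MM by (auto simp: cl_def)
      moreover have "x - y \<le> 2 * c" if "\<bar>x - z\<bar> \<le> c" "\<bar>y - z\<bar> \<le> c" for x y z c :: real
        using that by linarith
      ultimately have 1: "real k * (u / real M ^ 2) - real k * (u / real M' ^ 2) \<le> 2 * (1 / real N)"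
        by blast
      \<comment> \<open>A lower bound for the decrease of \<open>1 / M\<^sup>2\<close>, using that
        both points are at most \<open>2 * K\<close>. Combined with the upper bound just found, it
        confines the points to a short interval.\<close>
      have "(real M' - real M) / (8 * real K ^ 3) \<le> (real M' - real M) / (real M ^ 2 * real M')"
      proof (rule divide_left_mono)
        have "real M ^ 2 * real M' \<le> (2 * real K) ^ 2 * (2 * real K)"
          using b by (intro mult_mono power_mono) auto
        then show "real M ^ 2 * real M' \<le> 8 * real K ^ 3" by (simp add: power3_eq_cube power2_eq_square)
      qed (use b pos Kpos in auto)
      also have "\<dots> = (real M' - real M) * real M' / (real M ^ 2 * real M' ^ 2)"
        using pos by (simp add: power2_eq_square)
      also have "\<dots> \<le> (real M' - real M) * (real M' + real M) / (real M ^ 2 * real M' ^ 2)"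
        using b by (intro divide_right_mono mult_left_mono) auto
      also have "\<dots> = 1 / real M ^ 2 - 1 / real M' ^ 2"
        using pos by (simp add: field_simps power2_eq_square)
      finally have "real k * u * ((real M' - real M) / (8 * real K ^ 3)) \<le> real k * u * (1 / real M ^ 2 - 1 / real M' ^ 2)"
        using u by (intro mult_left_mono) auto
      also have "\<dots> \<le> 2 / real N" using 1 by (simp add: algebra_simps)
      finally show "real M' - real M \<le> L"
        unfolding L_def using u N0 k Kpos by (simp add: field_simps)
    qed
    also have "L / real k = 16 * real K ^ 3 / (u * real N) / real k ^ 2"
      by (simp add: L_def power2_eq_square)
    finally show ?thesis .
  qed
  have cA: "real (card (A k)) \<le> real k * (u / real K ^ 2) + 2" for k
  proof -
    have "real k * (u / real K ^ 2) \<ge> 0" using u by simp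
    then have "\<lfloor>real k * (u / real K ^ 2)\<rfloor> \<ge> 0" by simp
    moreover have "real_of_int \<lfloor>real k * (u / real K ^ 2)\<rfloor> \<le> real k * (u / real K ^ 2)" by simp
    ultimately show ?thesis by (simp add: A_def)
  qed
  have fin_cl: "finite (cl k b)" for k b using finB by (simp add: cl_def)
  have "card B \<le> card (\<Union>k\<in>{1..N}. \<Union>b\<in>A k. cl k b)"
    using B_sub fin_cl by (intro card_mono finite_UN_I) (auto simp: A_def)
  also have "\<dots> \<le> (\<Sum>k\<in>{1..N}. \<Sum>b\<in>A k. card (cl k b))"
    by (intro order_trans[OF card_UN_le] sum_mono card_UN_le) (auto simp: A_def)
  finally have "real (card B) \<le> (\<Sum>k\<in>{1..N}. \<Sum>b\<in>A k. real (card (cl k b)))"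
    by (simp flip: of_nat_sum)
  also have "\<dots> \<le> (\<Sum>k\<in>{1..N}. \<Sum>b\<in>A k. 16 * real K ^ 3 / (u * real N) / real k ^ 2 + 2)"
    by (intro sum_mono cl) auto
  also have "\<dots> = (\<Sum>k\<in>{1..N}. real (card (A k)) * (16 * real K ^ 3 / (u * real N) / real k ^ 2 + 2))" by simp
  also have "\<dots> \<le> (\<Sum>k\<in>{1..N}. 96 * w * (1 / real k) + 2 * real N * (u / real K ^ 2) + 4)"
  proof (rule sum_mono)
    fix k assume k: "k \<in> {1..N}"
    then have k1: "real k \<ge> 1" "real k \<le> real N" by auto
    have a1: "16 * real K / real N \<le> 32 * w"
    proof -
      have "16 * real K \<le> 32 * w * real N" using N2 w1 by (simp add: field_simps)
      then show ?thesis using N0 by (simp add: field_simps)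
    qed
    \<comment> \<open>Here \<open>K\<^sup>2 \<le> u\<close> and \<open>N \<ge> K / (2 * w)\<close>
      enter: they bound \<open>K ^ 3 / (u * N)\<close> by \<open>2 * w\<close>.\<close>
    have a2: "32 * real K ^ 3 / (u * real N) \<le> 64 * w"
    proof -
      have "32 * real K ^ 3 = 32 * real K * real K ^ 2" by (simp add: power3_eq_cube power2_eq_square)
      also have "\<dots> \<le> 32 * real K * u" using K by (intro mult_left_mono) auto
      also have "\<dots> \<le> (64 * w * real N) * u" using N2 w1 u by (intro mult_right_mono) (auto simp: field_simps)
      finally show ?thesis using u N0 by (simp add: field_simps)
    qed
    have "1 / real k ^ 2 \<le> 1 / real k" using k1 by (simp add: field_simps power2_eq_square)
    then have b2: "32 * real K ^ 3 / (u * real N) * (1 / real k ^ 2) \<le> 64 * w * (1 / real k)"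
      using a2 u w1 by (intro mult_mono) auto
    have b1: "16 * real K / real N * (1 / real k) \<le> 32 * w * (1 / real k)"
      using a1 by (intro mult_right_mono) auto
    have b3: "2 * real k * (u / real K ^ 2) \<le> 2 * real N * (u / real K ^ 2)"
      using k1 u by (intro mult_right_mono) auto
    have c0: "16 * real K ^ 3 / (u * real N) / real k ^ 2 \<ge> 0" using u by simp
    have "real (card (A k)) * (16 * real K ^ 3 / (u * real N) / real k ^ 2 + 2)
        \<le> (real k * (u / real K ^ 2) + 2) * (16 * real K ^ 3 / (u * real N) / real k ^ 2 + 2)"
      using cA[of k] c0 by (intro mult_right_mono) auto
    also have "\<dots> = 16 * real K / real N * (1 / real k) + 32 * real K ^ 3 / (u * real N) * (1 / real k ^ 2) + 2 * real k * (u / real K ^ 2) + 4"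
    proof -
      have "real k * (u / real K ^ 2) * (16 * real K ^ 3 / (u * real N) / real k ^ 2) = 16 * real K / real N * (1 / real k)"
        using k1 u Kpos N0 by (simp add: field_simps power2_eq_square power3_eq_cube)
      moreover have "(x + 2) * (y + 2) = x * y + 2 * y + 2 * x + 4" for x y :: real
        by (simp add: algebra_simps)
      ultimately show ?thesis by simp
    qed
    also have "\<dots> \<le> 96 * w * (1 / real k) + 2 * real N * (u / real K ^ 2) + 4" using b1 b2 b3 by linarith
    finally show "real (card (A k)) * (16 * real K ^ 3 / (u * real N) / real k ^ 2 + 2) \<le>
        96 * w * (1 / real k) + 2 * real N * (u / real K ^ 2) + 4" .
  qed
  also have "\<dots> = 96 * w * harm N + real N * (2 * real N * (u / real K ^ 2) + 4)"
    by (simp add: sum.distrib harm_def inverse_eq_divide sum_distrib_left algebra_simps)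
  also have "\<dots> \<le> 96 * w * (1 + ln u) + 6 * w"
  proof -
    have "harm N - ln (real N) \<le> (harm 1 - ln (real 1) :: real)"
      using N0 by (intro euler_mascheroni_sequence_decreasing) auto
    moreover have "real N \<le> u"
    proof -
      have "real N \<le> real K" using N1 w1 Kpos divide_left_mono[of 1 w "real K"] by simp
      also have "real K \<le> real K ^ 2" using Kpos by (simp add: power2_eq_square flip: of_nat_mult)
      finally show ?thesis using K by linarith
    qed
    moreover have "ln (real N) \<le> ln u" using calculation(2) N0 u by simp
    ultimately have "harm N \<le> 1 + ln u" by (simp add: harm_expand)
    then have 1: "96 * w * harm N \<le> 96 * w * (1 + ln u)" using w1 by (intro mult_left_mono) auto
    \<comment> \<open>This is the order of the number of pairs (numerator, denominator), at most
      \<open>u / w\<^sup>2 = w\<close>.\<close>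
    have "real N * (real N * (u / real K ^ 2)) \<le> w"
    proof -
      have "real N * real N * (u / real K ^ 2) \<le> (real K / w) * (real K / w) * (u / real K ^ 2)"
        using N1 u w1 by (intro mult_mono) auto
      also have "\<dots> = u / w ^ 2" using Kpos by (simp add: field_simps power2_eq_square)
      also have "\<dots> = w" using w1 by (simp flip: w3 add: power3_eq_cube power2_eq_square)
      finally show ?thesis by (simp add: mult.assoc)
    qed
    moreover note Nw
    moreover have "real N * (2 * x + 4) = 2 * (real N * x) + 4 * real N" for x
      by (simp add: algebra_simps)
    moreover have "2 * real N * (u / real K ^ 2) = 2 * (real N * (u / real K ^ 2))" by simp
    ultimately show ?thesis using 1 by (simp only: mult.assoc)
  qed
  finally have cB: "real (card B) \<le> 96 * w * (1 + ln u) + 6 * w" .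
  have "w \<le> w * (1 + ln u)" using w1 u by (simp add: algebra_simps)
  then show ?thesis using B(3) cB w1 Nw by linarith
qed

text \<open>Terms with \<open>n\<close> up to \<open>u powr (1/3)\<close> are bounded trivially; the
  rest split into \<open>O(1 + ln u)\<close> dyadic ranges, each with one logarithm of its own from
  \<open>sum_frac_dyadic\<close>, whence the square.\<close>

lemma sum_frac_bound:
  fixes u :: real
  assumes u: "u \<ge> 1" and m: "real m ^ 2 \<le> u"
  shows "\<bar>\<Sum>n\<in>{1..m}. (frac (u / real n) - 1 / 2)\<bar> \<le> 2000 * u powr (1 / 3) * (1 + ln u) ^ 2"
proof -
  define w where "w = u powr (1 / 3)"
  define F where "F = (\<lambda>n. frac (u / real n) - 1 / 2)"
  define K where "K = nat \<lceil>w\<rceil>"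
  have w1: "w \<ge> 1" unfolding w_def using u by (simp add: ge_one_powr_ge_zero)
  have Kw: "w \<le> real K" "real K \<le> w + 1" using w1 unfolding K_def by linarith+
  have F1: "\<bar>F n\<bar> \<le> 1" for n
    using frac_ge_0[of "u / real n"] frac_lt_1[of "u / real n"] unfolding abs_le_iff F_def by linarith
  define c where "c = 520 * w * (1 + ln u)"
  have nn: "0 \<le> c" unfolding c_def using w1 u by simp
  have main: "\<bar>\<Sum>n\<in>{1..min m (K * 2 ^ i)}. F n\<bar> \<le> w + 1 + real i * c" for i
  proof (induction i)
    case 0
    have "\<bar>\<Sum>n\<in>{1..min m K}. F n\<bar> \<le> (\<Sum>n\<in>{1..min m K}. 1)"
      using F1 by (intro sum_norm_le[where 'a = real, unfolded real_norm_def]) auto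
    also have "\<dots> \<le> real K" by simp
    finally show ?case using Kw by simp
  next
    case (Suc i)
    show ?case
    proof (cases "m \<le> K * 2 ^ i")
      case True
      then have eq: "min m (K * 2 ^ Suc i) = min m (K * 2 ^ i)" by auto
      have "real i * c \<le> real (Suc i) * c"
        using nn by (intro mult_right_mono) auto
      then show ?thesis unfolding eq using Suc by linarith
    next
      case False
      define L where "L = K * 2 ^ i"
      define m' where "m' = min m (K * 2 ^ Suc i)"
      have L: "K \<le> L" "L \<le> m'" "m' \<le> 2 * L" "L < m" using False by (auto simp: L_def m'_def)
      have "real L ^ 2 \<le> real m ^ 2" using L by (intro power_mono) auto
      then have "real L ^ 2 \<le> u" using m by linarith
      then have "\<bar>\<Sum>n\<in>{L<..m'}. F n\<bar> \<le> c"
        unfolding F_def c_def using L Kw m u by (intro sum_frac_dyadic) (auto simp: w_def)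
      moreover have "(\<Sum>n\<in>{1..m'}. F n) = (\<Sum>n\<in>{1..L}. F n) + (\<Sum>n\<in>{L<..m'}. F n)"
        using L by (subst sum.union_disjoint[symmetric]) (auto intro!: sum.cong)
      moreover have "\<bar>\<Sum>n\<in>{1..L}. F n\<bar> \<le> w + 1 + real i * c"
        using Suc L by (simp add: L_def min_def split: if_splits)
      ultimately have "\<bar>\<Sum>n\<in>{1..m'}. F n\<bar> \<le> w + 1 + (real i + 1) * c"
        by (simp only: distrib_right)
      then show ?thesis by (simp add: m'_def add.commute)
    qed
  qed
  define i where "i = nat \<lceil>log 2 u\<rceil>"
  have i1: "real i \<le> 1 + 2 * ln u"
  proof -
    have "ln u / ln 2 \<le> ln u / (1 / 2)"
      using u ln2_ge_two_thirds by (intro divide_left_mono) auto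
    then have "log 2 u \<le> 2 * ln u" by (simp add: log_def)
    moreover have "log 2 u \<ge> 0" using u by simp
    ultimately show ?thesis unfolding i_def by linarith
  qed
  have "m \<le> K * 2 ^ i"
  proof -
    have "u = 2 powr log 2 u" using u by simp
    also have "\<dots> \<le> 2 powr real i"
      unfolding i_def by (intro powr_mono) linarith+
    finally have "u \<le> 2 ^ i" by (simp add: powr_realpow)
    moreover have "real m \<le> real m ^ 2" by (cases m) (auto simp: power2_eq_square)
    ultimately have "real m \<le> 2 ^ i" using m by linarith
    then have "m \<le> 2 ^ i" by (metis of_nat_le_iff of_nat_numeral of_nat_power)
    also have "\<dots> \<le> K * 2 ^ i" using Kw w1 by (cases K) auto
    finally show ?thesis .
  qed
  then have "\<bar>\<Sum>n\<in>{1..m}. F n\<bar> \<le> w + 1 + real i * c" using main[of i] by (simp add: min_def)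
  also have "\<dots> \<le> w + 1 + (1 + 2 * ln u) * c"
    using i1 nn by (intro add_left_mono mult_right_mono) auto
  also have "\<dots> \<le> 2000 * w * (1 + ln u) ^ 2"
  proof -
    define l where "l = ln u"
    have l: "l \<ge> 0" using u by (simp add: l_def)
    have "w + 1 \<le> 2 * w * (1 + l) ^ 2"
    proof -
      have "w * 1 \<le> w * (1 + l) ^ 2" using w1 l by (intro mult_left_mono) auto
      then show ?thesis using w1 by linarith
    qed
    moreover have "(1 + 2 * l) * (520 * w * (1 + l)) \<le> (2 * (1 + l)) * (520 * w * (1 + l))"
      using l w1 by (intro mult_right_mono) auto
    moreover have "w * (1 + l) ^ 2 \<ge> 0" using w1 by simp
    moreover have "(2 * (1 + l)) * (520 * w * (1 + l)) = 1040 * (w * (1 + l) ^ 2)"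
      by (simp add: power2_eq_square algebra_simps)
    ultimately show ?thesis unfolding c_def l_def[symmetric] by (simp only: mult.assoc)
  qed
  finally show ?thesis by (simp add: F_def w_def)
qed

section \<open>From the divisor sum to a sawtooth sum\<close>

definition divisor_sum :: "real \<Rightarrow> real" where
  "divisor_sum u = real (card {(m, n). m > 0 \<and> n > 0 \<and> real (m * n) \<le> u})"

definition divisor_main :: "real \<Rightarrow> real" where
  "divisor_main u = u * (ln u + 2 * euler_mascheroni - 1)"

text \<open>Dirichlet's hyperbola method: of two factors with product at most \<open>u\<close> one
  is at most \<open>sqrt u\<close>, and every pair with both factors at most \<open>N\<close>
  qualifies, so the overlap is a full square.\<close>

lemma divisor_sum_hyperbola:
  assumes u: "u \<ge> 1" and N: "N = nat \<lfloor>sqrt u\<rfloor>"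
  shows "divisor_sum u = 2 * (\<Sum>n\<in>{1..N}. of_int \<lfloor>u / real n\<rfloor>) - real N ^ 2"
proof -
  define H where "H = {(m, n). m > 0 \<and> n > 0 \<and> real (m * n) \<le> u}"
  define A where "A = {(m, n) \<in> H. m \<le> N}"
  define B where "B = {(m, n) \<in> H. n \<le> N}"
  have NN: "real N \<le> sqrt u" "sqrt u < real N + 1" unfolding N using u by auto
  have fin: "finite H" unfolding H_def by (rule finite_S_mu)
  have HAB: "H = A \<union> B"
  proof -
    have "m \<le> N \<or> n \<le> N" if "real (m * n) \<le> u" for m n
    proof (rule ccontr)
      assume "\<not> ?thesis"
      then have "real N + 1 \<le> real m" "real N + 1 \<le> real n" by auto
      then have "sqrt u < real m" "sqrt u < real n" using NN by auto
      moreover have "sqrt u \<ge> 1" using u by simp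
      ultimately have "sqrt u * sqrt u < real m * real n" by (intro mult_strict_mono) linarith+
      then show False using that u by simp
    qed
    then show ?thesis by (auto simp: A_def B_def H_def)
  qed
  have AB: "A \<inter> B = {1..N} \<times> {1..N}"
  proof -
    have "real (m * n) \<le> u" if "m \<le> N" "n \<le> N" for m n
    proof -
      have "real m * real n \<le> sqrt u * sqrt u" using that NN u by (intro mult_mono) auto
      then show ?thesis using u by simp
    qed
    then show ?thesis by (auto simp: A_def B_def H_def)
  qed
  have cA: "real (card A) = (\<Sum>n\<in>{1..N}. of_int \<lfloor>u / real n\<rfloor>)"
  proof -
    have "n \<le> nat \<lfloor>u / real m\<rfloor> \<longleftrightarrow> real (m * n) \<le> u" if "m > 0" "n > 0" for m n
    proof -
      have "n \<le> nat \<lfloor>u / real m\<rfloor> \<longleftrightarrow> int n \<le> \<lfloor>u / real m\<rfloor>" using that by linarith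
      also have "\<dots> \<longleftrightarrow> real n \<le> u / real m" by (simp add: le_floor_iff)
      also have "\<dots> \<longleftrightarrow> real (m * n) \<le> u" using that by (simp add: field_simps)
      finally show ?thesis .
    qed
    then have "A = (SIGMA m:{1..N}. {1..nat \<lfloor>u / real m\<rfloor>})"
      by (auto simp: A_def H_def Suc_le_eq simp del: of_nat_mult)
    then have "card A = (\<Sum>m\<in>{1..N}. nat \<lfloor>u / real m\<rfloor>)" by simp
    then show ?thesis using u by simp
  qed
  have "B = prod.swap ` A"
    by (auto simp: A_def B_def H_def mult.commute image_iff)
  then have cB: "card B = card A" by (simp add: card_image)
  have "card A + card B = card H + card (A \<inter> B)"
    unfolding HAB using fin HAB by (intro card_Un_Int) auto
  then have "real (card H) = 2 * real (card A) - real N ^ 2"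
    unfolding AB using cB by (simp add: power2_eq_square flip: of_nat_add of_nat_mult)
  then show ?thesis using cA by (simp add: divisor_sum_def H_def)
qed

text \<open>Since \<open>harm N\<close> is multiplied by \<open>2 * u\<close>, it must be known up
  to \<open>O(1 / u)\<close>, so its term of size \<open>1 / (2 * N)\<close> matters as well. Then
  everything that grows with \<open>u\<close>, except the sawtooth sum, cancels against
  \<open>divisor_main\<close>.\<close>

lemma divisor_sum_sawtooth:
  assumes u: "u \<ge> 1" and N: "N = nat \<lfloor>sqrt u\<rfloor>"
  shows "\<bar>divisor_sum u - divisor_main u\<bar> \<le> 2 * \<bar>\<Sum>n\<in>{1..N}. (frac (u / real n) - 1 / 2)\<bar> + 10"
proof -
  define v where "v = sqrt u"
  have v: "v \<ge> 1" "u = v ^ 2" using u by (simp_all add: v_def)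
  have NN: "real N \<le> v" "v < real N + 1" unfolding N v_def using u by auto
  have N1: "N \<ge> 1" using NN v by linarith
  \<comment> \<open>\<open>e\<close> is about \<open>1 / (2 * N)\<close>; times \<open>2 * u\<close>
    it is about \<open>v\<close> and has to cancel a term \<open>v\<close>, so bounds from both
    sides are required.\<close>
  define e where "e = (euler_mascheroni + ln (real N + 1) - harm N :: real)"
  have e: "1 / (2 * (real N + 1)) \<le> e" "e \<le> 1 / (2 * real N)"
    using euler_mascheroni_bounds[OF N1] by (auto simp: e_def inverse_eq_divide add.commute)
  \<comment> \<open>\<open>h\<close> measures the rounding in \<open>N\<close>. Expanding
    \<open>ln (1 + h / v)\<close> to second order makes the terms \<open>v * h\<close>
    cancel.\<close>
  define h where "h = real N + 1 - v"
  have h: "0 < h" "h \<le> 1" using NN by (auto simp: h_def)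
  have "(\<Sum>n\<in>{1..N}. of_int \<lfloor>u / real n\<rfloor>) = u * harm N - real N / 2 - (\<Sum>n\<in>{1..N}. (frac (u / real n) - 1 / 2))"
    by (simp add: frac_def sum_subtractf sum.distrib harm_def sum_distrib_left inverse_eq_divide)
  then have "divisor_sum u = 2 * u * harm N - real N - 2 * (\<Sum>n\<in>{1..N}. (frac (u / real n) - 1 / 2)) - real N ^ 2"
    unfolding divisor_sum_hyperbola[OF u N] by simp
  moreover have "\<bar>2 * u * harm N - real N - real N ^ 2 - divisor_main u\<bar> \<le> 10"
  proof -
    have l: "ln (real N + 1) = ln v + ln (1 + h / v)"
    proof -
      have "real N + 1 = v * (1 + h / v)" using v by (simp add: h_def field_simps)
      moreover have "1 + h / v > 0" using v h by (intro add_pos_pos) auto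
      ultimately show ?thesis using v by (simp add: ln_mult_pos)
    qed
    have hv: "0 \<le> h / v" "h / v \<le> 1" using h v by auto
    have l1: "ln (1 + h / v) \<le> h / v" using hv ln_add_one_self_le_self by auto
    have l2: "h / v - (h / v) ^ 2 \<le> ln (1 + h / v)" using hv by (intro ln_one_plus_pos_lower_bound) auto
    have a1: "v ^ 2 * ln (1 + h / v) \<le> v * h"
      using mult_left_mono[OF l1, of "v ^ 2"] v(1) by (simp add: power2_eq_square)
    have a2: "v * h - h ^ 2 \<le> v ^ 2 * ln (1 + h / v)"
      using mult_left_mono[OF l2, of "v ^ 2"] v(1) by (simp add: power2_eq_square right_diff_distrib)
    have b1: "2 * v ^ 2 * e \<le> v + 3"
    proof -
      have "2 * v ^ 2 * e \<le> 2 * v ^ 2 * (1 / (2 * real N))" using e by (intro mult_left_mono) auto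
      also have "\<dots> = v ^ 2 / real N" by simp
      also have "\<dots> \<le> (v + 3)"
      proof -
        have "v ^ 2 = v * v" by (simp add: power2_eq_square)
        also have "\<dots> \<le> (v + 3) * (v - 1) \<or> v \<le> 2" using v by (auto simp: algebra_simps)
        finally have "v ^ 2 \<le> (v + 3) * real N"
        proof
          assume "v ^ 2 \<le> (v + 3) * (v - 1)"
          also have "\<dots> \<le> (v + 3) * real N" using NN v by (intro mult_left_mono) auto
          finally show ?thesis .
        next
          assume "v \<le> 2"
          then have "v * v \<le> 2 * 2" using v by (intro mult_mono) auto
          also have "\<dots> \<le> (v + 3) * 1" using v by simp
          also have "\<dots> \<le> (v + 3) * real N" using N1 v by (intro mult_left_mono) auto
          finally show ?thesis by (simp add: power2_eq_square)
        qed
        then show ?thesis using N1 by (simp add: field_simps)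
      qed
      finally show ?thesis .
    qed
    have b2: "2 * v ^ 2 * e \<ge> v - 1"
    proof -
      have "v - 1 \<le> v ^ 2 / (v + h)"
      proof -
        have "(v - 1) * (v + h) \<le> (v - 1) * (v + 1)" using v h by (intro mult_left_mono) auto
        also have "\<dots> \<le> v ^ 2" by (simp add: algebra_simps power2_eq_square)
        finally show ?thesis using v h by (simp add: field_simps)
      qed
      also have "\<dots> = 2 * v ^ 2 * (1 / (2 * (real N + 1)))" by (simp add: h_def divide_simps)
      also have "\<dots> \<le> 2 * v ^ 2 * e" using e by (intro mult_left_mono) auto
      finally show ?thesis .
    qed
    have "ln (v * v) = ln v + ln v" using v(1) by (intro ln_mult_pos) auto
    then have lu: "ln u = 2 * ln v" by (simp only: v(2) power2_eq_square mult_2)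
    have hN: "harm N = euler_mascheroni + ln v + ln (1 + h / v) - e" using l by (simp add: e_def)
    have Nv: "real N = v + h - 1" by (simp add: h_def)
    have "2 * u * harm N - real N - real N ^ 2 - divisor_main u =
        2 * (v ^ 2 * ln (1 + h / v)) - 2 * v ^ 2 * e - (v + h - 1) * (v + h) + v ^ 2"
      unfolding divisor_main_def lu hN Nv unfolding v(2) by (simp add: algebra_simps power2_eq_square)
    also have "\<dots> = 2 * (v ^ 2 * ln (1 + h / v) - v * h) - (2 * v ^ 2 * e - v) - h ^ 2 + h"
      by (simp add: algebra_simps power2_eq_square)
    finally have eq: "2 * u * harm N - real N - real N ^ 2 - divisor_main u =
      2 * (v ^ 2 * ln (1 + h / v) - v * h) - (2 * v ^ 2 * e - v) - h ^ 2 + h" .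
    have "0 \<le> h ^ 2" "h ^ 2 \<le> 1" using h by (auto intro: power_le_one)
    moreover have "\<bar>2 * (X - Y) - (E - v) - s + h\<bar> \<le> 10"
      if "X \<le> Y" "Y - s \<le> X" "E \<le> v + 3" "v - 1 \<le> E" "0 \<le> s" "s \<le> 1" for X Y E s
      using that h by (smt (verit))
    ultimately show ?thesis unfolding eq using a1 a2 b1 b2 by blast
  qed
  ultimately show ?thesis by linarith
qed

text \<open>7/20 is 1/3 plus 1/60, where the 1/60 absorbs the squared logarithm through
  \<open>ln u \<le> 120 * u powr (1 / 120)\<close>; this is also the origin of 121.\<close>

theorem divisor_problem_bound:
  "\<exists>C\<ge>0. \<forall>u\<ge>1. \<bar>divisor_sum u - divisor_main u\<bar> \<le> C * u powr (7 / 20)"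
proof (intro exI[of _ "4000 * 121 ^ 2 + 10"] conjI allI impI)
  fix u :: real assume u: "u \<ge> 1"
  define N where "N = nat \<lfloor>sqrt u\<rfloor>"
  have "real N \<le> sqrt u" unfolding N_def using u by auto
  then have "real N ^ 2 \<le> (sqrt u) ^ 2" by (intro power_mono) auto
  then have N2: "real N ^ 2 \<le> u" using u by simp
  have p1: "u powr (7 / 20) \<ge> 1" using u by (simp add: ge_one_powr_ge_zero)
  have "ln u \<le> u powr (1 / 120) / (1 / 120)" using u by (intro ln_powr_bound) auto
  moreover have "u powr (1 / 120) \<ge> 1" using u by (simp add: ge_one_powr_ge_zero)
  ultimately have "1 + ln u \<le> 121 * u powr (1 / 120)" by simp
  then have "(1 + ln u) ^ 2 \<le> (121 * u powr (1 / 120)) ^ 2" using u by (intro power_mono) auto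
  also have "\<dots> = 121 ^ 2 * u powr (1 / 60)"
    using u by (simp add: power_mult_distrib powr_powr flip: powr_realpow)
  finally have l: "(1 + ln u) ^ 2 \<le> 121 ^ 2 * u powr (1 / 60)" .
  have "\<bar>divisor_sum u - divisor_main u\<bar> \<le> 2 * (2000 * u powr (1 / 3) * (1 + ln u) ^ 2) + 10"
    using divisor_sum_sawtooth[OF u N_def] sum_frac_bound[OF u N2] by linarith
  also have "2000 * u powr (1 / 3) * (1 + ln u) ^ 2 \<le> 2000 * u powr (1 / 3) * (121 ^ 2 * u powr (1 / 60))"
    using l by (intro mult_left_mono) auto
  also have "\<dots> = 2000 * 121 ^ 2 * u powr (7 / 20)" by (simp flip: powr_add)
  finally have "\<bar>divisor_sum u - divisor_main u\<bar> \<le> 2 * (2000 * 121 ^ 2 * u powr (7 / 20)) + 10" by simp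
  also have "\<dots> \<le> 2 * (2000 * 121 ^ 2 * u powr (7 / 20)) + 10 * u powr (7 / 20)" using p1 by simp
  finally show "\<bar>divisor_sum u - divisor_main u\<bar> \<le> (4000 * 121 ^ 2 + 10) * u powr (7 / 20)"
    by (simp add: algebra_simps)
qed simp

section \<open>Dirichlet convolution and the Moebius function\<close>


text \<open>For \<open>n = 0\<close> every \<open>d\<close> divides \<open>n\<close>, so the sum
  ranges over an infinite set and is 0 by convention. Series can therefore run over all of
  \<open>nat\<close>.\<close>

definition dirichlet_conv :: "(nat \<Rightarrow> 'a) \<Rightarrow> (nat \<Rightarrow> 'a) \<Rightarrow> nat \<Rightarrow> 'a :: comm_semiring_1" where
  "dirichlet_conv f g n = (\<Sum>d | d dvd n. f d * g (n div d))"

lemma dirichlet_conv_0 [simp]: "dirichlet_conv f g 0 = 0"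
  by (simp add: dirichlet_conv_def)

text \<open>Absolute convergence over all pairs allows regrouping along the fibres of the product
  \<open>m * n\<close>. The vanishing values at 0 confine the sum to positive pairs, where the
  fibres are finite and correspond to divisors.\<close>

lemma dirichlet_conv_has_sum:
  fixes f g :: "nat \<Rightarrow> complex"
  assumes f: "summable (\<lambda>n. norm (f n))" "f 0 = 0" and g: "summable (\<lambda>n. norm (g n))" "g 0 = 0"
  shows "(dirichlet_conv f g has_sum (suminf f * suminf g)) UNIV"
    and "(\<lambda>n. norm (dirichlet_conv f g n)) summable_on UNIV"
proof -
  define h where "h = (\<lambda>(m, n). f m * g n)"
  define S where "S = (SIGMA k:{0<..}. {d::nat. d dvd k})"
  have fs: "(f has_sum suminf f) UNIV" "((\<lambda>n. norm (f n)) has_sum suminf (\<lambda>n. norm (f n))) UNIV"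
    and gs: "(g has_sum suminf g) UNIV" "((\<lambda>n. norm (g n)) has_sum suminf (\<lambda>n. norm (g n))) UNIV"
    using f g by (auto intro!: norm_summable_imp_has_sum summable_sums intro: summable_norm_cancel)
  have "(\<lambda>p. norm (h p)) summable_on (UNIV \<times> UNIV)"
  proof (rule summable_on_SigmaI)
    show "((\<lambda>y. norm (h (x, y))) has_sum norm (f x) * suminf (\<lambda>n. norm (g n))) UNIV" for x
      unfolding h_def using has_sum_cmult_right[OF gs(2), of "norm (f x)"] by (simp add: norm_mult)
    show "(\<lambda>x. norm (f x) * suminf (\<lambda>n. norm (g n))) summable_on UNIV"
      using has_sum_cmult_left[OF fs(2)] by (rule has_sum_imp_summable)
  qed auto
  then have abs: "(\<lambda>p. norm (h p)) summable_on UNIV" by simp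
  then have "h summable_on UNIV" by (rule abs_summable_summable)
  then obtain s where s: "(h has_sum s) (UNIV \<times> UNIV)" by (auto simp: summable_on_def)
  have "((\<lambda>m. f m * suminf g) has_sum s) UNIV"
    by (rule has_sum_SigmaD[OF s]) (use has_sum_cmult_right[OF gs(1)] in \<open>simp add: h_def\<close>)
  with has_sum_cmult_left[OF fs(1)] have s_eq: "s = suminf f * suminf g"
    by (rule has_sum_unique[symmetric])
  define h' where "h' = (\<lambda>(k, d). f d * g (k div d))"
  have fin: "finite {d. d dvd k}" if "k > 0" for k :: nat using that by simp
  have S1: "(h has_sum s) ({0<..} \<times> {0<..})"
    by (rule has_sum_cong_neutral[THEN iffD2, OF _ _ _ s]) (auto simp: h_def f(2) g(2) intro!: Nat.gr0I)
  have "(h has_sum s) ({0<..} \<times> {0<..}) = (h' has_sum s) S"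
    by (rule has_sum_reindex_bij_witness[where j = "\<lambda>(m, n). (m * n, m)" and i = "\<lambda>(k, d). (d, k div d)"])
       (auto simp: S_def h_def h'_def dvd_div_eq_0_iff elim!: dvdE)
  then have h': "(h' has_sum s) S" using S1 by simp
  have "(dirichlet_conv f g has_sum s) {0<..}"
    using h' unfolding S_def
    by (rule has_sum_SigmaD) (auto simp: h'_def dirichlet_conv_def intro!: has_sum_finiteI fin)
  then show "(dirichlet_conv f g has_sum (suminf f * suminf g)) UNIV"
    unfolding s_eq by (rule has_sum_cong_neutral[THEN iffD1, rotated -1]) auto
  have "(\<lambda>p. norm (h p)) summable_on ({0<..} \<times> {0<..})"
    using abs by (rule summable_on_subset_banach) auto
  then obtain t where t: "((\<lambda>p. norm (h p)) has_sum t) ({0<..} \<times> {0<..})" by (auto simp: summable_on_def)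
  have "((\<lambda>p. norm (h p)) has_sum t) ({0<..} \<times> {0<..}) = ((\<lambda>p. norm (h' p)) has_sum t) S"
    by (rule has_sum_reindex_bij_witness[where j = "\<lambda>(m, n). (m * n, m)" and i = "\<lambda>(k, d). (d, k div d)"])
       (auto simp: S_def h_def h'_def dvd_div_eq_0_iff elim!: dvdE)
  then have "((\<lambda>p. norm (h' p)) has_sum t) S" using t by simp
  then have "((\<lambda>k. \<Sum>d | d dvd k. norm (h' (k, d))) has_sum t) {0<..}"
    unfolding S_def by (rule has_sum_SigmaD) (auto intro!: has_sum_finiteI fin)
  then have "(\<lambda>k. \<Sum>d | d dvd k. norm (h' (k, d))) summable_on {0<..}" by (rule has_sum_imp_summable)
  then have "(\<lambda>k. norm (dirichlet_conv f g k)) summable_on {0<..}"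
    by (rule summable_on_comparison_test)
       (auto simp: h'_def dirichlet_conv_def intro!: norm_sum)
  then show "(\<lambda>n. norm (dirichlet_conv f g n)) summable_on UNIV"
    by (rule summable_on_cong_neutral[THEN iffD1, rotated -1]) auto
qed

lemma dirichlet_conv_sums:
  fixes f g :: "nat \<Rightarrow> complex"
  assumes f: "summable (\<lambda>n. norm (f n))" "f 0 = 0" and g: "summable (\<lambda>n. norm (g n))" "g 0 = 0"
  shows "dirichlet_conv f g sums (suminf f * suminf g)"
    and "summable (\<lambda>n. norm (dirichlet_conv f g n))"
  using dirichlet_conv_has_sum[OF assms]
  by (auto intro: has_sum_imp_sums summable_on_imp_summable)

lemma dirichlet_conv_powr:
  fixes a b :: "nat \<Rightarrow> complex"
  shows "dirichlet_conv (\<lambda>n. a n * of_nat n powr s) (\<lambda>n. b n * of_nat n powr s) n =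
    dirichlet_conv a b n * of_nat n powr s"
proof (cases "n = 0")
  case False
  have "a d * of_nat d powr s * (b (n div d) * of_nat (n div d) powr s) = a d * b (n div d) * of_nat n powr s"
    if "d dvd n" for d
  proof -
    from that obtain k where k: "n = d * k" by (elim dvdE)
    then have "d > 0" using False by auto
    then have "of_nat n powr s = of_nat d powr s * (of_nat k powr s :: complex)"
      unfolding k by (simp add: powr_times_real)
    then show ?thesis using \<open>d > 0\<close> k by simp
  qed
  then show ?thesis
    unfolding dirichlet_conv_def sum_distrib_right by (intro sum.cong refl) blast
qed simp

section \<open>The Moebius function and its convolution square\<close>

lemma dirichlet_conv_of_int:
  "dirichlet_conv (\<lambda>n. of_int (f n)) (\<lambda>n. of_int (g n)) n = of_int (dirichlet_conv f g n)"
  by (simp add: dirichlet_conv_def)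

lemma moebius_mu_0 [simp]: "moebius_mu 0 = 0"
  by (simp add: moebius_mu_def)

lemma abs_moebius_mu_le: "\<bar>moebius_mu n\<bar> \<le> 1"
  by (simp add: moebius_mu_def)

lemma moebius_mu_prime_mult:
  assumes "prime p" "\<not> p dvd d"
  shows "moebius_mu (p * d) = - moebius_mu d"
proof -
  have cop: "coprime p d" using assms by (simp add: prime_imp_coprime)
  then have sq: "squarefree (p * d) \<longleftrightarrow> squarefree d"
    using assms(1) by (auto intro: squarefree_mult_coprime squarefree_prime dest: squarefree_multD)
  have "prime_factors (p * d) = insert p (prime_factors d)" if "d \<noteq> 0"
    using assms(1) that by (simp add: prime_factors_product prime_prime_factors prime_gt_0_nat)
  moreover have "p \<notin> prime_factors d" using assms(2) by auto
  ultimately show ?thesis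
    unfolding moebius_mu_def sq by (cases "d = 0") auto
qed

text \<open>For a prime \<open>p\<close> dividing \<open>n\<close>, the squarefree divisors pair off
  as \<open>d\<close> and \<open>p * d\<close> with \<open>p\<close> not dividing \<open>d\<close>,
  and the two values cancel.\<close>

lemma sum_moebius_mu_divisors:
  "(\<Sum>d | d dvd n. moebius_mu d) = (if n = 1 then 1 else 0)"
proof (cases "n = 0 \<or> n = 1")
  case True
  then show ?thesis by (auto simp: moebius_mu_def)
next
  case False
  then obtain p where p: "prime p" "p dvd n" using prime_factor_nat by blast
  define A where "A = {d. d dvd n \<and> squarefree d \<and> \<not> p dvd d}"
  have fin: "finite A" using False by (auto simp: A_def)
  have inj: "inj_on ((*) p) A" using p by (auto simp: inj_on_def)
  have un: "{d. d dvd n \<and> squarefree d} = A \<union> (*) p ` A"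
  proof (intro equalityI subsetI)
    fix d assume "d \<in> {d. d dvd n \<and> squarefree d}"
    then have d: "d dvd n" "squarefree d" by auto
    show "d \<in> A \<union> (*) p ` A"
    proof (cases "p dvd d")
      case True
      then obtain e where e: "d = p * e" by (elim dvdE)
      have "\<not> p dvd e"
      proof
        assume "p dvd e"
        then have "p ^ 2 dvd d" unfolding e power2_eq_square by (intro mult_dvd_mono) auto
        then have "p dvd 1" using d(2) by (rule squarefreeD[rotated])
        then show False using p by auto
      qed
      then have "e \<in> A" using d e by (auto simp: A_def dest: dvd_mult_right squarefree_multD)
      then show ?thesis using e by blast
    qed (use d in \<open>auto simp: A_def\<close>)
  next
    fix d assume "d \<in> A \<union> (*) p ` A"
    then show "d \<in> {d. d dvd n \<and> squarefree d}"
    proof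
      assume "d \<in> (*) p ` A"
      then obtain e where e: "d = p * e" "e dvd n" "squarefree e" "\<not> p dvd e" by (auto simp: A_def)
      have "coprime p e" using e p by (simp add: prime_imp_coprime)
      then show ?thesis using e p by (auto intro: divides_mult squarefree_mult_coprime squarefree_prime)
    qed (auto simp: A_def)
  qed
  have "(\<Sum>d | d dvd n. moebius_mu d) = (\<Sum>d | d dvd n \<and> squarefree d. moebius_mu d)"
    using False by (intro sum.mono_neutral_right) (auto simp: moebius_mu_def)
  also have "\<dots> = (\<Sum>d\<in>A. moebius_mu d) + (\<Sum>d\<in>(*) p ` A. moebius_mu d)"
    unfolding un by (intro sum.union_disjoint finite_imageI fin) (auto simp: A_def)
  also have "(\<Sum>d\<in>(*) p ` A. moebius_mu d) = (\<Sum>d\<in>A. - moebius_mu d)"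
    by (subst sum.reindex[OF inj]) (auto intro!: sum.cong simp: moebius_mu_prime_mult[OF p(1)] A_def)
  finally show ?thesis using False by (simp add: sum_negf)
qed

text \<open>The \<open>g\<close> of the overview; the square is meant in the sense of convolution,
  not pointwise.\<close>

definition mu_sq :: "nat \<Rightarrow> int" where
  "mu_sq = dirichlet_conv moebius_mu moebius_mu"

lemma mu_sq_0 [simp]: "mu_sq 0 = 0"
  by (simp add: mu_sq_def)

text \<open>Associativity of convolution: summing over divisors cancels one of the two Moebius
  factors.\<close>

lemma sum_mu_sq_divisors:
  assumes "n > 0"
  shows "(\<Sum>d | d dvd n. mu_sq d) = moebius_mu n"
proof -
  have fin: "finite {d. d dvd k}" if "k dvd n" for k using that assms by (auto intro: finite_divisors_nat dvd_pos_nat)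
  have "(\<Sum>d | d dvd n. mu_sq d) =
      (\<Sum>(d, e) \<in> (SIGMA d:{d. d dvd n}. {e. e dvd d}). moebius_mu e * moebius_mu (d div e))"
    unfolding mu_sq_def dirichlet_conv_def using fin by (subst sum.Sigma) auto
  also have "\<dots> = (\<Sum>(e, f) \<in> (SIGMA e:{e. e dvd n}. {f. f dvd n div e}). moebius_mu e * moebius_mu f)"
    by (rule sum.reindex_bij_witness[where i = "\<lambda>(e, f). (e * f, e)" and j = "\<lambda>(d, e). (e, d div e)"])
       (use assms in \<open>auto elim!: dvdE\<close>)
  also have "\<dots> = (\<Sum>e | e dvd n. moebius_mu e * (\<Sum>f | f dvd n div e. moebius_mu f))"
    using fin by (subst sum.Sigma[symmetric]) (auto simp: sum_distrib_left div_dvd_iff_mult elim!: dvdE)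
  also have "\<dots> = (\<Sum>e | e dvd n. moebius_mu e * (if e = n then 1 else 0))"
    unfolding sum_moebius_mu_divisors using assms by (intro sum.cong) (auto elim!: dvdE)
  also have "\<dots> = moebius_mu n" using fin by (simp add: if_distrib sum.delta cong: if_cong)
  finally show ?thesis .
qed

text \<open>Expand \<open>moebius_mu (gcd m n)\<close> as the sum of \<open>mu_sq e\<close> over
  common divisors \<open>e\<close>. The pairs divisible by \<open>e\<close> are \<open>e\<close>
  times the pairs with product at most \<open>x / e\<^sup>2\<close>, and every such \<open>e\<close>
  is at most \<open>x\<close>, hence at most \<open>N\<close>.\<close>

lemma S_mu_eq_sum:
  assumes x: "x \<le> real N"
  shows "real_of_int (S_mu x) = (\<Sum>e\<in>{1..N}. of_int (mu_sq e) * divisor_sum (x / real e ^ 2))"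
proof -
  define H where "H = (\<lambda>x. {(m, n). m > 0 \<and> n > 0 \<and> real (m * n) \<le> x})"
  have fin: "finite (H x)" for x unfolding H_def by (rule finite_S_mu)
  have le: "m \<le> N" if "(m, n) \<in> H x" for m n
  proof -
    have "m \<le> m * n" using that by (auto simp: H_def)
    moreover have "real (m * n) \<le> real N" using that x by (auto simp: H_def simp del: of_nat_mult)
    then have "m * n \<le> N" by (simp only: of_nat_le_iff)
    ultimately show ?thesis by linarith
  qed
  have "S_mu x = (\<Sum>(m, n)\<in>H x. \<Sum>e\<in>{1..N}. if e dvd m \<and> e dvd n then mu_sq e else 0)"
    unfolding S_mu_def
  proof (rule sum.cong)
    show "{(m, n). m > 0 \<and> n > 0 \<and> real (m * n) \<le> x} = H x" by (simp add: H_def)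
    fix p assume "p \<in> H x"
    then obtain m n where p: "p = (m, n)" and mn: "(m, n) \<in> H x" by (cases p) auto
    from mn have pos: "m > 0" "n > 0" by (auto simp: H_def)
    have "moebius_mu (gcd m n) = (\<Sum>d | d dvd gcd m n. mu_sq d)"
      using pos by (intro sum_mu_sq_divisors[symmetric]) auto
    also have "{d. d dvd gcd m n} = {e \<in> {1..N}. e dvd m \<and> e dvd n}"
      using pos le[OF mn] by (auto simp: Suc_le_eq dest: dvd_imp_le intro: Nat.gr0I)
    also have "(\<Sum>d\<in>\<dots>. mu_sq d) = (\<Sum>e\<in>{1..N}. if e dvd m \<and> e dvd n then mu_sq e else 0)"
      by (rule sum.inter_filter) auto
    finally show "(case p of (m, n) \<Rightarrow> moebius_mu (gcd m n)) =
        (case p of (m, n) \<Rightarrow> \<Sum>e\<in>{1..N}. if e dvd m \<and> e dvd n then mu_sq e else 0)"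
      by (simp add: p)
  qed
  also have "\<dots> = (\<Sum>e\<in>{1..N}. \<Sum>p\<in>H x. if e dvd fst p \<and> e dvd snd p then mu_sq e else 0)"
    by (subst sum.swap) (simp add: case_prod_unfold)
  also have "\<dots> = (\<Sum>e\<in>{1..N}. mu_sq e * int (card (H (x / real e ^ 2))))"
  proof (intro sum.cong refl)
    fix e assume e: "e \<in> {1..N}"
    have "{p \<in> H x. e dvd fst p \<and> e dvd snd p} = (\<lambda>(m, n). (e * m, e * n)) ` H (x / real e ^ 2)"
    proof (intro equalityI subsetI)
      fix p assume "p \<in> {p \<in> H x. e dvd fst p \<and> e dvd snd p}"
      then obtain m n where p: "p = (e * m, e * n)" "(e * m, e * n) \<in> H x" by (cases p) (auto elim!: dvdE)
      then have "(m, n) \<in> H (x / real e ^ 2)"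
        using e by (auto simp: H_def field_simps power2_eq_square)
      then show "p \<in> (\<lambda>(m, n). (e * m, e * n)) ` H (x / real e ^ 2)" using p by force
    qed (use e in \<open>auto simp: H_def field_simps power2_eq_square\<close>)
    moreover have "inj_on (\<lambda>(m, n). (e * m, e * n)) (H (x / real e ^ 2))"
      using e by (auto simp: inj_on_def)
    ultimately have "card {p \<in> H x. e dvd fst p \<and> e dvd snd p} = card (H (x / real e ^ 2))"
      by (simp add: card_image)
    then show "(\<Sum>p\<in>H x. if e dvd fst p \<and> e dvd snd p then mu_sq e else 0) = mu_sq e * int (card (H (x / real e ^ 2)))"
      using fin by (simp add: sum.inter_filter[symmetric])
  qed
  finally show ?thesis by (simp add: divisor_sum_def H_def)
qed

definition divisor_count :: "nat \<Rightarrow> nat" where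
  "divisor_count n = card {d. d dvd n}"

lemma divisor_count_0 [simp]: "divisor_count 0 = 0"
  by (simp add: divisor_count_def)

lemma divisor_sum_eq_sum:
  assumes "u \<le> real N"
  shows "divisor_sum u = (\<Sum>n\<le>N. if real n \<le> u then real (divisor_count n) else 0)"
proof -
  define H where "H = {(m, n). m > 0 \<and> n > 0 \<and> real (m * n) \<le> u}"
  define S where "S = (SIGMA k:{k. 0 < k \<and> real k \<le> u}. {d::nat. d dvd k})"
  have fin: "finite {k. 0 < k \<and> real k \<le> u}"
    by (rule finite_subset[of _ "{..N}"]) (use assms in auto)
  have "bij_betw (\<lambda>(m, n). (m * n, m)) H S"
    by (rule bij_betw_byWitness[where f' = "\<lambda>(k, d). (d, k div d)"])
       (auto simp: H_def S_def dvd_div_eq_0_iff dvd_imp_le elim!: dvdE)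
  then have "card H = card S" by (rule bij_betw_same_card)
  also have "\<dots> = (\<Sum>k | 0 < k \<and> real k \<le> u. divisor_count k)"
    unfolding S_def divisor_count_def using fin by (subst card_SigmaI) auto
  also have "\<dots> = (\<Sum>k\<in>{k\<in>{..N}. real k \<le> u}. divisor_count k)"
    using assms by (intro sum.mono_neutral_left) (auto intro: Nat.gr0I)
  also have "\<dots> = (\<Sum>n\<le>N. if real n \<le> u then divisor_count n else 0)"
    by (rule sum.inter_filter) auto
  finally show ?thesis by (simp add: divisor_sum_def H_def if_distrib cong: if_cong)
qed

section \<open>Dirichlet series\<close>

lemma norm_of_nat_powr: "n > 0 \<Longrightarrow> norm (of_nat n powr (s :: complex)) = real n powr Re s"
  by (subst norm_powr_real_powr) auto

lemma norm_of_nat_powr_le: "norm (of_nat n powr (s :: complex)) \<le> real n powr Re s"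
  by (cases "n = 0") (auto simp: norm_of_nat_powr)

text \<open>As \<open>0 powr z = 0\<close>, the term at \<open>n = 0\<close> vanishes; this is what
  lets the Dirichlet series below start at 0.\<close>

lemma zeta_sums_powr:
  assumes "Re s > 1"
  shows "(\<lambda>n. of_nat n powr - s) sums zeta s"
proof -
  have "(\<lambda>n. of_nat (Suc n) powr - s) sums zeta s"
    using zeta_sums[OF assms] by (simp only: powr_minus_divide)
  then show ?thesis by (subst (asm) sums_Suc_iff) simp
qed

lemma summable_norm_powr:
  assumes "Re s > 1"
  shows "summable (\<lambda>n. norm (of_nat n powr - s :: complex))"
proof (rule summable_comparison_test)
  show "summable (\<lambda>n. real n powr (- Re s))" using assms by (simp add: summable_real_powr_iff)
  show "\<exists>N. \<forall>n\<ge>N. norm (norm (of_nat n powr - s :: complex)) \<le> real n powr (- Re s)"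
    using norm_of_nat_powr_le[of _ "- s"] by auto
qed

lemma dirichlet_series_mult:
  fixes a b :: "nat \<Rightarrow> complex"
  assumes a: "summable (\<lambda>n. norm (a n * of_nat n powr s))" "(\<lambda>n. a n * of_nat n powr s) sums A"
    and b: "summable (\<lambda>n. norm (b n * of_nat n powr s))" "(\<lambda>n. b n * of_nat n powr s) sums B"
  shows "(\<lambda>n. dirichlet_conv a b n * of_nat n powr s) sums (A * B)"
    and "summable (\<lambda>n. norm (dirichlet_conv a b n * of_nat n powr s))"
  using dirichlet_conv_sums[OF a(1) _ b(1)] sums_unique[OF a(2)] sums_unique[OF b(2)]
  by (simp_all add: dirichlet_conv_powr[of a s b, abs_def] fun_eq_iff[symmetric] dirichlet_conv_powr)

lemma divisor_count_series:
  assumes "Re s > 1"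
  shows "(\<lambda>n. of_nat (divisor_count n) * of_nat n powr - s) sums (zeta s) ^ 2"
    and "summable (\<lambda>n. norm (of_nat (divisor_count n) * of_nat n powr - s :: complex))"
proof -
  have 1: "dirichlet_conv (\<lambda>n. 1) (\<lambda>n. 1) n = (of_nat (divisor_count n) :: complex)" for n
    by (simp add: dirichlet_conv_def divisor_count_def)
  have "summable (\<lambda>n. norm (1 * of_nat n powr - s :: complex))" "(\<lambda>n. 1 * of_nat n powr - s :: complex) sums zeta s"
    using summable_norm_powr[OF assms] zeta_sums_powr[OF assms] by simp_all
  from dirichlet_series_mult[OF this this]
  show "(\<lambda>n. of_nat (divisor_count n) * of_nat n powr - s) sums (zeta s) ^ 2"
    "summable (\<lambda>n. norm (of_nat (divisor_count n) * of_nat n powr - s :: complex))"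
    unfolding 1 by (simp_all add: power2_eq_square)
qed

lemma moebius_series_summable:
  assumes "Re s > 1"
  shows "summable (\<lambda>n. norm (of_int (moebius_mu n) * of_nat n powr - s :: complex))"
proof (rule summable_comparison_test[OF _ summable_norm_powr[OF assms]], intro exI allI impI)
  fix n
  have "real_of_int \<bar>moebius_mu n\<bar> \<le> 1" using abs_moebius_mu_le[of n] by linarith
  then show "norm (norm (of_int (moebius_mu n) * of_nat n powr - s :: complex)) \<le> norm (of_nat n powr - s :: complex)"
    using mult_right_mono[of "\<bar>real_of_int (moebius_mu n)\<bar>" 1 "norm (of_nat n powr - s :: complex)"] by (simp add: norm_mult)
qed

lemma moebius_series_aux:
  assumes "Re s > 1"
  shows "(\<Sum>n. of_int (moebius_mu n) * of_nat n powr - s) * zeta s = 1"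
proof -
  have sum: "summable (\<lambda>n. of_int (moebius_mu n) * of_nat n powr - s :: complex)"
    by (rule summable_norm_cancel[OF moebius_series_summable[OF assms]])
  have 1: "dirichlet_conv (\<lambda>n. of_int (moebius_mu n)) (\<lambda>n. 1) n = (if n = 1 then 1 else 0 :: complex)" for n
  proof (cases "n = 0")
    case False
    have "dirichlet_conv (\<lambda>n. of_int (moebius_mu n)) (\<lambda>n. 1) n = of_int (\<Sum>d | d dvd n. moebius_mu d)"
      by (simp add: dirichlet_conv_def)
    then show ?thesis unfolding sum_moebius_mu_divisors by (cases "n = 1") auto
  qed simp
  have "summable (\<lambda>n. norm (1 * of_nat n powr - s :: complex))" "(\<lambda>n. 1 * of_nat n powr - s :: complex) sums zeta s"
    using summable_norm_powr[OF assms] zeta_sums_powr[OF assms] by simp_all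
  from dirichlet_series_mult(1)[OF moebius_series_summable[OF assms] summable_sums[OF sum] this]
  have "(\<lambda>n. (if n = 1 then 1 else 0) * of_nat n powr - s) sums ((\<Sum>n. of_int (moebius_mu n) * of_nat n powr - s) * zeta s)"
    unfolding 1 .
  moreover have "(\<lambda>n. (if n = 1 then 1 else 0) * of_nat n powr - s) sums (1 :: complex)"
    using sums_single[of 1 "\<lambda>n. 1 :: complex"] by (simp add: if_distrib[of "\<lambda>x. x * _"] cong: if_cong)
  ultimately show ?thesis by (rule sums_unique2)
qed

lemma zeta_nonzero_Re_gt_1: "Re s > 1 \<Longrightarrow> zeta s \<noteq> 0"
  using moebius_series_aux[of s] by auto

lemma moebius_series:
  assumes "Re s > 1"
  shows "(\<lambda>n. of_int (moebius_mu n) * of_nat n powr - s) sums (1 / zeta s)"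
proof -
  have "(\<Sum>n. of_int (moebius_mu n) * of_nat n powr - s) = 1 / zeta s"
    using moebius_series_aux[OF assms] zeta_nonzero_Re_gt_1[OF assms] by (simp add: field_simps)
  then show ?thesis using summable_sums[OF summable_norm_cancel[OF moebius_series_summable[OF assms]]] by simp
qed

lemma mu_sq_series:
  assumes "Re s > 1"
  shows "(\<lambda>n. of_int (mu_sq n) * of_nat n powr - s) sums (1 / zeta s) ^ 2"
    and "summable (\<lambda>n. norm (of_int (mu_sq n) * of_nat n powr - s :: complex))"
proof -
  note * = moebius_series_summable[OF assms] moebius_series[OF assms]
  show "(\<lambda>n. of_int (mu_sq n) * of_nat n powr - s) sums (1 / zeta s) ^ 2"
    "summable (\<lambda>n. norm (of_int (mu_sq n) * of_nat n powr - s :: complex))"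
    using dirichlet_series_mult[OF * *] by (simp_all add: dirichlet_conv_of_int power2_eq_square mu_sq_def)
qed

lemma mu_sq_summable_real:
  assumes "c > 1"
  shows "summable (\<lambda>n. \<bar>real_of_int (mu_sq n)\<bar> * real n powr - c)"
proof -
  have "norm (of_int (mu_sq n) * of_nat n powr - complex_of_real c) = \<bar>real_of_int (mu_sq n)\<bar> * real n powr - c" for n
    by (cases "n = 0") (auto simp: norm_mult norm_of_nat_powr)
  then show ?thesis using mu_sq_series(2)[of "complex_of_real c"] assms by simp
qed

lemma divisor_count_summable_real:
  assumes "c > 1"
  shows "summable (\<lambda>n. real (divisor_count n) * real n powr - c)"
proof -
  have "norm (of_nat (divisor_count n) * of_nat n powr - complex_of_real c) = real (divisor_count n) * real n powr - c" for n
    by (cases "n = 0") (auto simp: norm_mult norm_of_nat_powr)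
  then show ?thesis using divisor_count_series(2)[of "complex_of_real c"] assms by simp
qed

text \<open>Summability at \<open>c\<close> majorises the series uniformly on the half-plane, and
  for holomorphic functions uniform convergence passes to derivatives. Applied to
  \<open>zeta\<close> itself and, at 2, to \<open>(1 / zeta s) ^ 2\<close>.\<close>

lemma dirichlet_series_deriv:
  fixes a :: "nat \<Rightarrow> complex"
  assumes a: "summable (\<lambda>n. norm (a n) * real n powr - c)" and s: "Re s > c"
    and F: "\<And>z. Re z > c \<Longrightarrow> (\<lambda>n. a n * of_nat n powr - z) sums F z"
  shows "(\<lambda>n. - (a n * of_real (ln (real n)) * of_nat n powr - s)) sums deriv F s"
proof -
  define U where "U = {z. Re z > c}"
  define f where "f = (\<lambda>N z. \<Sum>n<N. a n * of_nat n powr - z)"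
  have openU: "open U" by (simp add: U_def open_halfspace_Re_gt)
  have unif: "uniform_limit U f F sequentially"
  proof -
    have "uniform_limit U (\<lambda>N z. \<Sum>n<N. a n * of_nat n powr - z) (\<lambda>z. \<Sum>n. a n * of_nat n powr - z) sequentially"
    proof (rule Weierstrass_m_test[OF _ a])
      fix n z assume z: "z \<in> U"
      have "norm (of_nat n powr - z :: complex) \<le> real n powr - c"
      proof (cases "n = 0")
        case False
        then have "real n powr - Re z \<le> real n powr - c" using z by (intro powr_mono) (auto simp: U_def)
        then show ?thesis using False by (simp add: norm_of_nat_powr)
      qed simp
      then show "norm (a n * of_nat n powr - z) \<le> norm (a n) * real n powr - c"
        by (simp add: norm_mult mult_left_mono)
    qed
    then show ?thesis
      unfolding f_def by (rule uniform_limit_cong[THEN iffD1, rotated -1])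
        (auto simp: U_def sums_unique[OF F, symmetric])
  qed
  have der: "((\<lambda>z. a n * of_nat n powr - z) has_field_derivative - (a n * of_real (ln (real n)) * of_nat n powr - z)) (at z)" for n z
  proof (cases "n = 0")
    case False
    then have nz: "of_nat n \<noteq> (0 :: complex)" by simp
    have "((\<lambda>z. a n * exp (- z * Ln (of_nat n))) has_field_derivative (a n * (- Ln (of_nat n) * exp (- z * Ln (of_nat n))))) (at z)"
      by (auto intro!: derivative_eq_intros)
    then have "((\<lambda>z. a n * of_nat n powr - z) has_field_derivative (a n * (- Ln (of_nat n) * of_nat n powr - z))) (at z)"
      using nz by (simp add: powr_def)
    moreover have "Ln (of_nat n) = complex_of_real (ln (real n))"
      using False Ln_of_real[of "real n"] by simp
    ultimately show ?thesis by (simp add: mult.assoc)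
  qed simp
  have "f N holomorphic_on U" for N
    unfolding f_def using der by (intro holomorphic_on_sum holomorphic_onI) (auto intro: has_field_derivative_at_within simp: field_differentiable_def)
  then have "(\<lambda>N. deriv (f N) s) \<longlonglongrightarrow> deriv F s"
    using s openU unif by (intro deriv_complex_uniform_limit) (auto simp: U_def)
  moreover have "deriv (f N) s = (\<Sum>n<N. - (a n * of_real (ln (real n)) * of_nat n powr - s))" for N
    unfolding f_def by (intro DERIV_imp_deriv DERIV_sum der)
  ultimately show ?thesis by (simp add: sums_def)
qed

section \<open>The zeta function to the right of the imaginary axis\<close>

text \<open>The continuation of \<open>(s - 1) * zeta s\<close> to \<open>Re s > 0\<close>,
  including 1. The product itself has the wrong value there: it is 0 because
  \<open>zeta 1 = 0\<close> by convention, while \<open>zeta_reg 1 = 1\<close>.\<close>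

definition zeta_reg :: "complex \<Rightarrow> complex" where
  "zeta_reg s = 1 + (\<Sum>n. zeta_rem 1 n s)"

lemma zeta_rem_1:
  "zeta_rem 1 n s = of_nat (Suc (Suc n)) powr (1 - s) - of_nat (Suc n) powr (1 - s)
     - (1 - s) * of_nat (Suc n) powr - s"
proof -
  have 1: "{..1 :: nat} = {0, 1}" by auto
  have 2: "1 - s - of_nat 1 = - s" by simp
  show ?thesis unfolding zeta_rem_def 1 by (simp add: 2 del: of_nat_Suc of_nat_1 One_nat_def)
qed

lemma zeta_rem_1_bound:
  assumes "Re s \<ge> 0"
  shows "norm (zeta_rem 1 n s) \<le> norm s * norm (s - 1) * real (Suc n) powr (- Re s - 1)"
proof -
  have "(1 - s) gchoose (Suc 1) = (1 - s) * (- s) / 2"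
    by (simp add: gbinomial_prod_rev numeral_2_eq_2)
  then have "real (Suc 1) * norm ((1 - s) gchoose (Suc 1)) = norm s * norm (s - 1)"
    by (simp add: norm_mult norm_divide norm_minus_commute)
  then show ?thesis using zeta_rem_bound[of 1 s n] assms by simp
qed

lemma zeta_reg_holomorphic: "zeta_reg holomorphic_on {s. Re s > 0}"
  unfolding zeta_reg_def using zeta_rem_series_holomorphic[of 1]
  by (intro holomorphic_intros) auto

lemma zeta_reg_eq_aux:
  assumes s: "Re s > 1"
  shows "zeta_reg s = (s - 1) * zeta s"
proof -
  have "(\<lambda>n. of_nat (Suc n) powr (1 - s)) \<longlonglongrightarrow> 0"
  proof (rule tendsto_norm_zero_cancel)
    have "(\<lambda>n. real (Suc n) powr Re (1 - s)) \<longlonglongrightarrow> 0"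
      using s by (intro tendsto_neg_powr filterlim_compose[OF filterlim_real_sequentially] filterlim_Suc) auto
    then show "(\<lambda>n. norm (of_nat (Suc n) powr (1 - s))) \<longlonglongrightarrow> 0"
      by (simp only: norm_Suc_powr)
  qed
  from telescope_sums[OF this]
  have 1: "(\<lambda>n. of_nat (Suc (Suc n)) powr (1 - s) - of_nat (Suc n) powr (1 - s)) sums (-1)" by simp
  have 2: "(\<lambda>n. (1 - s) * of_nat (Suc n) powr - s) sums ((1 - s) * zeta s)"
    using zeta_sums[OF s] by (intro sums_mult) (simp only: powr_minus_divide)
  have "(\<lambda>n. zeta_rem 1 n s) sums (-1 - (1 - s) * zeta s)"
    unfolding zeta_rem_1 by (rule sums_diff[OF 1 2])
  then show ?thesis by (simp add: zeta_reg_def sums_iff algebra_simps del: One_nat_def)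
qed

lemma zeta_reg_eq:
  assumes s: "Re s > 0" "s \<noteq> 1"
  shows "zeta_reg s = (s - 1) * zeta s"
proof (rule analytic_continuation_open[where f = zeta_reg and g = "\<lambda>s. (s - 1) * zeta s" and s = "{s. Re s > 1}" and s' = "{s. Re s > 0} - {1}"])
  show "open ({s. Re s > 0} - {1 :: complex})" by (intro open_delete open_halfspace_Re_gt)
  show "connected ({s. Re s > 0} - {1 :: complex})"
    by (intro connected_open_delete open_halfspace_Re_gt convex_connected convex_halfspace_Re_gt) auto
  show "{s. 1 < Re s} \<noteq> {}" by (auto intro: exI[of _ 2])
  show "zeta_reg holomorphic_on {s. Re s > 0} - {1}"
    using zeta_reg_holomorphic by (rule holomorphic_on_subset) auto
  show "(\<lambda>s. (s - 1) * zeta s) holomorphic_on {s. Re s > 0} - {1}"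
    by (intro holomorphic_intros holomorphic_on_subset[OF zeta_holomorphic]) auto
  show "zeta_reg z = (z - 1) * zeta z" if "z \<in> {s. 1 < Re s}" for z
    using zeta_reg_eq_aux that by simp
qed (use s in \<open>auto simp: open_halfspace_Re_gt\<close>)

lemma zeta_eq_zeta_reg:
  assumes "Re s > 0" "s \<noteq> 1"
  shows "zeta s = zeta_reg s / (s - 1)"
  using zeta_reg_eq[OF assms] assms by simp

lemma zeta_1 [simp]: "zeta 1 = 0"
  using zeta_continuation_zeta by (simp add: zeta_continuation_def)

lemma zeta_reg_1 [simp]: "zeta_reg 1 = 1"
  by (simp add: zeta_reg_def zeta_rem_1 del: One_nat_def of_nat_Suc)

text \<open>The constant term of \<open>zeta\<close> at its pole, which brings
  \<open>euler_mascheroni\<close> into the main term. Termwise differentiation at 1 turns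
  \<open>zeta_rem 1 n\<close> into \<open>1 / (n + 1) - ln ((n + 2) / (n + 1))\<close>, and these
  terms sum to the constant.\<close>

lemma deriv_zeta_reg_1: "deriv zeta_reg 1 = euler_mascheroni"
proof -
  define U where "U = ball (1 :: complex) (1 / 2)"
  define f where "f = (\<lambda>N s. 1 + (\<Sum>n<N. zeta_rem 1 n s))"
  have "uniform_limit U (\<lambda>N s. \<Sum>n<N. zeta_rem 1 n s) (\<lambda>s. \<Sum>n. zeta_rem 1 n s) sequentially"
  proof (rule Weierstrass_m_test)
    fix n s assume "s \<in> U"
    then have "norm (1 - s) < 1 / 2" by (simp add: U_def dist_norm)
    then have s: "norm (s - 1) \<le> 1" "norm s \<le> 2" "Re s \<ge> 1 / 2"
      using norm_triangle_ineq2[of s 1] abs_Re_le_cmod[of "1 - s"] by (auto simp: norm_minus_commute)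
    have "norm (zeta_rem 1 n s) \<le> norm s * norm (s - 1) * real (Suc n) powr (- Re s - 1)"
      using s by (intro zeta_rem_1_bound) auto
    also have "\<dots> \<le> 2 * 1 * real (Suc n) powr (- (3 / 2))"
      using s by (intro mult_mono powr_mono) auto
    finally show "norm (zeta_rem 1 n s) \<le> 2 * real (Suc n) powr (- (3 / 2))" by simp
  qed (intro summable_mult summable_Suc_powr, simp)
  then have "uniform_limit U f zeta_reg sequentially"
    unfolding f_def zeta_reg_def by (intro uniform_limit_intros)
  moreover have "f N holomorphic_on U" for N
    unfolding f_def by (intro holomorphic_intros zeta_rem_holomorphic_aux)
  ultimately have lim: "(\<lambda>N. deriv (f N) 1) \<longlonglongrightarrow> deriv zeta_reg 1"
    by (intro deriv_complex_uniform_limit[where A = U]) (auto simp: U_def)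
  define e where "e = (\<lambda>n. inverse (real (n + 1)) + ln (real (n + 1)) - ln (real (n + 2)))"
  have der: "(zeta_rem 1 n has_field_derivative of_real (e n)) (at 1)" for n
  proof -
    have nz: "of_nat (Suc n) \<noteq> (0 :: complex)" "of_nat (Suc (Suc n)) \<noteq> (0 :: complex)" by (simp_all del: of_nat_Suc)
    have L: "Ln (of_nat (Suc n)) = complex_of_real (ln (real (Suc n)))" for n
      using Ln_of_real[of "real (Suc n)"] by simp
    have "((\<lambda>s. exp ((1 - s) * Ln (of_nat (Suc (Suc n)))) - exp ((1 - s) * Ln (of_nat (Suc n)))
       - (1 - s) * exp (- s * Ln (of_nat (Suc n)))) has_field_derivative
        (- Ln (of_nat (Suc (Suc n))) + Ln (of_nat (Suc n)) + exp (- Ln (of_nat (Suc n))))) (at 1)"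
      by (auto intro!: derivative_eq_intros simp del: of_nat_Suc)
    moreover have "exp (- Ln (of_nat (Suc n))) = inverse (of_nat (Suc n) :: complex)"
      by (simp only: exp_minus exp_Ln[OF nz(1)])
    then have "- Ln (of_nat (Suc (Suc n))) + Ln (of_nat (Suc n)) + exp (- Ln (of_nat (Suc n))) = complex_of_real (e n)"
      unfolding L by (simp add: e_def)
    moreover have "zeta_rem 1 n = (\<lambda>s. exp ((1 - s) * Ln (of_nat (Suc (Suc n)))) - exp ((1 - s) * Ln (of_nat (Suc n)))
       - (1 - s) * exp (- s * Ln (of_nat (Suc n))))"
      using nz by (intro ext) (simp add: zeta_rem_1 powr_def del: of_nat_Suc One_nat_def)
    ultimately show ?thesis by (simp only:)
  qed
  have "(f N has_field_derivative (0 + (\<Sum>n<N. of_real (e n)))) (at 1)" for N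
    unfolding f_def by (intro DERIV_add DERIV_const DERIV_sum der)
  then have "deriv (f N) 1 = (\<Sum>n<N. of_real (e n))" for N
    using DERIV_imp_deriv by fastforce
  then have "(\<lambda>n. complex_of_real (e n)) sums deriv zeta_reg 1" using lim by (simp add: sums_def)
  moreover have "(\<lambda>n. complex_of_real (e n)) sums of_real euler_mascheroni"
    unfolding e_def by (intro sums_of_real euler_mascheroni_sum_real)
  ultimately show ?thesis using sums_unique2 by fastforce
qed

lemma zeta_reg_bound:
  "\<exists>K>0. \<forall>s. Re s \<ge> 1 / 2 \<longrightarrow> norm (zeta_reg s) \<le> 1 + K * norm s * norm (s - 1)"
proof -
  define K where "K = (\<Sum>n. real (Suc n) powr - (3 / 2))"
  have sumK: "summable (\<lambda>n. real (Suc n) powr - (3 / 2))" by (rule summable_Suc_powr) simp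
  have "norm (zeta_reg s) \<le> 1 + (K + 1) * norm s * norm (s - 1)" if s: "Re s \<ge> 1 / 2" for s
  proof -
    have b: "norm (zeta_rem 1 n s) \<le> norm s * norm (s - 1) * real (Suc n) powr - (3 / 2)" for n
    proof -
      have "norm (zeta_rem 1 n s) \<le> norm s * norm (s - 1) * real (Suc n) powr (- Re s - 1)"
        using s by (intro zeta_rem_1_bound) auto
      also have "\<dots> \<le> norm s * norm (s - 1) * real (Suc n) powr - (3 / 2)"
        using s by (intro mult_left_mono powr_mono) auto
      finally show ?thesis .
    qed
    have sm: "summable (\<lambda>n. norm s * norm (s - 1) * real (Suc n) powr - (3 / 2))"
      using sumK by (rule summable_mult)
    have "norm (\<Sum>n. zeta_rem 1 n s) \<le> (\<Sum>n. norm s * norm (s - 1) * real (Suc n) powr - (3 / 2))"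
      by (rule norm_suminf_le[OF b sm])
    also have "\<dots> = norm s * norm (s - 1) * K" unfolding K_def using sumK by (rule suminf_mult)
    finally have "norm (zeta_reg s) \<le> 1 + norm s * norm (s - 1) * K"
      unfolding zeta_reg_def using norm_triangle_ineq[of 1 "\<Sum>n. zeta_rem 1 n s"] by simp
    also have "\<dots> \<le> 1 + (K + 1) * norm s * norm (s - 1)" by (simp add: algebra_simps)
    finally show ?thesis .
  qed
  moreover have "K + 1 > 0" unfolding K_def using suminf_nonneg[OF sumK] by simp
  ultimately show ?thesis by blast
qed

section \<open>Non-vanishing on the line of real part one\<close>

text \<open>Writing \<open>f = (s - z) ^ k * g\<close> with \<open>g\<close> nonvanishing near
  \<open>z\<close> gives \<open>f' / f = k / (s - z) + g' / g\<close>, so the limit is the order of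
  vanishing. The point \<open>w\<close> rules out that \<open>f\<close> is identically 0.\<close>

lemma log_deriv_limit:
  assumes f: "f holomorphic_on S" and S: "open S" "connected S" "z \<in> S" and w: "w \<in> S" "f w \<noteq> 0"
  shows "\<exists>k::nat. ((\<lambda>s. (s - z) * (deriv f s / f s)) \<longlongrightarrow> of_nat k) (at z) \<and> (f z = 0 \<longrightarrow> k > 0)"
proof -
  have "\<exists>(k::nat) r g. 0 < r \<and> ball z r \<subseteq> S \<and> g holomorphic_on ball z r \<and> (f z = 0 \<longrightarrow> k > 0) \<and>
      (\<forall>s\<in>ball z r. f s = (s - z) ^ k * g s \<and> g s \<noteq> 0)"
  proof (cases "f z = 0")
    case True
    have "\<not> f constant_on S" using True w S by (metis constant_on_def)
    from holomorphic_factor_zero_nonconstant[OF f S True this]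
    obtain g r n where "0 < n" "0 < r" "ball z r \<subseteq> S" "g holomorphic_on ball z r"
      "\<And>s. s \<in> ball z r \<Longrightarrow> f s = (s - z) ^ n * g s" "\<And>s. s \<in> ball z r \<Longrightarrow> g s \<noteq> 0" by metis
    then show ?thesis by (intro exI[of _ n] exI[of _ r] exI[of _ g]) auto
  next
    case False
    have "isCont f z"
      using holomorphic_on_imp_continuous_on[OF f] S by (simp add: continuous_on_eq_continuous_at)
    then obtain r1 where r1: "r1 > 0" "\<And>s. dist s z < r1 \<Longrightarrow> f s \<noteq> 0"
      using False continuous_at_avoid[of z f 0] by (metis dist_commute)
    obtain r2 where r2: "r2 > 0" "ball z r2 \<subseteq> S" using S openE by blast
    show ?thesis using r1 r2 False holomorphic_on_subset[OF f]
      by (intro exI[of _ 0] exI[of _ "min r1 r2"] exI[of _ f]) (auto simp: dist_commute subset_iff)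
  qed
  then obtain k r g where r: "0 < r" "ball z r \<subseteq> S" and g: "g holomorphic_on ball z r"
    and k: "f z = 0 \<longrightarrow> k > 0" and fg: "\<And>s. s \<in> ball z r \<Longrightarrow> f s = (s - z) ^ k * g s"
    and gnz: "\<And>s. s \<in> ball z r \<Longrightarrow> g s \<noteq> 0" by blast
  have eq: "(s - z) * (deriv f s / f s) = of_nat k + (s - z) * (deriv g s / g s)"
    if s: "s \<in> ball z r" "s \<noteq> z" for s
  proof -
    have "(g has_field_derivative deriv g s) (at s)" using g s(1) by (intro holomorphic_derivI) auto
    then have "((\<lambda>s. (s - z) ^ k * g s) has_field_derivative
        (of_nat k * (s - z) ^ (k - 1) * g s + (s - z) ^ k * deriv g s)) (at s)"
      by (auto intro!: derivative_eq_intros)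
    then have "(f has_field_derivative (of_nat k * (s - z) ^ (k - 1) * g s + (s - z) ^ k * deriv g s)) (at s)"
      by (rule has_field_derivative_transform_within_open[where S = "ball z r"]) (use s fg in auto)
    then have d: "deriv f s = of_nat k * (s - z) ^ (k - 1) * g s + (s - z) ^ k * deriv g s" by (rule DERIV_imp_deriv)
    have "(s - z) * deriv f s = (of_nat k * g s + (s - z) * deriv g s) * (s - z) ^ k"
      unfolding d by (cases k) (auto simp: algebra_simps)
    then show ?thesis using s gnz[OF s(1)] fg[OF s(1)] by (simp add: divide_simps)
  qed
  have "isCont (\<lambda>s. of_nat k + (s - z) * (deriv g s / g s)) z"
  proof -
    have "isCont (deriv g) z" "isCont g z"
      using holomorphic_on_imp_continuous_on[OF holomorphic_deriv[OF g open_ball]]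
        holomorphic_on_imp_continuous_on[OF g] r by (auto simp: continuous_on_eq_continuous_at)
    then show ?thesis using gnz[of z] r by (intro continuous_intros) auto
  qed
  then have "((\<lambda>s. of_nat k + (s - z) * (deriv g s / g s)) \<longlongrightarrow> of_nat k) (at z)"
    unfolding isCont_def by simp
  moreover have "eventually (\<lambda>s. of_nat k + (s - z) * (deriv g s / g s) = (s - z) * (deriv f s / f s)) (at z)"
    using eventually_at_ball'[OF r(1), of z UNIV]
  proof eventually_elim
    case (elim s)
    then have "s \<in> ball z r" "s \<noteq> z" by auto
    from eq[OF this] show ?case by (rule sym)
  qed
  ultimately have "((\<lambda>s. (s - z) * (deriv f s / f s)) \<longlongrightarrow> of_nat k) (at z)"
    by (rule Lim_transform_eventually)
  then show ?thesis using k by blast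
qed

section \<open>The logarithmic derivative of zeta\<close>

lemma mangoldt_le_ln: "n > 0 \<Longrightarrow> mangoldt n \<le> ln (real n)"
proof -
  assume n: "n > 0"
  have "mangoldt n \<le> (\<Sum>d | d dvd n. mangoldt d :: real)"
    using n by (intro member_le_sum) (auto simp: mangoldt_nonneg)
  then show ?thesis using mangoldt_sum[of n, where 'a = real] n by simp
qed

lemma ln_series_summable:
  assumes "\<sigma> > 1"
  shows "summable (\<lambda>n. ln (real n) * real n powr - \<sigma>)"
proof (rule summable_comparison_test)
  define a where "a = (\<sigma> - 1) / 2"
  have a: "a > 0" using assms by (simp add: a_def)
  show "summable (\<lambda>n. 1 / a * real n powr (a - \<sigma>))"
    using assms by (intro summable_mult) (auto simp: summable_real_powr_iff a_def field_simps)
  have "norm (ln (real n) * real n powr - \<sigma>) \<le> 1 / a * real n powr (a - \<sigma>)" for n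
  proof (cases "n = 0")
    case False
    then have "ln (real n) \<le> real n powr a / a" using a by (intro ln_powr_bound) auto
    then have "ln (real n) * real n powr - \<sigma> \<le> real n powr a / a * real n powr - \<sigma>" by (rule mult_right_mono) auto
    then show ?thesis using False by (simp add: powr_diff powr_minus field_simps)
  qed simp
  then show "\<exists>N. \<forall>n\<ge>N. norm (ln (real n) * real n powr - \<sigma>) \<le> 1 / a * real n powr (a - \<sigma>)" by blast
qed

text \<open>Convolving \<open>mangoldt\<close> with 1 gives \<open>ln\<close>, whose Dirichlet
  series is the termwise derivative \<open>- deriv zeta\<close>.\<close>

lemma mangoldt_series:
  assumes s: "Re s > 1"
  shows "(\<lambda>n. mangoldt n * of_nat n powr - s) sums (- deriv zeta s / zeta s)"
proof -
  have sm: "summable (\<lambda>n. norm (mangoldt n * of_nat n powr - s :: complex))"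
  proof (rule summable_comparison_test[OF _ ln_series_summable[OF s]])
    have "norm (norm (mangoldt n * of_nat n powr - s :: complex)) \<le> ln (real n) * real n powr - Re s" for n
      using mangoldt_le_ln[of n] mult_right_mono[of "mangoldt n :: real" "ln (real n)" "real n powr - Re s"]
      by (cases "n = 0") (auto simp: norm_mult norm_of_nat_powr mangoldt_nonneg)
    then show "\<exists>N. \<forall>n\<ge>N. norm (norm (mangoldt n * of_nat n powr - s :: complex)) \<le> ln (real n) * real n powr - Re s"
      by blast
  qed
  define L where "L = (\<Sum>n. mangoldt n * of_nat n powr - s)"
  have L: "(\<lambda>n. mangoldt n * of_nat n powr - s) sums L"
    unfolding L_def by (rule summable_sums[OF summable_norm_cancel[OF sm]])
  have "summable (\<lambda>n. norm (1 * of_nat n powr - s :: complex))" "(\<lambda>n. 1 * of_nat n powr - s :: complex) sums zeta s"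
    using summable_norm_powr[OF s] zeta_sums_powr[OF s] by simp_all
  from dirichlet_series_mult(1)[OF sm L this]
  have "(\<lambda>n. dirichlet_conv mangoldt (\<lambda>n. 1) n * of_nat n powr - s) sums (L * zeta s)" .
  moreover have "dirichlet_conv mangoldt (\<lambda>n. 1) n = complex_of_real (ln (real n))" for n
    using mangoldt_sum[of n, where 'a = complex] by (cases "n = 0") (auto simp: dirichlet_conv_def)
  ultimately have 1: "(\<lambda>n. of_real (ln (real n)) * of_nat n powr - s) sums (L * zeta s)" by simp
  define c where "c = (1 + Re s) / 2"
  have c: "c > 1" "Re s > c" using s by (auto simp: c_def field_simps)
  have "(\<lambda>n. - (1 * of_real (ln (real n)) * of_nat n powr - s)) sums deriv zeta s"
    by (rule dirichlet_series_deriv[where c = c])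
       (use c zeta_sums_powr in \<open>auto simp: summable_real_powr_iff\<close>)
  from sums_unique2[OF sums_minus[OF this]] 1 have "- deriv zeta s = L * zeta s" by auto
  then have "L = - deriv zeta s / zeta s" using zeta_nonzero_Re_gt_1[OF s] by (simp add: field_simps)
  then show ?thesis using L by simp
qed

lemma zeta_log_deriv_limit:
  assumes z: "Re z > 0" "z \<noteq> 1"
  shows "\<exists>k::nat. ((\<lambda>s. (s - z) * (deriv zeta s / zeta s)) \<longlongrightarrow> of_nat k) (at z) \<and> (zeta z = 0 \<longrightarrow> k > 0)"
proof (rule log_deriv_limit)
  show "zeta holomorphic_on {s. Re s > 0} - {1}"
    using zeta_holomorphic by (rule holomorphic_on_subset) auto
  show "open ({s. Re s > 0} - {1 :: complex})" by (intro open_delete open_halfspace_Re_gt)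
  show "connected ({s. Re s > 0} - {1 :: complex})"
    by (intro connected_open_delete open_halfspace_Re_gt convex_connected convex_halfspace_Re_gt) auto
  show "zeta 2 \<noteq> 0" by (rule zeta_nonzero_Re_gt_1) simp
qed (use z in auto)

lemma zeta_log_deriv_limit_1:
  "((\<lambda>s. (s - 1) * (deriv zeta s / zeta s)) \<longlongrightarrow> -1) (at 1)"
proof -
  have reg: "isCont (\<lambda>s. (s - 1) * (deriv zeta_reg s / zeta_reg s) - 1) 1"
  proof -
    have o: "open {s. Re s > 0}" by (rule open_halfspace_Re_gt)
    have "isCont (deriv zeta_reg) 1" "isCont zeta_reg 1"
      using holomorphic_on_imp_continuous_on[OF holomorphic_deriv[OF zeta_reg_holomorphic o]]
        holomorphic_on_imp_continuous_on[OF zeta_reg_holomorphic] o by (auto simp: continuous_on_eq_continuous_at)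
    then show ?thesis by (intro continuous_intros) auto
  qed
  then have "((\<lambda>s. (s - 1) * (deriv zeta_reg s / zeta_reg s) - 1) \<longlongrightarrow> -1) (at 1)"
    unfolding isCont_def by simp
  moreover have "eventually (\<lambda>s. (s - 1) * (deriv zeta_reg s / zeta_reg s) - 1 = (s - 1) * (deriv zeta s / zeta s)) (at 1)"
  proof -
    have "isCont zeta_reg 1"
      using holomorphic_on_imp_continuous_on[OF zeta_reg_holomorphic]
      by (auto simp: continuous_on_eq_continuous_at open_halfspace_Re_gt)
    then have "(zeta_reg \<longlongrightarrow> 1) (at 1)" unfolding isCont_def by simp
    then have "eventually (\<lambda>s. zeta_reg s \<noteq> 0) (at 1)" by (rule tendsto_imp_eventually_ne) simp
    moreover have "eventually (\<lambda>s. s \<in> {s. Re s > 0} \<and> s \<noteq> 1) (at 1)"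
      using eventually_at_in_open[OF open_halfspace_Re_gt[of 0], of 1] by (auto elim: eventually_mono)
    ultimately show ?thesis
    proof eventually_elim
      case (elim s)
      then have s: "Re s > 0" "s \<noteq> 1" "zeta_reg s \<noteq> 0" by auto
      have "(zeta_reg has_field_derivative deriv zeta_reg s) (at s)"
        using s by (intro holomorphic_derivI[OF zeta_reg_holomorphic open_halfspace_Re_gt]) auto
      then have "((\<lambda>s. zeta_reg s / (s - 1)) has_field_derivative
          (deriv zeta_reg s * (s - 1) - zeta_reg s) / (s - 1) ^ 2) (at s)"
        using s by (auto intro!: derivative_eq_intros simp: power2_eq_square)
      then have "(zeta has_field_derivative (deriv zeta_reg s * (s - 1) - zeta_reg s) / (s - 1) ^ 2) (at s)"
        by (rule has_field_derivative_transform_within_open[where S = "{s. Re s > 0} - {1}"])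
           (use s zeta_eq_zeta_reg in \<open>auto intro: open_delete open_halfspace_Re_gt\<close>)
      then have "deriv zeta s = (deriv zeta_reg s * (s - 1) - zeta_reg s) / (s - 1) ^ 2" by (rule DERIV_imp_deriv)
      then show ?case unfolding zeta_eq_zeta_reg[OF s(1,2)] using s(2,3)
        by (simp add: divide_simps power2_eq_square) (simp add: algebra_simps)
    qed
  qed
  ultimately show ?thesis by (rule Lim_transform_eventually)
qed

text \<open>The classical \<open>3 + 4 cos \<theta> + cos 2\<theta> \<ge> 0\<close> argument.\<close>

lemma zeta_nonzero_Re_eq_1:
  assumes t: "t \<noteq> 0"
  shows "zeta (Complex 1 t) \<noteq> 0"
proof
  assume z: "zeta (Complex 1 t) = 0"
  have ne: "Complex 1 t \<noteq> 1" "Complex 1 (2 * t) \<noteq> 1" using t by (auto simp: complex_eq_iff)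
  obtain k1 where k1: "((\<lambda>s. (s - Complex 1 t) * (deriv zeta s / zeta s)) \<longlongrightarrow> of_nat k1) (at (Complex 1 t))" "k1 > 0"
    using zeta_log_deriv_limit[OF _ ne(1)] z by auto
  obtain k2 :: nat where k2: "((\<lambda>s. (s - Complex 1 (2 * t)) * (deriv zeta s / zeta s)) \<longlongrightarrow> of_nat k2) (at (Complex 1 (2 * t)))"
    using zeta_log_deriv_limit[OF _ ne(2)] by auto
  define L where "L = (\<lambda>s. - deriv zeta s / zeta s)"
  have flt: "filterlim (\<lambda>d. Complex (1 + d) t) (at (Complex 1 t)) (at_right 0)" for t
    unfolding filterlim_at
    by (auto simp: eventually_at_filter complex_eq_iff intro!: tendsto_Complex tendsto_eq_intros)
  have lim: "((\<lambda>d. d * Re (L (Complex (1 + d) t))) \<longlongrightarrow> - Re c) (at_right 0)"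
    if "((\<lambda>s. (s - Complex 1 t) * (deriv zeta s / zeta s)) \<longlongrightarrow> c) (at (Complex 1 t))" for t c
  proof -
    have "((\<lambda>d. Re ((Complex (1 + d) t - Complex 1 t) * (deriv zeta (Complex (1 + d) t) / zeta (Complex (1 + d) t)))) \<longlongrightarrow> Re c) (at_right 0)"
      by (intro tendsto_Re filterlim_compose[OF that flt])
    moreover have "Complex (1 + d) t - Complex 1 t = of_real d" for d by (simp add: complex_eq_iff)
    moreover have "Re (of_real d * q) = d * Re q" for d q by simp
    ultimately have "((\<lambda>d. d * Re (deriv zeta (Complex (1 + d) t) / zeta (Complex (1 + d) t))) \<longlongrightarrow> Re c) (at_right 0)"
      by (simp only:)
    from tendsto_minus[OF this] show ?thesis by (simp add: L_def)
  qed
  \<comment> \<open>The pole at 1 contributes 3, a zero of order \<open>k1\<close> at height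
    \<open>t\<close> contributes \<open>- 4 * k1\<close>, and height \<open>2 * t\<close>
    contributes \<open>- k2\<close>. The limit is negative as soon as
    \<open>k1 \<ge> 1\<close>.\<close>
  have "((\<lambda>d. 3 * (d * Re (L (Complex (1 + d) 0))) + 4 * (d * Re (L (Complex (1 + d) t))) + d * Re (L (Complex (1 + d) (2 * t))))
      \<longlongrightarrow> 3 * - Re (-1) + 4 * - Re (of_nat k1) + - Re (of_nat k2)) (at_right 0)"
    by (intro tendsto_intros lim k1 k2) (use zeta_log_deriv_limit_1 in \<open>simp add: one_complex.code\<close>)
  moreover have "eventually (\<lambda>d. 3 * (d * Re (L (Complex (1 + d) 0))) + 4 * (d * Re (L (Complex (1 + d) t))) + d * Re (L (Complex (1 + d) (2 * t))) \<ge> 0) (at_right 0)"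
    unfolding eventually_at_filter
  proof (intro always_eventually allI impI)
    fix d :: real assume "d \<noteq> 0" "d \<in> {0<..}"
    then have d: "d > 0" by auto
    have tm: "Re (mangoldt n * of_nat n powr - Complex (1 + d) t) = mangoldt n * real n powr - (1 + d) * cos (t * ln (real n))" for n t
    proof (cases "n = 0")
      case False
      have "of_nat n powr - Complex (1 + d) t = exp (- Complex (1 + d) t * of_real (ln (real n)))"
        using False Ln_of_real[of "real n"] by (simp add: powr_def)
      also have "Re \<dots> = real n powr - (1 + d) * cos (t * ln (real n))"
        using False by (simp add: Re_exp powr_def algebra_simps)
      finally have "Re (of_real (mangoldt n) * of_nat n powr - Complex (1 + d) t) = mangoldt n * (real n powr - (1 + d) * cos (t * ln (real n)))"
        by simp
      then show ?thesis by simp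
    qed simp
    have ser: "(\<lambda>n. mangoldt n * real n powr - (1 + d) * cos (t * ln (real n))) sums Re (L (Complex (1 + d) t))" for t
    proof -
      have "Re (Complex (1 + d) t) > 1" using d by simp
      from sums_Re[OF mangoldt_series[OF this]] show ?thesis unfolding tm L_def .
    qed
    have sm: "(\<lambda>n. 3 * (mangoldt n * real n powr - (1 + d) * cos (0 * ln (real n))) + 4 * (mangoldt n * real n powr - (1 + d) * cos (t * ln (real n)))
        + mangoldt n * real n powr - (1 + d) * cos (2 * t * ln (real n)))
      sums (3 * Re (L (Complex (1 + d) 0)) + 4 * Re (L (Complex (1 + d) t)) + Re (L (Complex (1 + d) (2 * t))))"
      by (intro sums_add sums_mult ser)
    have nn: "3 * (mangoldt n * real n powr - (1 + d) * cos (0 * ln (real n))) + 4 * (mangoldt n * real n powr - (1 + d) * cos (t * ln (real n)))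
        + mangoldt n * real n powr - (1 + d) * cos (2 * t * ln (real n)) \<ge> 0" for n
    proof -
      define c where "c = cos (t * ln (real n))"
      have 2: "cos (2 * t * ln (real n)) = 2 * c ^ 2 - 1" unfolding c_def using cos_double_cos[of "t * ln (real n)"] by (simp add: mult.assoc)
      have "3 * (m * 1) + 4 * (m * c) + m * (2 * c ^ 2 - 1) = 2 * m * (1 + c) ^ 2" for m c :: real
        by (simp add: power2_eq_square algebra_simps)
      then have "3 * (mangoldt n * real n powr - (1 + d) * cos (0 * ln (real n))) + 4 * (mangoldt n * real n powr - (1 + d) * cos (t * ln (real n)))
        + mangoldt n * real n powr - (1 + d) * cos (2 * t * ln (real n)) = 2 * (mangoldt n * real n powr - (1 + d)) * (1 + c) ^ 2"
        unfolding 2 c_def[symmetric] by (simp only: mult_zero_left cos_zero)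
      then show ?thesis by (simp add: mangoldt_nonneg)
    qed
    have "0 \<le> 3 * Re (L (Complex (1 + d) 0)) + 4 * Re (L (Complex (1 + d) t)) + Re (L (Complex (1 + d) (2 * t)))"
      by (rule sums_le[OF nn sums_zero sm])
    then have "0 \<le> d * (3 * Re (L (Complex (1 + d) 0)) + 4 * Re (L (Complex (1 + d) t)) + Re (L (Complex (1 + d) (2 * t))))"
      using d by simp
    then show "3 * (d * Re (L (Complex (1 + d) 0))) + 4 * (d * Re (L (Complex (1 + d) t))) + d * Re (L (Complex (1 + d) (2 * t))) \<ge> 0"
      by (simp add: algebra_simps)
  qed
  ultimately have "0 \<le> 3 * - Re (-1) + 4 * - Re (of_nat k1) + - Re (of_nat k2)"
    by (rule tendsto_lowerbound) simp
  then show False using k1(2) by simp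
qed

section \<open>Logarithmic growth of zeta under the Riemann Hypothesis\<close>

text \<open>The map \<open>w \<mapsto> w / (2 * B - w)\<close> sends the half-plane
  \<open>Re w < B\<close> into the unit disc and fixes 0, so Schwarz's lemma applies to its
  composition with \<open>f - f z0\<close>, rescaled to the unit disc.\<close>

lemma Borel_Caratheodory:
  assumes f: "f holomorphic_on ball z0 R" and R: "R > 0"
    and A: "\<And>z. z \<in> ball z0 R \<Longrightarrow> Re (f z) < A" and r: "0 \<le> r" "r < 1"
    and z: "norm (z - z0) \<le> r * R"
  shows "norm (f z - f z0) \<le> 2 * (A - Re (f z0)) * r / (1 - r)"
proof -
  define B where "B = A - Re (f z0)"
  define \<phi> where "\<phi> = (\<lambda>w. f (z0 + of_real R * w) - f z0)"
  define g where "g = (\<lambda>w. \<phi> w / (2 * of_real B - \<phi> w))"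
  have B: "B > 0" using A[of z0] R by (simp add: B_def)
  have inb: "z0 + of_real R * w \<in> ball z0 R" if "norm w < 1" for w
    using that R by (simp add: dist_norm norm_mult)
  have \<phi>B: "Re (\<phi> w) < B" if "norm w < 1" for w
    using A[OF inb[OF that]] by (simp add: \<phi>_def B_def)
  have lt: "norm (\<phi> w) < norm (2 * of_real B - \<phi> w)" if "norm w < 1" for w
  proof -
    have "(norm (\<phi> w))\<^sup>2 < (norm (2 * of_real B - \<phi> w))\<^sup>2"
      using mult_strict_left_mono[OF \<phi>B[OF that], of "4 * B"] B
      unfolding cmod_power2 by (simp add: power2_eq_square algebra_simps)
    then show ?thesis by (rule power2_less_imp_less) simp
  qed
  have hol: "\<phi> holomorphic_on ball 0 1"
  proof -
    have "(f \<circ> (\<lambda>w. z0 + of_real R * w)) holomorphic_on ball 0 1"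
      by (rule holomorphic_on_compose_gen[OF _ f]) (use inb in \<open>auto intro!: holomorphic_intros\<close>)
    then show ?thesis unfolding \<phi>_def by (intro holomorphic_intros) (simp add: o_def)
  qed
  define w where "w = (z - z0) / of_real R"
  have w: "norm w \<le> r" using z R by (simp add: w_def norm_divide field_simps)
  then have w1: "norm w < 1" using r by simp
  have "norm (g w) \<le> norm w"
  proof (rule Schwarz_Lemma)
    show "g holomorphic_on ball 0 1"
      unfolding g_def using lt by (intro holomorphic_intros hol) force
    show "g 0 = 0" by (simp add: g_def \<phi>_def)
    show "norm (g z) < 1" if "norm z < 1" for z
      using lt[OF that] unfolding g_def norm_divide
      by (subst divide_less_eq_1_pos) (auto intro: le_less_trans[OF norm_ge_zero])
  qed (rule w1)
  then have g: "norm (g w) \<le> r" using w by simp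
  have nz: "2 * of_real B - \<phi> w \<noteq> 0" using lt[OF w1] by auto
  have "norm (\<phi> w) = norm (g w) * norm (2 * of_real B - \<phi> w)" using nz by (simp add: g_def norm_divide)
  also have "\<dots> \<le> r * (2 * B + norm (\<phi> w))"
  proof (rule mult_mono[OF g])
    show "norm (2 * of_real B - \<phi> w) \<le> 2 * B + norm (\<phi> w)"
      using norm_triangle_ineq4[of "2 * of_real B" "\<phi> w"] B by (simp add: norm_mult)
  qed (use r in auto)
  finally have "norm (\<phi> w) * (1 - r) \<le> 2 * B * r" by (simp add: algebra_simps)
  then have "norm (\<phi> w) \<le> 2 * B * r / (1 - r)" using r by (simp add: field_simps)
  then show ?thesis using R by (simp add: \<phi>_def w_def B_def)
qed

text \<open>A substitute for the three circles theorem: the Taylor coefficients satisfy Cauchy's bounds on both radii,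
  and the tail of the series beyond a fixed index only feels the larger circle.\<close>

lemma two_radii_interpolation:
  fixes r R r1 \<epsilon> :: real
  assumes r: "0 < r1" "0 < r" "r < R" "r1 < R" and \<epsilon>: "\<epsilon> > 0"
  shows "\<exists>C\<ge>0. \<forall>f z0 B1 B2 z. f holomorphic_on ball z0 R \<longrightarrow> (\<forall>w\<in>cball z0 r1. norm (f w) \<le> B1) \<longrightarrow>
      (\<forall>w\<in>ball z0 R. norm (f w) \<le> B2) \<longrightarrow> z \<in> cball z0 r \<longrightarrow> norm (f z :: complex) \<le> C * B1 + \<epsilon> * B2"
proof -
  define R' where "R' = (r + R) / 2"
  have R': "r < R'" "R' < R" "0 < R'" using r by (auto simp: R'_def)
  define q where "q = r / R'"
  have q: "0 < q" "q < 1" using r R' by (auto simp: q_def)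
  have "(\<lambda>N. q ^ N / (1 - q)) \<longlonglongrightarrow> 0 / (1 - q)"
    using q by (intro tendsto_intros LIMSEQ_realpow_zero) auto
  then have "eventually (\<lambda>N. q ^ N / (1 - q) < \<epsilon>) sequentially"
    using \<epsilon> by (intro order_tendstoD) auto
  then obtain N where N: "q ^ N / (1 - q) < \<epsilon>" by (auto simp: eventually_sequentially)
  define C where "C = (\<Sum>n<N. (r / r1) ^ n)"
  have C: "C \<ge> 0" using r unfolding C_def by (intro sum_nonneg) auto
  have "norm (f z) \<le> C * B1 + \<epsilon> * B2"
    if f: "f holomorphic_on ball z0 R" and B1: "\<forall>w\<in>cball z0 r1. norm (f w) \<le> B1"
      and B2: "\<forall>w\<in>ball z0 R. norm (f w) \<le> B2" and z: "z \<in> cball z0 r" for f :: "complex \<Rightarrow> complex" and z0 B1 B2 z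
  proof -
    have b2: "B2 \<ge> 0" using B2 r order_trans[OF norm_ge_zero, of "f z0" B2] by auto
    define c where "c = (\<lambda>n. (deriv ^^ n) f z0 / fact n)"
    have c_le: "norm (c n) \<le> B / \<rho> ^ n" if "\<And>w. w \<in> cball z0 \<rho> \<Longrightarrow> norm (f w) \<le> B" "0 < \<rho>" "\<rho> < R" for n B \<rho>
    proof -
      have "norm ((deriv ^^ n) f z0) \<le> fact n * B / \<rho> ^ n"
      proof (rule Cauchy_inequality)
        show "f holomorphic_on ball z0 \<rho>" using f that by (auto intro: holomorphic_on_subset)
        have "cball z0 \<rho> \<subseteq> ball z0 R" using that by auto
        then show "continuous_on (cball z0 \<rho>) f"
          using holomorphic_on_imp_continuous_on[OF f] continuous_on_subset by blast
      qed (use that in \<open>auto simp: dist_norm\<close>)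
      then show ?thesis by (simp add: c_def norm_divide field_simps)
    qed
    have c1: "norm (c n) \<le> B1 / r1 ^ n" for n using B1 r by (intro c_le) auto
    have c2: "norm (c n) \<le> B2 / R' ^ n" for n using B2 R' by (intro c_le) auto
    have zr: "norm (z - z0) \<le> r" using z by (simp add: dist_norm norm_minus_commute)
    have t1: "norm (c n * (z - z0) ^ n) \<le> (r / r1) ^ n * B1" for n
    proof -
      have "norm (c n) * norm (z - z0) ^ n \<le> B1 / r1 ^ n * r ^ n"
        using c1[of n] zr by (intro mult_mono power_mono) (auto intro: order_trans[OF norm_ge_zero])
      then show ?thesis by (simp add: norm_mult norm_power power_divide mult.commute)
    qed
    have t2: "norm (c n * (z - z0) ^ n) \<le> B2 * q ^ n" for n
    proof -
      have "norm (c n) * norm (z - z0) ^ n \<le> B2 / R' ^ n * r ^ n"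
        using c2[of n] zr by (intro mult_mono power_mono) (auto intro: order_trans[OF norm_ge_zero])
      then show ?thesis by (simp add: norm_mult norm_power power_divide q_def)
    qed
    have sums: "(\<lambda>n. c n * (z - z0) ^ n) sums f z"
      unfolding c_def by (rule holomorphic_power_series[OF f]) (use z r in auto)
    have tail: "(\<lambda>n. c (n + N) * (z - z0) ^ (n + N)) sums (f z - (\<Sum>n<N. c n * (z - z0) ^ n))"
      using sums by (rule sums_split_initial_segment)
    have geo: "(\<lambda>n. B2 * q ^ (n + N)) sums (B2 * (q ^ N / (1 - q)))"
    proof -
      have "(\<lambda>n. B2 * q ^ N * q ^ n) sums (B2 * q ^ N * (1 / (1 - q)))"
        using q by (intro sums_mult geometric_sums) auto
      then show ?thesis by (simp add: power_add mult_ac)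
    qed
    have "norm (\<Sum>n. c (n + N) * (z - z0) ^ (n + N)) \<le> (\<Sum>n. B2 * q ^ (n + N))"
      using t2 by (intro norm_suminf_le sums_summable[OF geo]) auto
    then have "norm (f z - (\<Sum>n<N. c n * (z - z0) ^ n)) \<le> B2 * (q ^ N / (1 - q))"
      using sums_unique[OF tail] sums_unique[OF geo] by simp
    also have "\<dots> \<le> B2 * \<epsilon>" using N b2 by (intro mult_left_mono) auto
    finally have 1: "norm (f z - (\<Sum>n<N. c n * (z - z0) ^ n)) \<le> \<epsilon> * B2" by (simp add: mult.commute)
    have 2: "norm (\<Sum>n<N. c n * (z - z0) ^ n) \<le> C * B1"
      unfolding C_def sum_distrib_right by (intro sum_norm_le t1)
    show ?thesis using 1 2 norm_triangle_ineq[of "f z - (\<Sum>n<N. c n * (z - z0) ^ n)" "\<Sum>n<N. c n * (z - z0) ^ n"] by simp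
  qed
  then show ?thesis using C by blast
qed

lemma zeta_bounds_right:
  assumes \<sigma>: "\<sigma> > 1"
  shows "\<exists>K\<ge>1. \<forall>s. Re s \<ge> \<sigma> \<longrightarrow> norm (zeta s) \<le> K \<and> norm (1 / zeta s) \<le> K"
proof -
  define K where "K = (\<Sum>n. real n powr - \<sigma>)"
  have sm: "summable (\<lambda>n. real n powr - \<sigma>)" using \<sigma> by (simp add: summable_real_powr_iff)
  have "norm (zeta s) \<le> K \<and> norm (1 / zeta s) \<le> K" if s: "Re s \<ge> \<sigma>" for s
  proof
    have s1: "Re s > 1" using s \<sigma> by simp
    have b: "norm (of_nat n powr - s :: complex) \<le> real n powr - \<sigma>" for n
      using s by (cases "n = 0") (auto simp: norm_of_nat_powr intro!: powr_mono)
    show "norm (zeta s) \<le> K"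
      unfolding K_def sums_unique[OF zeta_sums_powr[OF s1]] by (rule norm_suminf_le[OF b sm])
    have "norm (of_int (moebius_mu n) * of_nat n powr - s :: complex) \<le> real n powr - \<sigma>" for n
    proof -
      have "real_of_int \<bar>moebius_mu n\<bar> \<le> 1" using abs_moebius_mu_le[of n] by linarith
      then have "\<bar>real_of_int (moebius_mu n)\<bar> * norm (of_nat n powr - s :: complex) \<le> 1 * real n powr - \<sigma>"
        using b[of n] by (intro mult_mono) auto
      then show ?thesis by (simp add: norm_mult)
    qed
    then show "norm (1 / zeta s) \<le> K"
      unfolding K_def sums_unique[OF moebius_series[OF s1]] by (rule norm_suminf_le[OF _ sm])
  qed
  moreover have "1 \<le> max 1 K" "K \<le> max 1 K" by auto
  ultimately show ?thesis by (meson order_trans)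
qed

text \<open>Any polynomial bound would serve: only its logarithm enters
  \<open>abs_ln_zeta_bound\<close>.\<close>

lemma zeta_linear_bound:
  "\<exists>C\<ge>1. \<forall>s. Re s \<ge> 1 / 2 \<longrightarrow> \<bar>Im s\<bar> \<ge> 1 \<longrightarrow> Re s \<le> 4 \<longrightarrow> norm (zeta s) \<le> C * \<bar>Im s\<bar>"
proof -
  obtain K where K: "K > 0" "\<And>s. Re s \<ge> 1 / 2 \<Longrightarrow> norm (zeta_reg s) \<le> 1 + K * norm s * norm (s - 1)"
    using zeta_reg_bound by blast
  have "norm (zeta s) \<le> (1 + 5 * K) * \<bar>Im s\<bar>" if s: "Re s \<ge> 1 / 2" "\<bar>Im s\<bar> \<ge> 1" "Re s \<le> 4" for s
  proof -
    have ne: "s \<noteq> 1" using s by auto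
    have n1: "norm (s - 1) \<ge> 1" using s abs_Im_le_cmod[of "s - 1"] by simp
    have "norm s \<le> \<bar>Re s\<bar> + \<bar>Im s\<bar>" by (rule cmod_le)
    then have ns: "norm s \<le> 5 * \<bar>Im s\<bar>" using s by linarith
    have "norm (zeta s) = norm (zeta_reg s) / norm (s - 1)"
      using zeta_eq_zeta_reg[of s] ne s by (simp add: norm_divide)
    also have "\<dots> \<le> (1 + K * norm s * norm (s - 1)) / norm (s - 1)"
      using K(2)[OF s(1)] by (intro divide_right_mono) auto
    also have "\<dots> = 1 / norm (s - 1) + K * norm s" using ne by (simp add: field_simps)
    also have "\<dots> \<le> 1 + K * (5 * \<bar>Im s\<bar>)"
    proof (intro add_mono mult_left_mono)
      show "1 / norm (s - 1) \<le> 1" using n1 by (subst divide_le_eq_1) auto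
    qed (use ns K in auto)
    also have "\<dots> \<le> (1 + 5 * K) * \<bar>Im s\<bar>" using s by (simp add: algebra_simps)
    finally show ?thesis .
  qed
  then show ?thesis using K(1) by (intro exI[of _ "1 + 5 * K"]) auto
qed

section \<open>Zeta and its reciprocal to the right of the critical line\<close>

lemma zeta_nonzero_RH:
  assumes RH: Riemann_Hypothesis and s: "Re s > 1 / 2" "s \<noteq> 1"
  shows "zeta s \<noteq> 0"
proof (cases "Re s" "1 :: real" rule: linorder_cases)
  case less
  then show ?thesis using RH s unfolding Riemann_Hypothesis_def by force
next
  case equal
  then have "s = Complex 1 (Im s)" by (simp add: complex_eq_iff)
  moreover have "Im s \<noteq> 0" using equal s by (auto simp: complex_eq_iff)
  ultimately show ?thesis using zeta_nonzero_Re_eq_1 by metis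
next
  case greater
  then show ?thesis by (rule zeta_nonzero_Re_gt_1)
qed

text \<open>On a disc about \<open>2 + it\<close> that almost reaches the critical line,
  \<open>ln zeta\<close> exists and is \<open>O(ln \<bar>t\<bar>)\<close> by Borel-Caratheodory and
  the linear bound for \<open>zeta\<close>. On a smaller disc inside \<open>Re s > 1\<close> it is
  \<open>O(1)\<close>. Interpolating between the two discs leaves an arbitrarily small multiple of
  \<open>ln \<bar>t\<bar>\<close> at the intermediate radius, which reaches
  \<open>s\<close>.\<close>

lemma abs_ln_zeta_bound:
  assumes RH: Riemann_Hypothesis and \<eta>: "0 < \<eta>" "\<eta> \<le> 1 / 2" and \<epsilon>: "\<epsilon> > 0"
  shows "\<exists>C. \<forall>s. Re s \<ge> 1 / 2 + \<eta> \<longrightarrow> Re s \<le> 2 \<longrightarrow> \<bar>Im s\<bar> \<ge> 3 \<longrightarrow> \<bar>ln (norm (zeta s))\<bar> \<le> C + \<epsilon> * ln \<bar>Im s\<bar>"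
proof -
  obtain C0 where C0: "C0 \<ge> 1" "\<And>s. Re s \<ge> 1 / 2 \<Longrightarrow> \<bar>Im s\<bar> \<ge> 1 \<Longrightarrow> Re s \<le> 4 \<Longrightarrow> norm (zeta s) \<le> C0 * \<bar>Im s\<bar>"
    using zeta_linear_bound by blast
  obtain K where K: "K \<ge> 1" "\<And>s. Re s \<ge> 1 + \<eta> / 2 \<Longrightarrow> norm (zeta s) \<le> K \<and> norm (1 / zeta s) \<le> K"
    using zeta_bounds_right[of "1 + \<eta> / 2"] \<eta> by auto
  define k where "k = ln K"
  have k: "k \<ge> 0" using K by (simp add: k_def)
  \<comment> \<open>All discs are centred at real part 2. Radius \<open>R\<close> stays right of 1/2
    and \<open>S\<close> right of 1; \<open>R2\<close> and \<open>S2\<close> are slightly smaller,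
    as Borel-Caratheodory loses some radius. The point \<open>s\<close> is within
    \<open>3 / 2 - \<eta> < R2\<close>.\<close>
  define R where "R = 3 / 2 - \<eta> / 4"
  define R2 where "R2 = 3 / 2 - \<eta> / 2"
  define \<rho> where "\<rho> = R2 / R"
  define S where "S = 1 - \<eta> / 2"
  define S2 where "S2 = 1 - \<eta>"
  define \<rho>' where "\<rho>' = S2 / S"
  have R: "0 < R2" "R2 < R" "R \<le> 3 / 2" and S: "0 < S2" "S2 < S" using \<eta> by (auto simp: R_def R2_def S_def S2_def)
  have \<rho>: "0 \<le> \<rho>" "\<rho> < 1" "\<rho> * R = R2" and \<rho>': "0 \<le> \<rho>'" "\<rho>' < 1" "\<rho>' * S = S2"
    using R S by (auto simp: \<rho>_def \<rho>'_def)
  define D where "D = 2 * \<rho> / (1 - \<rho>)"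
  define D' where "D' = 2 * \<rho>' / (1 - \<rho>')"
  have D: "D \<ge> 0" "D' \<ge> 0" using \<rho> \<rho>' by (auto simp: D_def D'_def)
  \<comment> \<open>The bound on the large disc is about \<open>D * ln \<bar>Im s\<bar>\<close>, so
    interpolating with \<open>e\<close> gives the coefficient
    \<open>e * D \<le> \<epsilon>\<close>.\<close>
  define e where "e = \<epsilon> / (D + 1)"
  have e: "e > 0" "e * D \<le> \<epsilon>" using \<epsilon> D by (auto simp: e_def field_simps)
  have rr: "0 < S2" "0 < 3 / 2 - \<eta>" "3 / 2 - \<eta> < R2" "S2 < R2"
    using \<eta> by (auto simp: R2_def S2_def)
  obtain C1 where C1: "\<And>f z0 B1 B2 z. f holomorphic_on ball z0 R2 \<Longrightarrow> (\<forall>w\<in>cball z0 S2. norm (f w) \<le> B1) \<Longrightarrow>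
      (\<forall>w\<in>ball z0 R2. norm (f w) \<le> B2) \<Longrightarrow> z \<in> cball z0 (3 / 2 - \<eta>) \<Longrightarrow> norm (f z :: complex) \<le> C1 * B1 + e * B2"
    using two_radii_interpolation[OF rr e(1)] by meson
  define C where "C = k + C1 * (D' * (2 * k + 1)) + e * (D * (ln (C0 * 2) + k + 1))"
  have "\<bar>ln (norm (zeta s))\<bar> \<le> C + \<epsilon> * ln \<bar>Im s\<bar>"
    if s: "Re s \<ge> 1 / 2 + \<eta>" "Re s \<le> 2" "\<bar>Im s\<bar> \<ge> 3" for s
  proof -
    define z0 where "z0 = Complex 2 (Im s)"
    \<comment> \<open>\<open>\<bar>Im s\<bar> \<ge> 3\<close> together with
      \<open>R \<le> 3 / 2\<close> keeps the disc away from the pole and its heights comparable to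
      \<open>\<bar>Im s\<bar>\<close>.\<close>
    have inR: "Re w > 1 / 2" "Re w \<le> 4" "\<bar>Im w\<bar> \<ge> 1" "\<bar>Im w\<bar> \<le> 2 * \<bar>Im s\<bar>" "w \<noteq> 1" if "w \<in> ball z0 R" for w
    proof -
      have d: "norm (w - z0) < R" using that by (simp add: dist_norm norm_minus_commute)
      have "\<bar>Re w - 2\<bar> < R" "\<bar>Im w - Im s\<bar> < R"
        using abs_Re_le_cmod[of "w - z0"] abs_Im_le_cmod[of "w - z0"] d by (simp_all add: z0_def)
      then show "Re w > 1 / 2" "Re w \<le> 4" "\<bar>Im w\<bar> \<ge> 1" "\<bar>Im w\<bar> \<le> 2 * \<bar>Im s\<bar>"
        using R s \<eta> unfolding R_def by linarith+
      then show "w \<noteq> 1" by auto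
    qed
    have inS: "Re w > 1 + \<eta> / 2" if "w \<in> ball z0 S" for w
    proof -
      have d: "norm (w - z0) < S" using that by (simp add: dist_norm norm_minus_commute)
      have "\<bar>Re w - 2\<bar> < S" using abs_Re_le_cmod[of "w - z0"] d by (simp add: z0_def)
      then show ?thesis unfolding S_def by linarith
    qed
    have hz: "zeta holomorphic_on ball z0 R"
      using zeta_holomorphic by (rule holomorphic_on_subset) (use inR(5) in blast)
    have nz: "zeta w \<noteq> 0" if "w \<in> ball z0 R" for w using zeta_nonzero_RH[OF RH] inR[OF that] by auto
    obtain f where f: "f holomorphic_on ball z0 R" "\<And>w. w \<in> ball z0 R \<Longrightarrow> zeta w = exp (f w)"
      using contractible_imp_holomorphic_log[OF hz _ nz] convex_imp_contractible[OF convex_ball] by metis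
    have Ref: "Re (f w) = ln (norm (zeta w))" if "w \<in> ball z0 R" for w using f(2)[OF that] by simp
    have z0S: "z0 \<in> ball z0 S" and z0R: "z0 \<in> ball z0 R" using R S by auto
    have SR: "ball z0 S \<subseteq> ball z0 R" using R S \<eta> by (auto simp: S_def R_def)
    have upS: "\<bar>Re (f w)\<bar> \<le> k" if w: "w \<in> ball z0 S" for w
    proof -
      have n: "norm (zeta w) \<le> K" "norm (1 / zeta w) \<le> K" using K(2)[of w] inS[OF w] by auto
      have pos: "norm (zeta w) > 0" using nz SR w by auto
      have "ln (norm (zeta w)) \<le> k" unfolding k_def using n pos K(1) by (intro ln_mono) auto
      moreover have "ln (norm (1 / zeta w)) \<le> k" unfolding k_def using n pos K(1) by (intro ln_mono) (auto simp: norm_divide)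
      then have "- ln (norm (zeta w)) \<le> k" using pos by (simp add: norm_divide ln_div)
      ultimately show ?thesis using Ref SR w by auto
    qed
    \<comment> \<open>The summand 1 makes the bound on the real part strict, as Borel-Caratheodory
      asks; \<open>k + 1\<close> below has the same purpose.\<close>
    define A where "A = ln (C0 * 2) + ln \<bar>Im s\<bar> + 1"
    have upR: "Re (f w) < A" if w: "w \<in> ball z0 R" for w
    proof -
      have "norm (zeta w) \<le> C0 * \<bar>Im w\<bar>" using inR[OF w] by (intro C0) auto
      also have "\<dots> \<le> C0 * (2 * \<bar>Im s\<bar>)" using inR[OF w] C0 by (intro mult_left_mono) auto
      finally have "norm (zeta w) \<le> (C0 * 2) * \<bar>Im s\<bar>" by simp
      then have "ln (norm (zeta w)) \<le> ln ((C0 * 2) * \<bar>Im s\<bar>)" using nz[OF w] by (intro ln_mono) auto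
      also have "\<dots> = ln (C0 * 2) + ln \<bar>Im s\<bar>" using C0 s by (intro ln_mult_pos) auto
      finally show ?thesis using Ref[OF w] by (simp add: A_def)
    qed
    have f0: "\<bar>Re (f z0)\<bar> \<le> k" using upS[OF z0S] .
    have b2: "norm (f w - f z0) \<le> D * (A + k)" if w: "w \<in> ball z0 R2" for w
    proof -
      have "norm (f w - f z0) \<le> 2 * (A - Re (f z0)) * \<rho> / (1 - \<rho>)"
        by (rule Borel_Caratheodory[where R = R, OF f(1) _ upR \<rho>(1,2)])
           (use w R \<rho> in \<open>auto simp: dist_norm norm_minus_commute\<close>)
      also have "\<dots> = D * (A - Re (f z0))" by (simp add: D_def)
      also have "\<dots> \<le> D * (A + k)" using D f0 by (intro mult_left_mono) auto
      finally show ?thesis .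
    qed
    have b1: "norm (f w - f z0) \<le> D' * (2 * k + 1)" if w: "w \<in> cball z0 S2" for w
    proof -
      have "norm (f w - f z0) \<le> 2 * (k + 1 - Re (f z0)) * \<rho>' / (1 - \<rho>')"
      proof (rule Borel_Caratheodory[where f = f and A = "k + 1" and ?z0.0 = z0 and z = w and R = S, OF _ _ _ \<rho>'(1,2)])
        show "f holomorphic_on ball z0 S" using f(1) SR by (rule holomorphic_on_subset)
        show "Re (f z) < k + 1" if "z \<in> ball z0 S" for z using upS[OF that] by auto
      qed (use w S \<rho>' in \<open>auto simp: dist_norm norm_minus_commute\<close>)
      also have "\<dots> = D' * (k + 1 - Re (f z0))" by (simp add: D'_def)
      also have "\<dots> \<le> D' * (2 * k + 1)" using D f0 by (intro mult_left_mono) auto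
      finally show ?thesis .
    qed
    have sball: "s \<in> cball z0 (3 / 2 - \<eta>)"
    proof -
      have "z0 - s = of_real (2 - Re s)" by (simp add: z0_def complex_eq_iff)
      then have "dist z0 s = \<bar>2 - Re s\<bar>" by (simp only: dist_norm norm_of_real)
      then show ?thesis using s by simp
    qed
    have "norm (f s - f z0) \<le> C1 * (D' * (2 * k + 1)) + e * (D * (A + k))"
    proof (rule C1[of "\<lambda>w. f w - f z0" z0 "D' * (2 * k + 1)" "D * (A + k)" s])
      have "f holomorphic_on ball z0 R2" using f(1) by (rule holomorphic_on_subset) (use R in auto)
      then show "(\<lambda>w. f w - f z0) holomorphic_on ball z0 R2" by (intro holomorphic_intros)
      show "\<forall>w\<in>cball z0 S2. norm (f w - f z0) \<le> D' * (2 * k + 1)" using b1 by blast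
      show "\<forall>w\<in>ball z0 R2. norm (f w - f z0) \<le> D * (A + k)" using b2 by blast
    qed (rule sball)
    then have "\<bar>Re (f s - f z0)\<bar> \<le> C1 * (D' * (2 * k + 1)) + e * (D * (A + k))"
      using abs_Re_le_cmod[of "f s - f z0"] by linarith
    then have "\<bar>Re (f s)\<bar> \<le> k + C1 * (D' * (2 * k + 1)) + e * (D * (A + k))" using f0 by simp
    moreover have "s \<in> ball z0 R" using sball R \<eta> by (auto simp: R_def)
    ultimately have "\<bar>ln (norm (zeta s))\<bar> \<le> k + C1 * (D' * (2 * k + 1)) + e * (D * (A + k))"
      using Ref by simp
    also have "\<dots> = C + (e * D) * ln \<bar>Im s\<bar>" unfolding C_def A_def by (simp add: algebra_simps)
    also have "\<dots> \<le> C + \<epsilon> * ln \<bar>Im s\<bar>" using e s by (intro add_left_mono mult_right_mono) auto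
    finally show ?thesis .
  qed
  then show ?thesis by blast
qed

text \<open>Exponentiating the bound on the absolute value of the logarithm serves
  \<open>zeta\<close> and its reciprocal at once; right of \<open>Re s = 2\<close> both are
  bounded.\<close>

theorem zeta_growth_RH:
  assumes RH: Riemann_Hypothesis and \<eta>: "0 < \<eta>" and \<epsilon>: "\<epsilon> > 0"
  shows "\<exists>C\<ge>1. \<forall>s. Re s \<ge> 1 / 2 + \<eta> \<longrightarrow> \<bar>Im s\<bar> \<ge> 3 \<longrightarrow>
      norm (zeta s) \<le> C * \<bar>Im s\<bar> powr \<epsilon> \<and> norm (1 / zeta s) \<le> C * \<bar>Im s\<bar> powr \<epsilon>"
proof -
  define \<eta>' where "\<eta>' = min \<eta> (1 / 2)"
  have \<eta>': "0 < \<eta>'" "\<eta>' \<le> 1 / 2" "\<eta>' \<le> \<eta>" using \<eta> by (auto simp: \<eta>'_def)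
  obtain C where C: "\<And>s. Re s \<ge> 1 / 2 + \<eta>' \<Longrightarrow> Re s \<le> 2 \<Longrightarrow> \<bar>Im s\<bar> \<ge> 3 \<Longrightarrow> \<bar>ln (norm (zeta s))\<bar> \<le> C + \<epsilon> * ln \<bar>Im s\<bar>"
    using abs_ln_zeta_bound[OF RH \<eta>'(1,2) \<epsilon>] by blast
  obtain K where K: "K \<ge> 1" "\<And>s. Re s \<ge> 2 \<Longrightarrow> norm (zeta s) \<le> K \<and> norm (1 / zeta s) \<le> K"
    using zeta_bounds_right[of 2] by auto
  define M where "M = max (exp C) K"
  have M: "M \<ge> 1" "exp C \<le> M" "K \<le> M" using K by (auto simp: M_def)
  have "norm (zeta s) \<le> M * \<bar>Im s\<bar> powr \<epsilon> \<and> norm (1 / zeta s) \<le> M * \<bar>Im s\<bar> powr \<epsilon>"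
    if s: "Re s \<ge> 1 / 2 + \<eta>" "\<bar>Im s\<bar> \<ge> 3" for s
  proof (cases "Re s \<le> 2")
    case True
    have "s \<noteq> 1" using s by auto
    then have nz: "norm (zeta s) > 0" using zeta_nonzero_RH[OF RH] s \<eta> by auto
    have b: "\<bar>ln (norm (zeta s))\<bar> \<le> C + \<epsilon> * ln \<bar>Im s\<bar>" using s \<eta>' True by (intro C) auto
    have eq: "exp (C + \<epsilon> * ln \<bar>Im s\<bar>) \<le> M * \<bar>Im s\<bar> powr \<epsilon>"
      using s M by (simp add: exp_add powr_def mult.commute mult_right_mono)
    have "norm (zeta s) = exp (ln (norm (zeta s)))" using nz by simp
    also have "\<dots> \<le> exp (C + \<epsilon> * ln \<bar>Im s\<bar>)" using b by simp
    finally have 1: "norm (zeta s) \<le> M * \<bar>Im s\<bar> powr \<epsilon>" using eq by linarith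
    have "norm (1 / zeta s) = exp (- ln (norm (zeta s)))" using nz by (simp add: norm_divide exp_minus inverse_eq_divide)
    also have "\<dots> \<le> exp (C + \<epsilon> * ln \<bar>Im s\<bar>)" using b by simp
    finally have 2: "norm (1 / zeta s) \<le> M * \<bar>Im s\<bar> powr \<epsilon>" using eq by linarith
    show ?thesis using 1 2 ..
  next
    case False
    have "M * 1 \<le> M * \<bar>Im s\<bar> powr \<epsilon>" using M s \<epsilon> by (intro mult_left_mono) (auto intro: ge_one_powr_ge_zero)
    moreover have "norm (zeta s) \<le> K" "norm (1 / zeta s) \<le> K" using K(2)[of s] False by auto
    ultimately show ?thesis using M(3) by (intro conjI) linarith+
  qed
  then show ?thesis using M(1) by blast
qed

text \<open>The point 1 is included: since \<open>zeta 1 = 0\<close> and \<open>1 / 0 = 0\<close>,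
  the conventional value of \<open>1 / zeta\<close> at the pole is the true one, that of
  \<open>(s - 1) / zeta_reg s\<close>.\<close>

lemma recip_zeta_holomorphic_RH:
  assumes RH: Riemann_Hypothesis
  shows "(\<lambda>s. 1 / zeta s) holomorphic_on {s. Re s > 1 / 2}"
proof -
  have nz: "zeta_reg s \<noteq> 0" if "Re s > 1 / 2" for s
  proof (cases "s = 1")
    case False
    then show ?thesis using zeta_nonzero_RH[OF RH that False] zeta_reg_eq[of s] that by simp
  qed simp
  have "(\<lambda>s. (s - 1) / zeta_reg s) holomorphic_on {s. Re s > 1 / 2}"
    using nz by (intro holomorphic_intros holomorphic_on_subset[OF zeta_reg_holomorphic]) auto
  moreover have "(s - 1) / zeta_reg s = 1 / zeta s" if "Re s > 1 / 2" for s
    using zeta_eq_zeta_reg[of s] that by (cases "s = 1") auto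
  ultimately show ?thesis by (rule holomorphic_transform) simp
qed

text \<open>Using \<open>1 + \<bar>Im s\<bar>\<close> lets one bound cover small heights too, where
  the reciprocal is continuous on a compact rectangle, even at the pole of
  \<open>zeta\<close>.\<close>

lemma recip_zeta_bound_RH:
  assumes RH: Riemann_Hypothesis and \<eta>: "0 < \<eta>" and \<epsilon>: "\<epsilon> > 0"
  shows "\<exists>C\<ge>0. \<forall>s. Re s \<ge> 1 / 2 + \<eta> \<longrightarrow> norm (1 / zeta s) \<le> C * (1 + \<bar>Im s\<bar>) powr \<epsilon>"
proof -
  obtain C where C: "C \<ge> 1" "\<And>s. Re s \<ge> 1 / 2 + \<eta> \<Longrightarrow> \<bar>Im s\<bar> \<ge> 3 \<Longrightarrow> norm (1 / zeta s) \<le> C * \<bar>Im s\<bar> powr \<epsilon>"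
    using zeta_growth_RH[OF assms] by metis
  obtain K where K: "K \<ge> 1" "\<And>s. Re s \<ge> 2 \<Longrightarrow> norm (zeta s) \<le> K \<and> norm (1 / zeta s) \<le> K"
    using zeta_bounds_right[of 2] by auto
  define Q where "Q = cbox (Complex (1 / 2 + \<eta>) (-3)) (Complex 2 3)"
  have "continuous_on Q (\<lambda>s. 1 / zeta s)"
    using holomorphic_on_imp_continuous_on[OF recip_zeta_holomorphic_RH[OF RH]]
    by (rule continuous_on_subset) (use \<eta> in \<open>auto simp: Q_def in_cbox_complex_iff\<close>)
  then have "compact ((\<lambda>s. 1 / zeta s) ` Q)" by (rule compact_continuous_image) (simp add: Q_def)
  then obtain B where B: "\<And>s. s \<in> Q \<Longrightarrow> norm (1 / zeta s) \<le> B"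
    by (meson bounded_iff compact_imp_bounded imageI)
  define M where "M = max C (max K B)"
  have M: "M \<ge> 0" "C \<le> M" "K \<le> M" "B \<le> M" using C K by (auto simp: M_def)
  have "norm (1 / zeta s) \<le> M * (1 + \<bar>Im s\<bar>) powr \<epsilon>" if s: "Re s \<ge> 1 / 2 + \<eta>" for s
  proof -
    have one: "1 \<le> (1 + \<bar>Im s\<bar>) powr \<epsilon>" using \<epsilon> by (intro ge_one_powr_ge_zero) auto
    have M1: "M * 1 \<le> M * (1 + \<bar>Im s\<bar>) powr \<epsilon>" by (rule mult_left_mono[OF one M(1)])
    consider "\<bar>Im s\<bar> \<ge> 3" | "Re s \<ge> 2" | "s \<in> Q" using s by (force simp: Q_def in_cbox_complex_iff)
    then show ?thesis
    proof cases
      case 1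
      have "norm (1 / zeta s) \<le> C * \<bar>Im s\<bar> powr \<epsilon>" using s 1 by (intro C)
      also have "\<dots> \<le> M * (1 + \<bar>Im s\<bar>) powr \<epsilon>" using M \<epsilon> by (intro mult_mono powr_mono2) auto
      finally show ?thesis .
    next
      case 2
      then show ?thesis using K(2)[of s] M M1 by linarith
    next
      case 3
      then show ?thesis using B[of s] M M1 by linarith
    qed
  qed
  then show ?thesis using M(1) by blast
qed

lemma zeta_bound_line_RH:
  assumes RH: Riemann_Hypothesis and c: "c > 1 / 2" "c \<noteq> 1" and \<epsilon>: "\<epsilon> > 0"
  shows "\<exists>C\<ge>0. \<forall>t. norm (zeta (Complex c t)) \<le> C * (1 + \<bar>t\<bar>) powr \<epsilon>"
proof -
  have "\<exists>C\<ge>1. \<forall>s. Re s \<ge> 1 / 2 + (c - 1 / 2) \<longrightarrow> \<bar>Im s\<bar> \<ge> 3 \<longrightarrow>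
      norm (zeta s) \<le> C * \<bar>Im s\<bar> powr \<epsilon> \<and> norm (1 / zeta s) \<le> C * \<bar>Im s\<bar> powr \<epsilon>"
    using c by (intro zeta_growth_RH[OF RH _ \<epsilon>]) auto
  then obtain C where C: "C \<ge> 1" "\<And>s. Re s \<ge> c \<Longrightarrow> \<bar>Im s\<bar> \<ge> 3 \<Longrightarrow> norm (zeta s) \<le> C * \<bar>Im s\<bar> powr \<epsilon>" by auto
  have "continuous_on {-3..3} (\<lambda>t. zeta (Complex c t))"
    using c by (intro continuous_on_compose2[OF holomorphic_on_imp_continuous_on[OF zeta_holomorphic]])
      (auto intro!: continuous_intros simp: Complex_eq_1)
  then have "compact ((\<lambda>t. zeta (Complex c t)) ` {-3..3})" by (rule compact_continuous_image) simp
  then obtain B where B: "\<And>t. t \<in> {-3..3} \<Longrightarrow> norm (zeta (Complex c t)) \<le> B"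
    by (meson bounded_iff compact_imp_bounded imageI)
  define M where "M = max C B"
  have M: "M \<ge> 0" "C \<le> M" "B \<le> M" using C by (auto simp: M_def)
  have "norm (zeta (Complex c t)) \<le> M * (1 + \<bar>t\<bar>) powr \<epsilon>" for t
  proof (cases "\<bar>t\<bar> \<ge> 3")
    case True
    have "norm (zeta (Complex c t)) \<le> C * \<bar>t\<bar> powr \<epsilon>" using C(2)[of "Complex c t"] True by simp
    also have "\<dots> \<le> M * (1 + \<bar>t\<bar>) powr \<epsilon>" using M \<epsilon> by (intro mult_mono powr_mono2) auto
    finally show ?thesis .
  next
    case False
    have one: "1 \<le> (1 + \<bar>t\<bar>) powr \<epsilon>" using \<epsilon> by (intro ge_one_powr_ge_zero) auto
    have "M * 1 \<le> M * (1 + \<bar>t\<bar>) powr \<epsilon>" by (rule mult_left_mono[OF one M(1)])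
    moreover have "t \<in> {-3..3}" using False by auto
    ultimately show ?thesis using B[of t] M(3) by linarith
  qed
  then show ?thesis using M(1) by blast
qed

section \<open>Integrals over vertical lines\<close>

lemma integrable_powr_decay:
  fixes p :: real
  assumes p: "p > 1"
  shows "integrable lborel (\<lambda>t::real. (1 + \<bar>t\<bar>) powr - p)"
proof -
  define g where "g = (\<lambda>x::real. indicator {1..} x *\<^sub>R x powr - p)"
  have "(\<lambda>x::real. x powr - p) integrable_on {1..}"
    using has_integral_powr_to_inf[of "- p" 1] p by (auto simp: integrable_on_def)
  then have "set_integrable lebesgue {1..} (\<lambda>x::real. x powr - p)"
    by (rule nonnegative_absolutely_integrable_1) auto
  then have "integrable (completion lborel) g" by (simp add: g_def set_integrable_def)
  then have g: "integrable lborel g"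
    by (subst (asm) integrable_completion) (auto simp: g_def)
  have 1: "integrable lborel (\<lambda>x. g (1 + 1 * x))" "integrable lborel (\<lambda>x. g (1 + (- 1) * x))"
    by (intro lborel_integrable_real_affine[OF g]; simp)+
  show ?thesis
  proof (rule Bochner_Integration.integrable_bound)
    show "integrable lborel (\<lambda>x. g (1 + 1 * x) + g (1 + (- 1) * x))"
      using 1 by (rule Bochner_Integration.integrable_add)
    show "AE t in lborel. norm ((1 + \<bar>t\<bar>) powr - p) \<le> norm (g (1 + 1 * t) + g (1 + (- 1) * t))"
      by (intro AE_I2) (auto simp: g_def indicator_def abs_if)
  qed auto
qed

lemma integrable_decay:
  fixes f :: "real \<Rightarrow> complex"
  assumes p: "p > 1" and f: "continuous_on UNIV f" and le: "\<And>t. norm (f t) \<le> C * (1 + \<bar>t\<bar>) powr - p"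
  shows "integrable lborel f"
proof (rule Bochner_Integration.integrable_bound)
  show "integrable lborel (\<lambda>t. C * (1 + \<bar>t\<bar>) powr - p)"
    using integrable_powr_decay[OF p] by simp
  show "f \<in> borel_measurable lborel" using borel_measurable_continuous_onI[OF f] by simp
  show "AE t in lborel. norm (f t) \<le> norm (C * (1 + \<bar>t\<bar>) powr - p)"
    by (intro AE_I2) (simp only: real_norm_def order_trans[OF le abs_ge_self])
qed

lemma integrable_eventual_decay:
  fixes f :: "real \<Rightarrow> complex"
  assumes p: "p > 1" and f: "continuous_on UNIV f" and le: "\<And>t. \<bar>t\<bar> \<ge> T \<Longrightarrow> norm (f t) \<le> C * (1 + \<bar>t\<bar>) powr - p"
  shows "integrable lborel f"
proof -
  have cont: "continuous_on {- T..T} (\<lambda>t. f t * of_real ((1 + \<bar>t\<bar>) powr p))"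
    by (intro continuous_intros continuous_on_subset[OF f] continuous_on_powr) auto
  then have "compact ((\<lambda>t. f t * of_real ((1 + \<bar>t\<bar>) powr p)) ` {- T..T})"
    by (rule compact_continuous_image) simp
  then obtain B where B: "\<And>t. t \<in> {- T..T} \<Longrightarrow> norm (f t * of_real ((1 + \<bar>t\<bar>) powr p)) \<le> B"
    by (meson bounded_iff compact_imp_bounded imageI)
  have "norm (f t) \<le> max B C * (1 + \<bar>t\<bar>) powr - p" for t
  proof (cases "\<bar>t\<bar> \<ge> T")
    case True
    have "norm (f t) \<le> C * (1 + \<bar>t\<bar>) powr - p" by (rule le[OF True])
    also have "\<dots> \<le> max B C * (1 + \<bar>t\<bar>) powr - p" by (intro mult_right_mono) auto
    finally show ?thesis .
  next
    case False
    then have "t \<in> {- T..T}" by auto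
    then have "norm (f t) * (1 + \<bar>t\<bar>) powr p \<le> B" using B[of t] by (simp add: norm_mult)
    then have "norm (f t) \<le> B * (1 + \<bar>t\<bar>) powr - p"
      by (simp add: powr_minus field_simps)
    also have "\<dots> \<le> max B C * (1 + \<bar>t\<bar>) powr - p" by (intro mult_right_mono) auto
    finally show ?thesis .
  qed
  then show ?thesis by (rule integrable_decay[OF p f])
qed

text \<open>Integration is in the height \<open>t\<close>, without the factor \<open>\<i>\<close> of
  \<open>dz\<close>; so residues appear with \<open>2 * pi\<close> only.\<close>

definition vline_integral :: "(complex \<Rightarrow> complex) \<Rightarrow> real \<Rightarrow> complex" where
  "vline_integral f c = (LINT t|lborel. f (Complex c t))"

lemma continuous_on_vline:
  assumes "continuous_on S f" "\<And>t. Complex c t \<in> S"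
  shows "continuous_on UNIV (\<lambda>t. f (Complex c t))"
  using assms by (intro continuous_on_compose2[OF assms(1)]) (auto intro!: continuous_intros simp: Complex_eq)

lemma vline_integral_limit:
  assumes f: "continuous_on UNIV (\<lambda>t. f (Complex c t))" "integrable lborel (\<lambda>t. f (Complex c t))"
  shows "(\<lambda>n. contour_integral (linepath (Complex c (- real (Suc n))) (Complex c (real (Suc n)))) f)
    \<longlonglongrightarrow> \<i> * vline_integral f c"
proof -
  have eq: "contour_integral (linepath (Complex c (- real (Suc n))) (Complex c (real (Suc n)))) f
      = \<i> * (LINT t|lborel. indicator {- real (Suc n)..real (Suc n)} t *\<^sub>R f (Complex c t))" for n
  proof -
    have "set_integrable lborel {- real (Suc n)..real (Suc n)} (\<lambda>t. f (Complex c t))"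
      unfolding set_integrable_def using f(2) by (intro integrable_mult_indicator) auto
    from set_borel_integral_eq_integral(2)[OF this]
    have "integral {- real (Suc n)..real (Suc n)} (\<lambda>t. f (Complex c t)) =
        (LINT t|lborel. indicator {- real (Suc n)..real (Suc n)} t *\<^sub>R f (Complex c t))"
      by (simp add: set_lebesgue_integral_def)
    then show ?thesis
      by (subst contour_integral_linepath_same_Re[of _ c _ "- real (Suc n)" "real (Suc n)"]) auto
  qed
  have "(\<lambda>n. LINT t|lborel. indicator {- real (Suc n)..real (Suc n)} t *\<^sub>R f (Complex c t)) \<longlonglongrightarrow>
      (LINT t|lborel. f (Complex c t))"
  proof (rule integral_dominated_convergence[where w = "\<lambda>t. norm (f (Complex c t))"])
    show m: "(\<lambda>t. f (Complex c t)) \<in> borel_measurable lborel" using f(2) by (rule borel_measurable_integrable)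
    show "(\<lambda>t. indicator {- real (Suc n)..real (Suc n)} t *\<^sub>R f (Complex c t)) \<in> borel_measurable lborel" for n
      using m by (intro borel_measurable_scaleR borel_measurable_indicator) auto
    show "integrable lborel (\<lambda>t. norm (f (Complex c t)))" using f(2) by (rule integrable_norm)
    show "AE t in lborel. (\<lambda>n. indicator {- real (Suc n)..real (Suc n)} t *\<^sub>R f (Complex c t)) \<longlonglongrightarrow> f (Complex c t)"
    proof (intro AE_I2 tendsto_eventually)
      fix t :: real
      obtain N :: nat where "real N > \<bar>t\<bar>" using reals_Archimedean2 by blast
      then show "eventually (\<lambda>n. indicator {- real (Suc n)..real (Suc n)} t *\<^sub>R f (Complex c t) = f (Complex c t)) sequentially"
        by (intro eventually_sequentiallyI[of N]) (auto simp: indicator_def)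
    qed
    show "AE t in lborel. norm (indicator {- real (Suc n)..real (Suc n)} t *\<^sub>R f (Complex c t)) \<le> norm (f (Complex c t))" for n
      by (intro AE_I2) (auto simp: indicator_def)
  qed
  then show ?thesis unfolding eq vline_integral_def by (intro tendsto_intros)
qed

lemma contour_integral_rectpath:
  assumes f: "continuous_on (path_image (rectpath (Complex a (- T)) (Complex b T))) f" and T: "a \<le> b" "T > 0"
  shows "contour_integral (rectpath (Complex a (- T)) (Complex b T)) f =
    contour_integral (linepath (Complex a (- T)) (Complex b (- T))) f +
    contour_integral (linepath (Complex b (- T)) (Complex b T)) f -
    contour_integral (linepath (Complex a T) (Complex b T)) f -
    contour_integral (linepath (Complex a (- T)) (Complex a T)) f"
proof -
  have sub: "closed_segment (Complex a (- T)) (Complex b (- T)) \<subseteq> path_image (rectpath (Complex a (- T)) (Complex b T))"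
    "closed_segment (Complex b (- T)) (Complex b T) \<subseteq> path_image (rectpath (Complex a (- T)) (Complex b T))"
    "closed_segment (Complex b T) (Complex a T) \<subseteq> path_image (rectpath (Complex a (- T)) (Complex b T))"
    "closed_segment (Complex a T) (Complex a (- T)) \<subseteq> path_image (rectpath (Complex a (- T)) (Complex b T))"
    unfolding rectpath_def Let_def by (auto simp: path_image_join)
  note cont = sub[THEN continuous_on_subset[OF f]]
  note int = cont[THEN contour_integrable_continuous_linepath]
  have "contour_integral (rectpath (Complex a (- T)) (Complex b T)) f =
    contour_integral (linepath (Complex a (- T)) (Complex b (- T))) f +
    (contour_integral (linepath (Complex b (- T)) (Complex b T)) f +
    (contour_integral (linepath (Complex b T) (Complex a T)) f +
    contour_integral (linepath (Complex a T) (Complex a (- T))) f))"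
    unfolding rectpath_def Let_def using int by (simp add: contour_integrable_join)
  also have "contour_integral (linepath (Complex b T) (Complex a T)) f = - contour_integral (linepath (Complex a T) (Complex b T)) f"
    using cont(3) by (rule contour_integral_reverse_linepath)
  also have "contour_integral (linepath (Complex a T) (Complex a (- T))) f = - contour_integral (linepath (Complex a (- T)) (Complex a T)) f"
    using cont(4) by (rule contour_integral_reverse_linepath)
  finally show ?thesis by simp
qed

text \<open>The residue theorem on rectangles of growing height. Decay with exponent
  \<open>p > 1\<close> makes both vertical integrals absolutely convergent and the horizontal sides
  vanish; it is required only from height \<open>T0\<close> on, because of the poles in the
  strip.\<close>

lemma vline_integral_shift:
  assumes ab: "a < b" and U: "open U" "convex U" "{z. a \<le> Re z \<and> Re z \<le> b} \<subseteq> U"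
    and P: "finite P" "\<And>z. z \<in> P \<Longrightarrow> a < Re z \<and> Re z < b" and f: "f holomorphic_on U - P"
    and p: "p > 1" and le: "\<And>z. a \<le> Re z \<Longrightarrow> Re z \<le> b \<Longrightarrow> \<bar>Im z\<bar> \<ge> T0 \<Longrightarrow> norm (f z) \<le> C * (1 + \<bar>Im z\<bar>) powr - p"
  shows "integrable lborel (\<lambda>t. f (Complex a t))" "integrable lborel (\<lambda>t. f (Complex b t))"
    and "vline_integral f b - vline_integral f a = 2 * pi * (\<Sum>z\<in>P. residue f z)"
proof -
  have cf: "continuous_on (U - P) f" using f by (rule holomorphic_on_imp_continuous_on)
  have ca: "continuous_on UNIV (\<lambda>t. f (Complex a t))" and cb: "continuous_on UNIV (\<lambda>t. f (Complex b t))"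
    using U(3) P(2) ab by (intro continuous_on_vline[OF cf]; force)+
  show ia: "integrable lborel (\<lambda>t. f (Complex a t))"
    using le[of "Complex a _"] ab by (intro integrable_eventual_decay[OF p ca, of T0 C]) simp
  show ib: "integrable lborel (\<lambda>t. f (Complex b t))"
    using le[of "Complex b _"] ab by (intro integrable_eventual_decay[OF p cb, of T0 C]) simp
  obtain M where M: "\<And>z. z \<in> P \<Longrightarrow> norm z \<le> M" using finite_imp_bounded[OF P(1)] by (auto simp: bounded_iff)
  \<comment> \<open>From here on the rectangle contains all of \<open>P\<close>, and its horizontal
    sides lie where the decay bound holds.\<close>
  obtain N :: nat where N: "real N > max M (max T0 0)" using reals_Archimedean2 by blast
  define R where "R = (\<Sum>z\<in>P. residue f z)"
  define bot where "bot = (\<lambda>n. contour_integral (linepath (Complex a (- real (Suc n))) (Complex b (- real (Suc n)))) f)"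
  define top where "top = (\<lambda>n. contour_integral (linepath (Complex a (real (Suc n))) (Complex b (real (Suc n)))) f)"
  have rect: "bot n + contour_integral (linepath (Complex b (- real (Suc n))) (Complex b (real (Suc n)))) f
      - top n - contour_integral (linepath (Complex a (- real (Suc n))) (Complex a (real (Suc n)))) f = of_real (2 * pi) * \<i> * R"
    if n: "n \<ge> N" for n
  proof -
    let ?T = "real (Suc n)"
    let ?g = "rectpath (Complex a (- ?T)) (Complex b ?T)"
    have T: "?T > M" "?T > 0" using n N by auto
    have imP: "\<bar>Im z\<bar> < ?T" if "z \<in> P" for z using M[OF that] abs_Im_le_cmod[of z] T by linarith
    have box: "z \<in> box (Complex a (- ?T)) (Complex b ?T)" if "z \<in> P" for z
      using imP[OF that] P(2)[OF that] by (auto simp: in_box_complex_iff abs_less_iff)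
    have img: "path_image ?g = cbox (Complex a (- ?T)) (Complex b ?T) - box (Complex a (- ?T)) (Complex b ?T)"
      by (rule path_image_rectpath_cbox_minus_box) (use ab T in auto)
    have "cbox (Complex a (- ?T)) (Complex b ?T) \<subseteq> U" using U(3) by (auto simp: in_cbox_complex_iff)
    then have img': "path_image ?g \<subseteq> U - P" unfolding img using box by auto
    have "contour_integral ?g f = of_real (2 * pi) * \<i> * (\<Sum>z\<in>P. winding_number ?g z * residue f z)"
    proof (rule Residue_theorem[OF U(1) convex_connected[OF U(2)] P(1) f])
      show "\<forall>z. z \<notin> U \<longrightarrow> winding_number ?g z = 0"
        using img' U(2) by (intro allI impI winding_number_zero_outside[of _ U]) auto
    qed (use img' in auto)
    also have "(\<Sum>z\<in>P. winding_number ?g z * residue f z) = R"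
      unfolding R_def using box by (intro sum.cong) (auto simp: winding_number_rectpath)
    also have "contour_integral ?g f = bot n + contour_integral (linepath (Complex b (- ?T)) (Complex b ?T)) f
      - top n - contour_integral (linepath (Complex a (- ?T)) (Complex a ?T)) f"
      unfolding bot_def top_def using ab T
      by (intro contour_integral_rectpath continuous_on_subset[OF cf img']) auto
    finally show ?thesis .
  qed
  have small: "norm (contour_integral (linepath (Complex a t) (Complex b t)) f) \<le> \<bar>C\<bar> * (1 + \<bar>t\<bar>) powr - p * (b - a)"
    if t: "\<bar>t\<bar> > max M (max T0 0)" for t
  proof -
    have seg: "Im z = t" "a \<le> Re z" "Re z \<le> b" if "z \<in> closed_segment (Complex a t) (Complex b t)" for z
      using that ab by (auto simp: closed_segment_same_Im closed_segment_eq_real_ivl)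
    have "closed_segment (Complex a t) (Complex b t) \<subseteq> U - P"
    proof
      fix z assume z: "z \<in> closed_segment (Complex a t) (Complex b t)"
      have "z \<notin> P" using M[of z] abs_Im_le_cmod[of z] seg[OF z] t by auto
      then show "z \<in> U - P" using seg[OF z] U(3) by auto
    qed
    then have "f contour_integrable_on linepath (Complex a t) (Complex b t)"
      by (intro contour_integrable_continuous_linepath continuous_on_subset[OF cf])
    then have "norm (contour_integral (linepath (Complex a t) (Complex b t)) f) \<le>
        (\<bar>C\<bar> * (1 + \<bar>t\<bar>) powr - p) * norm (Complex b t - Complex a t)"
    proof (rule contour_integral_bound_linepath)
      fix z assume z: "z \<in> closed_segment (Complex a t) (Complex b t)"
      have "norm (f z) \<le> C * (1 + \<bar>t\<bar>) powr - p" using le[of z] seg[OF z] t by auto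
      also have "\<dots> \<le> \<bar>C\<bar> * (1 + \<bar>t\<bar>) powr - p" by (intro mult_right_mono) auto
      finally show "norm (f z) \<le> \<bar>C\<bar> * (1 + \<bar>t\<bar>) powr - p" .
    qed auto
    also have "norm (Complex b t - Complex a t) = b - a"
    proof -
      have "Complex b t - Complex a t = of_real (b - a)" by (simp add: complex_eq_iff)
      then show ?thesis using ab by (simp only: norm_of_real)
    qed
    finally show ?thesis .
  qed
  have z0: "(\<lambda>n. \<bar>C\<bar> * (1 + real (Suc n)) powr - p * (b - a)) \<longlonglongrightarrow> \<bar>C\<bar> * 0 * (b - a)"
    using p by (intro tendsto_mult tendsto_const tendsto_neg_powr filterlim_tendsto_add_at_top[OF tendsto_const]
      filterlim_compose[OF filterlim_real_sequentially filterlim_Suc]) auto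
  have "bot \<longlonglongrightarrow> 0"
  proof (rule Lim_null_comparison)
    show "eventually (\<lambda>n. norm (bot n) \<le> \<bar>C\<bar> * (1 + real (Suc n)) powr - p * (b - a)) sequentially"
      using eventually_ge_at_top[of N]
    proof eventually_elim
      case (elim n)
      then show ?case unfolding bot_def using small[of "- real (Suc n)"] N by simp
    qed
  qed (use z0 in simp)
  moreover have "top \<longlonglongrightarrow> 0"
  proof (rule Lim_null_comparison)
    show "eventually (\<lambda>n. norm (top n) \<le> \<bar>C\<bar> * (1 + real (Suc n)) powr - p * (b - a)) sequentially"
      using eventually_ge_at_top[of N]
    proof eventually_elim
      case (elim n)
      then show ?case unfolding top_def using small[of "real (Suc n)"] N by simp
    qed
  qed (use z0 in simp)
  ultimately have "(\<lambda>n. bot n + contour_integral (linepath (Complex b (- real (Suc n))) (Complex b (real (Suc n)))) f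
      - top n - contour_integral (linepath (Complex a (- real (Suc n))) (Complex a (real (Suc n)))) f)
      \<longlonglongrightarrow> 0 + \<i> * vline_integral f b - 0 - \<i> * vline_integral f a"
    by (intro tendsto_add tendsto_diff vline_integral_limit ca cb ia ib)
  moreover have "(\<lambda>n. bot n + contour_integral (linepath (Complex b (- real (Suc n))) (Complex b (real (Suc n)))) f
      - top n - contour_integral (linepath (Complex a (- real (Suc n))) (Complex a (real (Suc n)))) f)
      \<longlonglongrightarrow> of_real (2 * pi) * \<i> * R"
    by (rule tendsto_eventually) (use rect in \<open>auto simp: eventually_sequentially\<close>)
  ultimately have "0 + \<i> * vline_integral f b - 0 - \<i> * vline_integral f a = of_real (2 * pi) * \<i> * R"
    by (rule LIMSEQ_unique)
  then have "\<i> * (vline_integral f b - vline_integral f a) = \<i> * (2 * pi * R)" by (simp add: algebra_simps)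
  then show "vline_integral f b - vline_integral f a = 2 * pi * R" by simp
qed

section \<open>A Perron formula with absolutely convergent kernel\<close>

text \<open>For vertical lines at distance at least \<open>d\<close> from the poles 0 and -1,
  uniformly in the height. The next lemma treats whole strips, at heights of at least 1.\<close>

lemma inverse_norm_kernel_le:
  fixes z :: complex
  assumes "\<bar>Re z\<bar> \<ge> d" "\<bar>Re z + 1\<bar> \<ge> d" "0 < d" "d \<le> 1"
  shows "norm (1 / (z * (z + 1))) \<le> 4 / d ^ 2 * (1 + \<bar>Im z\<bar>) powr - 2"
proof -
  have *: "norm w \<ge> d / 2 * (1 + \<bar>Im w\<bar>)" if "\<bar>Re w\<bar> \<ge> d" for w :: complex
  proof -
    have "d \<le> norm w" using that abs_Re_le_cmod[of w] by linarith
    moreover have "d * \<bar>Im w\<bar> \<le> 1 * \<bar>Im w\<bar>" using assms by (intro mult_right_mono) auto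
    then have "d * \<bar>Im w\<bar> \<le> norm w" using abs_Im_le_cmod[of w] by linarith
    ultimately show ?thesis by (simp add: algebra_simps)
  qed
  have "(d / 2 * (1 + \<bar>Im z\<bar>)) * (d / 2 * (1 + \<bar>Im z\<bar>)) \<le> norm z * norm (z + 1)"
    using *[of z] *[of "z + 1"] assms by (intro mult_mono) auto
  then have "norm (1 / (z * (z + 1))) \<le> 1 / ((d / 2 * (1 + \<bar>Im z\<bar>)) * (d / 2 * (1 + \<bar>Im z\<bar>)))"
    using assms unfolding norm_divide norm_mult norm_one
    by (intro frac_le mult_pos_pos) (auto intro: add_pos_nonneg)
  also have "\<dots> = 4 / d ^ 2 * (1 + \<bar>Im z\<bar>) powr - 2"
    using assms by (simp add: powr_minus powr_realpow[of "1 + \<bar>Im z\<bar>" 2, simplified] power2_eq_square field_simps)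
  finally show ?thesis .
qed

lemma inverse_norm_kernel_le_Im:
  fixes z :: complex
  assumes "\<bar>Im z\<bar> \<ge> 1"
  shows "norm (1 / (z * (z + 1))) \<le> 4 * (1 + \<bar>Im z\<bar>) powr - 2"
proof -
  have *: "norm w \<ge> 1 / 2 * (1 + \<bar>Im w\<bar>)" if "\<bar>Im w\<bar> \<ge> 1" for w :: complex
  proof -
    have "1 + \<bar>Im w\<bar> \<le> 2 * norm w" using that abs_Im_le_cmod[of w] by linarith
    then show ?thesis by simp
  qed
  have "(1 / 2 * (1 + \<bar>Im z\<bar>)) * (1 / 2 * (1 + \<bar>Im z\<bar>)) \<le> norm z * norm (z + 1)"
    using *[of z] *[of "z + 1"] assms by (intro mult_mono) auto
  then have "norm (1 / (z * (z + 1))) \<le> 1 / ((1 / 2 * (1 + \<bar>Im z\<bar>)) * (1 / 2 * (1 + \<bar>Im z\<bar>)))"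
    using assms unfolding norm_divide norm_mult norm_one
    by (intro frac_le mult_pos_pos) (auto intro: add_pos_nonneg)
  also have "\<dots> = 4 * (1 + \<bar>Im z\<bar>) powr - 2"
    using assms by (simp add: powr_minus powr_realpow[of "1 + \<bar>Im z\<bar>" 2, simplified] power2_eq_square field_simps)
  finally show ?thesis .
qed

lemma norm_of_real_powr:
  "u > 0 \<Longrightarrow> norm (of_real u powr (z :: complex)) = u powr Re z"
  by (simp add: norm_powr_real_powr)

text \<open>The extra factor \<open>sqrt R\<close> makes the shift to infinity work for \<open>u = 1\<close> as well.\<close>

lemma inverse_norm_kernel_le_far:
  fixes z :: complex
  assumes "\<bar>Re z\<bar> \<ge> R" "\<bar>Re z + 1\<bar> \<ge> 1" "R \<ge> 1"
  shows "norm (1 / (z * (z + 1))) \<le> 4 * R powr - (1 / 2) * (1 + \<bar>Im z\<bar>) powr - (3 / 2)"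
proof -
  define v where "v = (1 + \<bar>Im z\<bar>) / 2"
  have v: "v > 0" by (simp add: v_def)
  have 1: "norm z \<ge> R" using assms abs_Re_le_cmod[of z] by linarith
  have 2: "norm z \<ge> v" using 1 assms abs_Im_le_cmod[of z] by (simp add: v_def)
  have 3: "norm (z + 1) \<ge> v" using assms abs_Re_le_cmod[of "z + 1"] abs_Im_le_cmod[of "z + 1"] by (simp add: v_def)
  have "R powr (1 / 2) * v powr (1 / 2) * v \<le> norm z powr (1 / 2) * norm z powr (1 / 2) * norm (z + 1)"
    using assms 1 2 3 v by (intro mult_mono powr_mono2) auto
  also have "norm z powr (1 / 2) * norm z powr (1 / 2) = norm z" by (simp flip: powr_add)
  finally have "R powr (1 / 2) * v powr (3 / 2) \<le> norm z * norm (z + 1)"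
    using v powr_add[of v "1 / 2" 1] by simp
  moreover have "R powr (1 / 2) * v powr (3 / 2) > 0" using assms v by simp
  ultimately have "norm (1 / (z * (z + 1))) \<le> 1 / (R powr (1 / 2) * v powr (3 / 2))"
    unfolding norm_divide norm_mult norm_one by (intro frac_le) auto
  also have "\<dots> = R powr - (1 / 2) * (2 powr (3 / 2) * (1 + \<bar>Im z\<bar>) powr - (3 / 2))"
    using assms by (simp add: v_def powr_divide powr_minus field_simps)
  also have "\<dots> \<le> R powr - (1 / 2) * (2 powr 2 * (1 + \<bar>Im z\<bar>) powr - (3 / 2))"
    by (intro mult_left_mono mult_right_mono powr_mono) auto
  finally show ?thesis by (simp add: mult_ac)
qed

text \<open>The kernel of first-order Riesz means. Compared with the classical
  \<open>u powr z / z\<close>, the factor \<open>z + 1\<close> makes its line integrals absolutely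
  convergent.\<close>

definition perron_kernel :: "real \<Rightarrow> complex \<Rightarrow> complex" where
  "perron_kernel u z = of_real u powr z / (z * (z + 1))"

lemma norm_perron_kernel:
  assumes "u > 0"
  shows "norm (perron_kernel u z) = u powr Re z * norm (1 / (z * (z + 1)))"
  using assms by (simp add: perron_kernel_def norm_divide norm_of_real_powr)

lemma perron_kernel_holomorphic:
  assumes "u > 0" "0 \<notin> A" "-1 \<notin> A"
  shows "perron_kernel u holomorphic_on A"
proof -
  have "z + 1 \<noteq> 0" if "z \<in> A" for z using that assms(3) by (metis add_eq_0_iff2 minus_minus)
  then show ?thesis
    using assms unfolding perron_kernel_def by (intro holomorphic_intros) auto
qed

lemma vline_integral_norm_le:
  assumes p: "p > 1" and int: "integrable lborel (\<lambda>t. f (Complex c t))"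
    and f: "\<And>t. norm (f (Complex c t)) \<le> C * (1 + \<bar>t\<bar>) powr - p"
  shows "norm (vline_integral f c) \<le> C * (LINT t|lborel. (1 + \<bar>t\<bar>) powr - p)"
proof -
  have "norm (vline_integral f c) \<le> (LINT t|lborel. C * (1 + \<bar>t\<bar>) powr - p)"
    unfolding vline_integral_def using integrable_powr_decay[OF p] f int
    by (intro Bochner_Integration.integral_norm_bound_integral) auto
  then show ?thesis by simp
qed

lemma le_powr_neg_half_imp_le_0:
  fixes x K R0 :: real
  assumes "\<And>R. R \<ge> R0 \<Longrightarrow> x \<le> K * R powr - (1 / 2)"
  shows "x \<le> 0"
proof (rule tendsto_lowerbound)
  have "((\<lambda>R::real. K * R powr - (1 / 2)) \<longlongrightarrow> K * 0) at_top"
    by (intro tendsto_intros tendsto_neg_powr filterlim_ident) auto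
  then show "((\<lambda>R::real. K * R powr - (1 / 2)) \<longlongrightarrow> 0) at_top" by simp
  show "eventually (\<lambda>R. x \<le> K * R powr - (1 / 2)) at_top"
    using eventually_ge_at_top[of R0] by eventually_elim (rule assms)
qed simp

lemma perron_kernel_far:
  assumes u: "u > 0" and c: "\<bar>c\<bar> \<ge> R" "\<bar>c + 1\<bar> \<ge> 1" "R \<ge> 1" and uc: "u powr c \<le> 1"
    and int: "integrable lborel (\<lambda>t. perron_kernel u (Complex c t))"
  shows "norm (vline_integral (perron_kernel u) c) \<le>
    4 * (LINT t|lborel. (1 + \<bar>t\<bar>) powr - (3 / 2)) * R powr - (1 / 2)"
proof -
  have "norm (vline_integral (perron_kernel u) c) \<le> (4 * R powr - (1 / 2)) * (LINT t|lborel. (1 + \<bar>t\<bar>) powr - (3 / 2))"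
  proof (rule vline_integral_norm_le[OF _ int])
    fix t
    have "norm (1 / (Complex c t * (Complex c t + 1))) \<le> 4 * R powr - (1 / 2) * (1 + \<bar>Im (Complex c t)\<bar>) powr - (3 / 2)"
      using c by (intro inverse_norm_kernel_le_far) auto
    moreover have "u powr c * norm (1 / (Complex c t * (Complex c t + 1))) \<le> 1 * norm (1 / (Complex c t * (Complex c t + 1)))"
      using uc by (intro mult_right_mono) auto
    ultimately show "norm (perron_kernel u (Complex c t)) \<le> 4 * R powr - (1 / 2) * (1 + \<bar>t\<bar>) powr - (3 / 2)"
      unfolding norm_perron_kernel[OF u] complex.sel by linarith
  qed simp
  then show ?thesis by (simp add: mult_ac)
qed

text \<open>For \<open>u < 1\<close> the line moves to the right, past no pole, and the integral
  tends to 0. For \<open>u \<ge> 1\<close> it moves to the left past 0 and -1, whose residues are 1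
  and \<open>- 1 / u\<close>.\<close>

lemma vline_integral_perron_kernel:
  assumes u: "u > 0" and c: "c > 0"
  shows "integrable lborel (\<lambda>t. perron_kernel u (Complex c t))"
    and "vline_integral (perron_kernel u) c = 2 * pi * of_real (max 0 (1 - 1 / u))"
proof -
  define J where "J = (LINT t|lborel. (1 + \<bar>t\<bar>) powr - (3 / 2 :: real))"
  have bound: "norm (perron_kernel u z) \<le> (M * 4) * (1 + \<bar>Im z\<bar>) powr - 2"
    if "u powr Re z \<le> M" "\<bar>Im z\<bar> \<ge> 1" for z M
  proof -
    have "norm (perron_kernel u z) \<le> M * (4 * (1 + \<bar>Im z\<bar>) powr - 2)"
      unfolding norm_perron_kernel[OF u] using that inverse_norm_kernel_le_Im[OF that(2)]
      by (intro mult_mono) (auto intro: order_trans[OF powr_ge_zero])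
    then show ?thesis by simp
  qed
  have "integrable lborel (\<lambda>t. perron_kernel u (Complex c t)) \<and>
    norm (vline_integral (perron_kernel u) c - 2 * pi * of_real (max 0 (1 - 1 / u))) \<le> 0"
  proof (cases "u < 1")
    case True
    have shift: "integrable lborel (\<lambda>t. perron_kernel u (Complex c t)) \<and> integrable lborel (\<lambda>t. perron_kernel u (Complex R t))
        \<and> vline_integral (perron_kernel u) R - vline_integral (perron_kernel u) c = 2 * pi * (\<Sum>z\<in>{}. residue (perron_kernel u) z)"
      if R: "R \<ge> c + 1" for R
    proof -
      have *: "norm (perron_kernel u z) \<le> (1 * 4) * (1 + \<bar>Im z\<bar>) powr - 2" if "c \<le> Re z" "\<bar>Im z\<bar> \<ge> 1" for z
        using that u c True powr_mono'[of 0 "Re z" u] by (intro bound) auto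
      show ?thesis
        by (intro conjI vline_integral_shift[where a = c and b = R and U = "{z. Re z > 0}" and ?T0.0 = 1 and p = 2 and C = "1 * 4" and P = "{}"])
           (use R c u * in \<open>auto intro!: perron_kernel_holomorphic open_halfspace_Re_gt convex_halfspace_Re_gt\<close>)
    qed
    have "norm (vline_integral (perron_kernel u) c) \<le> (4 * J) * R powr - (1 / 2)" if R: "R \<ge> c + 1" for R
    proof -
      have "norm (vline_integral (perron_kernel u) R) \<le> 4 * J * R powr - (1 / 2)"
        unfolding J_def using R c u True shift[OF R] powr_mono'[of 0 R u]
        by (intro perron_kernel_far) auto
      then show ?thesis using shift[OF R] by simp
    qed
    then have "norm (vline_integral (perron_kernel u) c) \<le> 0" by (rule le_powr_neg_half_imp_le_0)
    moreover have "max 0 (1 - 1 / u) = 0" using u True by (simp add: field_simps)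
    ultimately show ?thesis using shift[of "c + 1"] by simp
  next
    case False
    define \<Sigma> where "\<Sigma> = (\<Sum>z\<in>{0, -1}. residue (perron_kernel u) z)"
    have res: "\<Sigma> = of_real (1 - 1 / u)"
    proof -
      have "residue (\<lambda>z. (of_real u powr z / (z + 1)) / (z - 0)) 0 = of_real u powr 0 / (0 + 1)"
        by (rule residue_simple[of "ball 0 1"]) (use u in \<open>auto intro!: holomorphic_intros simp: add_eq_0_iff2\<close>)
      moreover have "residue (\<lambda>z. (of_real u powr z / z) / (z - (- 1))) (- 1) = of_real u powr (- 1) / (- 1)"
        by (rule residue_simple[of "ball (-1) 1"]) (use u in \<open>auto intro!: holomorphic_intros\<close>)
      moreover have "perron_kernel u = (\<lambda>z. (of_real u powr z / (z + 1)) / (z - 0))"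
        "perron_kernel u = (\<lambda>z. (of_real u powr z / z) / (z - (- 1)))"
        by (auto simp: perron_kernel_def mult.commute)
      ultimately have "residue (perron_kernel u) 0 = 1" "residue (perron_kernel u) (- 1) = - (1 / of_real u)"
        using u by (simp_all add: powr_minus_divide)
      then show ?thesis by (simp add: \<Sigma>_def)
    qed
    have shift: "integrable lborel (\<lambda>t. perron_kernel u (Complex (- R) t)) \<and> integrable lborel (\<lambda>t. perron_kernel u (Complex c t))
        \<and> vline_integral (perron_kernel u) c - vline_integral (perron_kernel u) (- R) = 2 * pi * (\<Sum>z\<in>{0, -1}. residue (perron_kernel u) z)"
      if R: "R \<ge> 2" for R
    proof -
      have *: "norm (perron_kernel u z) \<le> (u powr c * 4) * (1 + \<bar>Im z\<bar>) powr - 2" if "Re z \<le> c" "\<bar>Im z\<bar> \<ge> 1" for z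
        using that u False by (intro bound powr_mono) auto
      show ?thesis
        by (intro conjI vline_integral_shift[where a = "- R" and b = c and U = UNIV and ?T0.0 = 1 and p = 2 and C = "u powr c * 4" and P = "{0, -1}"])
           (use R c u * in \<open>auto intro!: perron_kernel_holomorphic\<close>)
    qed
    have "norm (vline_integral (perron_kernel u) c - 2 * pi * \<Sigma>) \<le> (4 * J) * R powr - (1 / 2)" if R: "R \<ge> 2" for R
    proof -
      have "norm (vline_integral (perron_kernel u) (- R)) \<le> 4 * J * R powr - (1 / 2)"
        unfolding J_def using R u False shift[OF R] powr_mono[of "- R" 0 u]
        by (intro perron_kernel_far) auto
      moreover have "vline_integral (perron_kernel u) c - 2 * pi * \<Sigma> = vline_integral (perron_kernel u) (- R)"
        using shift[OF R] unfolding \<Sigma>_def by (simp add: algebra_simps)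
      ultimately show ?thesis by simp
    qed
    then have "norm (vline_integral (perron_kernel u) c - 2 * pi * \<Sigma>) \<le> 0" by (rule le_powr_neg_half_imp_le_0)
    moreover have "max 0 (1 - 1 / u) = 1 - 1 / u" using u False by (simp add: field_simps)
    ultimately show ?thesis using shift[of 2] unfolding res by simp
  qed
  then show "integrable lborel (\<lambda>t. perron_kernel u (Complex c t))"
    "vline_integral (perron_kernel u) c = 2 * pi * of_real (max 0 (1 - 1 / u))" by auto
qed

text \<open>On the line, \<open>n powr - z\<close> times the kernel at \<open>u\<close> is the
  kernel at \<open>u / n\<close>. Absolute convergence allows integrating term by term, which
  produces the weights \<open>max 0 (1 - n / u)\<close>.\<close>

theorem riesz_perron:
  fixes a :: "nat \<Rightarrow> complex"
  assumes c: "c > 0" and u: "u > 0" and a: "a 0 = 0" "summable (\<lambda>n. norm (a n) * real n powr - c)"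
    and A: "\<And>t. (\<lambda>n. a n * of_nat n powr - Complex c t) sums A (Complex c t)"
  shows "integrable lborel (\<lambda>t. A (Complex c t) * perron_kernel u (Complex c t))"
    and "vline_integral (\<lambda>z. A z * perron_kernel u z) c = 2 * pi * (\<Sum>n. a n * of_real (max 0 (1 - real n / u)))"
proof -
  define f where "f = (\<lambda>n t. a n * perron_kernel (u / real n) (Complex c t))"
  have f_eq: "a n * of_nat n powr - Complex c t * perron_kernel u (Complex c t) = f n t" for n t
  proof (cases "n = 0")
    case False
    have "of_real (u / real n) powr Complex c t = of_real u powr Complex c t / of_nat n powr Complex c t"
    proof -
      have "of_real (u / real n) * of_nat n = complex_of_real u" using False by simp
      then have "of_real u powr Complex c t = of_real (u / real n) powr Complex c t * of_nat n powr Complex c t"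
        using powr_times_real[of "of_real (u / real n)" "of_nat n" "Complex c t"] u by simp
      then show ?thesis using False by simp
    qed
    then show ?thesis by (simp add: f_def perron_kernel_def powr_minus field_simps)
  qed (simp add: f_def a)
  have kint: "integrable lborel (\<lambda>t. perron_kernel (u / real n) (Complex c t))" if "n \<noteq> 0" for n
    using that u c by (intro vline_integral_perron_kernel) auto
  have fint: "integrable lborel (f n)" for n
    using kint[of n] by (cases "n = 0") (auto simp: f_def a)
  define k where "k = (\<lambda>t. norm (perron_kernel u (Complex c t)))"
  have k: "integrable lborel k" unfolding k_def using vline_integral_perron_kernel(1)[OF u c] by (rule integrable_norm)
  have nf: "norm (f n t) = norm (a n) * real n powr - c * k t" for n t
    unfolding f_eq[symmetric] by (cases "n = 0") (auto simp: a k_def norm_mult norm_of_nat_powr)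
  have s1: "AE t in lborel. summable (\<lambda>n. norm (f n t))"
    unfolding nf by (intro AE_I2 summable_mult2 a(2))
  have s2: "summable (\<lambda>n. LINT t|lborel. norm (f n t))"
    unfolding nf using a(2) by (simp add: summable_mult2)
  have sum_f: "(\<Sum>n. f n t) = A (Complex c t) * perron_kernel u (Complex c t)" for t
    using sums_mult2[OF A[of t], of "perron_kernel u (Complex c t)"] unfolding f_eq by (rule sums_unique[symmetric])
  show "integrable lborel (\<lambda>t. A (Complex c t) * perron_kernel u (Complex c t))"
    using integrable_suminf[OF fint s1 s2] unfolding sum_f .
  have "integral\<^sup>L lborel (f n) = 2 * pi * (a n * of_real (max 0 (1 - real n / u)))" for n
  proof (cases "n = 0")
    case False
    have "integral\<^sup>L lborel (f n) = a n * vline_integral (perron_kernel (u / real n)) c"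
      unfolding f_def vline_integral_def by simp
    also have "vline_integral (perron_kernel (u / real n)) c = 2 * pi * of_real (max 0 (1 - 1 / (u / real n)))"
      using False u c by (intro vline_integral_perron_kernel) auto
    finally show ?thesis by simp
  qed (simp add: f_def a)
  then have "(LINT t|lborel. A (Complex c t) * perron_kernel u (Complex c t)) = (\<Sum>n. 2 * pi * (a n * of_real (max 0 (1 - real n / u))))"
    using integral_suminf[OF fint s1 s2] unfolding sum_f by simp
  also have "\<dots> = 2 * pi * (\<Sum>n. a n * of_real (max 0 (1 - real n / u)))"
  proof (rule suminf_mult)
    obtain N :: nat where "real N > u" using reals_Archimedean2 by blast
    then have "max 0 (1 - real n / u) = 0" if "n \<notin> {..N}" for n using that u by (simp add: field_simps)
    then show "summable (\<lambda>n. a n * of_real (max 0 (1 - real n / u)))"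
      by (intro summable_finite[of "{..N}"]) auto
  qed
  finally show "vline_integral (\<lambda>z. A z * perron_kernel u z) c = 2 * pi * (\<Sum>n. a n * of_real (max 0 (1 - real n / u)))"
    by (simp add: vline_integral_def)
qed

section \<open>The error terms as contour integrals\<close>

text \<open>An antiderivative of \<open>divisor_main\<close>, with limit 0 at 0.\<close>

definition divisor_main1 :: "real \<Rightarrow> real" where
  "divisor_main1 u = u ^ 2 / 2 * (ln u + 2 * euler_mascheroni - 3 / 2)"

text \<open>The integral of \<open>divisor_sum\<close> from 0 to \<open>u\<close>, written as
  \<open>u\<close> times a Riesz mean so that it matches \<open>riesz_perron\<close>.\<close>

definition divisor_sum1 :: "real \<Rightarrow> real" where
  "divisor_sum1 u = u * (\<Sum>n. real (divisor_count n) * max 0 (1 - real n / u))"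

text \<open>The pole is double, so the residue is the derivative at 1 of
  \<open>zeta_reg z ^ 2 * perron_kernel u z\<close>; this is where \<open>deriv_zeta_reg_1\<close>
  is used.\<close>

lemma residue_zeta_sq_perron_kernel:
  assumes u: "u > 0"
  shows "residue (\<lambda>z. zeta z ^ 2 * perron_kernel u z) 1 = of_real (divisor_main1 u / u)"
proof -
  define h where "h = (\<lambda>z. zeta_reg z ^ 2 * perron_kernel u z)"
  have o: "open {z. Re z > 0}" by (rule open_halfspace_Re_gt)
  have kh: "perron_kernel u holomorphic_on {z. Re z > 0}"
    using u by (intro perron_kernel_holomorphic) auto
  have hh: "h holomorphic_on {z. Re z > 0}"
    unfolding h_def by (intro holomorphic_intros zeta_reg_holomorphic kh)
  have "residue (\<lambda>z. zeta z ^ 2 * perron_kernel u z) 1 = residue (\<lambda>z. h z / (z - 1) ^ Suc 1) 1"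
  proof (rule residue_cong)
    have "eventually (\<lambda>z. z \<in> {z. Re z > 0} - {1}) (at 1)"
      using eventually_at_in_open[OF o, of 1] by simp
    then show "eventually (\<lambda>z. zeta z ^ 2 * perron_kernel u z = h z / (z - 1) ^ Suc 1) (at 1)"
    proof eventually_elim
      case (elim z)
      then have "zeta z = zeta_reg z / (z - 1)" by (intro zeta_eq_zeta_reg) auto
      then show ?case by (simp add: h_def power_divide power2_eq_square)
    qed
  qed simp
  also have "\<dots> = (deriv ^^ 1) h 1 / fact 1"
    by (rule residue_holomorphic_over_power[OF o _ hh]) simp
  also have "\<dots> = deriv h 1" by simp
  also have "\<dots> = of_real (divisor_main1 u / u)"
  proof (rule DERIV_imp_deriv)
    have d1: "(zeta_reg has_field_derivative euler_mascheroni) (at 1)"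
      using holomorphic_derivI[OF zeta_reg_holomorphic o, of 1] deriv_zeta_reg_1 by simp
    have Lu: "Ln (of_real u) = complex_of_real (ln u)" using u by (rule Ln_of_real)
    have eu: "exp (of_real (ln u)) = complex_of_real u" using u by (simp add: exp_of_real)
    have "((\<lambda>z. exp (z * of_real (ln u)) / (z * (z + 1)) :: complex) has_field_derivative
        (of_real (ln u) * of_real u * 2 - of_real u * 3) / 4) (at 1)"
      by (auto intro!: derivative_eq_intros simp: eu)
    moreover have "perron_kernel u = (\<lambda>z. exp (z * of_real (ln u)) / (z * (z + 1)))"
      using u by (auto simp: perron_kernel_def powr_def Lu)
    ultimately have d2: "(perron_kernel u has_field_derivative (of_real (ln u) * of_real u * 2 - of_real u * 3) / 4) (at 1)"
      by simp
    have k1: "perron_kernel u 1 = of_real u / 2" using u by (simp add: perron_kernel_def)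
    have "(h has_field_derivative (of_nat 2 * (euler_mascheroni * zeta_reg 1 ^ (2 - Suc 0))) * perron_kernel u 1 +
        (of_real (ln u) * of_real u * 2 - of_real u * 3) / 4 * zeta_reg 1 ^ 2) (at 1)"
      unfolding h_def by (rule DERIV_mult[OF DERIV_power[OF d1] d2])
    moreover have "(of_nat 2 * (euler_mascheroni * zeta_reg 1 ^ (2 - Suc 0))) * perron_kernel u 1 +
        (of_real (ln u) * of_real u * 2 - of_real u * 3) / 4 * zeta_reg 1 ^ 2 = complex_of_real (divisor_main1 u / u)"
      using u unfolding k1 divisor_main1_def
      by (simp add: power2_eq_square field_simps)
    ultimately show "(h has_field_derivative of_real (divisor_main1 u / u)) (at 1)" by simp
  qed
  finally show ?thesis .
qed

text \<open>Moving the line from 2 to \<open>c\<close> crosses the double pole at 1, whose residue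
  is the main term; the poles 0 and -1 of the kernel stay on the left. What remains on the line is
  the error term of the integrated divisor sum.\<close>

lemma vline_integral_zeta_sq:
  assumes RH: Riemann_Hypothesis and c: "1 / 2 < c" "c < 1" and u: "u > 0"
  shows "integrable lborel (\<lambda>t. zeta (Complex c t) ^ 2 * perron_kernel u (Complex c t))"
    and "of_real u * vline_integral (\<lambda>z. zeta z ^ 2 * perron_kernel u z) c =
           2 * pi * of_real (divisor_sum1 u - divisor_main1 u)"
proof -
  define f where "f = (\<lambda>z. zeta z ^ 2 * perron_kernel u z)"
  \<comment> \<open>With exponent 1/8 for \<open>zeta\<close>, the integrand decays with exponent
    \<open>2 - 2 / 8 = 7 / 4\<close>, which exceeds 1.\<close>
  obtain C where C: "C \<ge> 1" "\<And>s. Re s \<ge> c \<Longrightarrow> \<bar>Im s\<bar> \<ge> 3 \<Longrightarrow> norm (zeta s) \<le> C * \<bar>Im s\<bar> powr (1 / 8)"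
    using zeta_growth_RH[OF RH, of "c - 1 / 2" "1 / 8"] c by auto
  define K where "K = C ^ 2 * max (u powr c) (u powr 2) * 4"
  have bound: "norm (f z) \<le> K * (1 + \<bar>Im z\<bar>) powr - (7 / 4)"
    if z: "c \<le> Re z" "Re z \<le> 2" "\<bar>Im z\<bar> \<ge> 3" for z
  proof -
    have "norm (zeta z) \<le> C * \<bar>Im z\<bar> powr (1 / 8)" using z by (intro C)
    also have "\<dots> \<le> C * (1 + \<bar>Im z\<bar>) powr (1 / 8)" using C(1) by (intro mult_left_mono powr_mono2) auto
    finally have "norm (zeta z) ^ 2 \<le> (C * (1 + \<bar>Im z\<bar>) powr (1 / 8)) ^ 2" by (rule power_mono) simp
    then have 1: "norm (zeta z ^ 2) \<le> C ^ 2 * (1 + \<bar>Im z\<bar>) powr (1 / 4)"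
      by (simp add: norm_power power_mult_distrib powr_power)
    have "u powr Re z \<le> max (u powr c) (u powr 2)"
    proof (cases "u \<ge> 1")
      case True
      then have "u powr Re z \<le> u powr 2" using z by (intro powr_mono) auto
      then show ?thesis by simp
    next
      case False
      then have "u powr Re z \<le> u powr c" using z u by (intro powr_mono') auto
      then show ?thesis by simp
    qed
    then have 2: "norm (perron_kernel u z) \<le> max (u powr c) (u powr 2) * (4 * (1 + \<bar>Im z\<bar>) powr - 2)"
      unfolding norm_perron_kernel[OF u] using inverse_norm_kernel_le_Im[of z] z
      by (intro mult_mono) (auto simp: le_max_iff_disj)
    have "norm (f z) \<le> (C ^ 2 * (1 + \<bar>Im z\<bar>) powr (1 / 4)) * (max (u powr c) (u powr 2) * (4 * (1 + \<bar>Im z\<bar>) powr - 2))"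
      unfolding f_def norm_mult using 1 2 by (intro mult_mono) auto
    also have "\<dots> = K * ((1 + \<bar>Im z\<bar>) powr (1 / 4) * (1 + \<bar>Im z\<bar>) powr - 2)" by (simp add: K_def mult_ac)
    also have "(1 + \<bar>Im z\<bar>) powr (1 / 4) * (1 + \<bar>Im z\<bar>) powr - 2 = (1 + \<bar>Im z\<bar>) powr - (7 / 4)"
      by (simp flip: powr_add)
    finally show ?thesis .
  qed
  have hol: "f holomorphic_on {z. Re z > 0} - {1}"
  proof -
    have "zeta holomorphic_on {z. Re z > 0} - {1}" using zeta_holomorphic by (rule holomorphic_on_subset) auto
    moreover have "perron_kernel u holomorphic_on {z. Re z > 0} - {1}"
      using u by (intro perron_kernel_holomorphic) auto
    ultimately show ?thesis unfolding f_def by (intro holomorphic_intros)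
  qed
  have sub: "{z. c \<le> Re z \<and> Re z \<le> 2} \<subseteq> {z. 0 < Re z}" using c by auto
  note shift = vline_integral_shift[where a = c and b = 2 and f = f and U = "{z. Re z > 0}" and P = "{1}" and ?T0.0 = 3
      and C = K and p = "7 / 4", OF _ open_halfspace_Re_gt convex_halfspace_Re_gt sub _ _ hol _ bound]
  show "integrable lborel (\<lambda>t. zeta (Complex c t) ^ 2 * perron_kernel u (Complex c t))"
    using shift(1) c by (auto simp: f_def)
  have sh: "vline_integral f 2 - vline_integral f c = 2 * pi * of_real (divisor_main1 u / u)"
    using shift(3) c residue_zeta_sq_perron_kernel[OF u] by (auto simp: f_def)
  have "vline_integral f 2 = 2 * pi * (\<Sum>n. of_nat (divisor_count n) * complex_of_real (max 0 (1 - real n / u)))"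
    unfolding f_def
  proof (rule riesz_perron(2)[where a = "\<lambda>n. of_nat (divisor_count n)"])
    show "summable (\<lambda>n. norm (of_nat (divisor_count n) :: complex) * real n powr - 2)"
      using divisor_count_summable_real[of 2] by simp
    show "(\<lambda>n. of_nat (divisor_count n) * of_nat n powr - Complex 2 t) sums zeta (Complex 2 t) ^ 2" for t
      by (rule divisor_count_series) simp
  qed (use u in auto)
  also have "(\<Sum>n. of_nat (divisor_count n) * complex_of_real (max 0 (1 - real n / u))) =
      complex_of_real (\<Sum>n. real (divisor_count n) * max 0 (1 - real n / u))"
  proof -
    obtain N :: nat where "real N > u" using reals_Archimedean2 by blast
    then have "max 0 (1 - real n / u) = 0" if "n \<notin> {..N}" for n using that u by (simp add: field_simps)
    then have "summable (\<lambda>n. real (divisor_count n) * max 0 (1 - real n / u))"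
      by (intro summable_finite[of "{..N}"]) auto
    from suminf_of_real[OF this, where 'a = complex] show ?thesis by simp
  qed
  finally have v2: "of_real u * vline_integral f 2 = 2 * pi * of_real (divisor_sum1 u)"
    by (simp add: divisor_sum1_def)
  have "of_real u * vline_integral f c = of_real u * vline_integral f 2 - of_real u * (2 * pi * of_real (divisor_main1 u / u))"
    using sh by (simp add: algebra_simps)
  also have "\<dots> = 2 * pi * of_real (divisor_sum1 u - divisor_main1 u)"
    unfolding v2 using u by (simp add: field_simps)
  finally show "of_real u * vline_integral (\<lambda>z. zeta z ^ 2 * perron_kernel u z) c =
      2 * pi * of_real (divisor_sum1 u - divisor_main1 u)"
    by (simp add: f_def)
qed

section \<open>The series of the squared reciprocal of zeta with damped initial terms\<close>

text \<open>The weight \<open>min 1 (n / y)\<close> is the complement of the Riesz weight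
  \<open>max 0 (1 - n / y)\<close>: terms well below \<open>y\<close> are suppressed, those beyond
  \<open>y\<close> are kept.\<close>

definition mu_sq_tail :: "real \<Rightarrow> complex \<Rightarrow> complex" where
  "mu_sq_tail y w = (\<Sum>n. of_int (mu_sq n) * of_real (min 1 (real n / y)) * of_nat n powr - w)"

lemma mu_sq_tail_summable:
  assumes "Re w > 1" "y > 0"
  shows "summable (\<lambda>n. norm (of_int (mu_sq n) * of_real (min 1 (real n / y)) * of_nat n powr - w :: complex))"
proof (rule summable_comparison_test[OF _ mu_sq_series(2)[OF assms(1)]], intro exI allI impI)
  fix n
  have "\<bar>min 1 (real n / y)\<bar> \<le> 1" using assms by auto
  then have "\<bar>real_of_int (mu_sq n)\<bar> * \<bar>min 1 (real n / y)\<bar> * norm (of_nat n powr - w :: complex) \<le>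
      \<bar>real_of_int (mu_sq n)\<bar> * 1 * norm (of_nat n powr - w :: complex)"
    by (intro mult_right_mono mult_left_mono) auto
  then show "norm (norm (of_int (mu_sq n) * of_real (min 1 (real n / y)) * of_nat n powr - w :: complex)) \<le>
      norm (of_int (mu_sq n) * of_nat n powr - w :: complex)"
    by (simp add: norm_mult)
qed

text \<open>The Riesz mean of the series at \<open>w\<close> is a line integral of
  \<open>(1 / zeta (w + z)) ^ 2\<close> against the kernel. Moving the line left of 0 picks up the
  full series as the residue at 0, so the shifted integral is exactly the tail, up to the factor
  \<open>- 2 * pi\<close>. Under RH no other singularity is met, and \<open>y powr Re z\<close> is
  the saving.\<close>

lemma mu_sq_tail_bound_RH:
  assumes RH: Riemann_Hypothesis and \<delta>: "0 < \<delta>" "\<delta> < 1 / 4" and \<epsilon>: "0 < \<epsilon>" "\<epsilon> < 1 / 2"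
  shows "\<exists>C\<ge>0. \<forall>y w. y \<ge> 1 \<longrightarrow> Re w = 1 + 2 * \<delta> \<longrightarrow>
      norm (mu_sq_tail y w) \<le> C * y powr - (1 / 2 + \<delta>) * (1 + \<bar>Im w\<bar>) powr (2 * \<epsilon>)"
proof -
  obtain C where C: "C \<ge> 0" "\<And>s. Re s \<ge> 1 / 2 + \<delta> \<Longrightarrow> norm (1 / zeta s) \<le> C * (1 + \<bar>Im s\<bar>) powr \<epsilon>"
    using recip_zeta_bound_RH[OF RH \<delta>(1) \<epsilon>(1)] by blast
  \<comment> \<open>On the line \<open>Re z = a\<close> the argument \<open>w + z\<close> has real
    part \<open>1 / 2 + \<delta>\<close>, where the bound for \<open>1 / zeta\<close> still
    holds.\<close>
  define a where "a = - (1 / 2 + \<delta>)"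
  define p where "p = 2 - 2 * \<epsilon>"
  have p: "p > 1" using \<epsilon> by (simp add: p_def)
  define J where "J = (LINT t|lborel. (1 + \<bar>t\<bar>) powr - p)"
  define B where "B = C ^ 2 * 64 * J"
  have J: "J \<ge> 0" unfolding J_def by (intro integral_nonneg_AE) auto
  have main: "norm (mu_sq_tail y w) \<le> B * y powr - (1 / 2 + \<delta>) * (1 + \<bar>Im w\<bar>) powr (2 * \<epsilon>)"
    if y: "y \<ge> 1" and w: "Re w = 1 + 2 * \<delta>" for y w
  proof -
    define M where "M = (\<lambda>s. 1 / zeta s)"
    define f where "f = (\<lambda>z. M (w + z) ^ 2 * perron_kernel y z)"
    define W where "W = (1 + \<bar>Im w\<bar>) powr (2 * \<epsilon>)"
    have W: "W \<ge> 0" by (simp add: W_def)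
    have Mb: "norm (M (w + z) ^ 2) \<le> C ^ 2 * W * (1 + \<bar>Im z\<bar>) powr (2 * \<epsilon>)" if "Re z \<ge> a" for z
    proof -
      have "norm (M (w + z)) \<le> C * (1 + \<bar>Im (w + z)\<bar>) powr \<epsilon>" unfolding M_def using that w by (intro C) (auto simp: a_def)
      also have "\<dots> \<le> C * ((1 + \<bar>Im w\<bar>) * (1 + \<bar>Im z\<bar>)) powr \<epsilon>"
      proof (intro mult_left_mono powr_mono2)
        \<comment> \<open>The product bound separates the height of \<open>w\<close>, which leaves
          the integral, from the height of \<open>z\<close>, which is integrated.\<close>
        have "\<bar>Im w + Im z\<bar> \<le> \<bar>Im w\<bar> + \<bar>Im z\<bar> + \<bar>Im w\<bar> * \<bar>Im z\<bar>" by (smt (verit) mult_nonneg_nonneg abs_ge_zero)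
        then show "1 + \<bar>Im (w + z)\<bar> \<le> (1 + \<bar>Im w\<bar>) * (1 + \<bar>Im z\<bar>)" by (simp add: algebra_simps)
      qed (use C \<epsilon> in auto)
      finally have "norm (M (w + z)) ^ 2 \<le> (C * ((1 + \<bar>Im w\<bar>) * (1 + \<bar>Im z\<bar>)) powr \<epsilon>) ^ 2" by (rule power_mono) simp
      then show ?thesis
        by (simp add: norm_power power_mult_distrib powr_power powr_mult W_def mult_ac)
    qed
    have pp: "(1 + \<bar>t\<bar>) powr (2 * \<epsilon>) * (1 + \<bar>t\<bar>) powr - 2 = (1 + \<bar>t\<bar>) powr - p" for t :: real
      by (simp add: p_def flip: powr_add)
    have bound: "norm (f z) \<le> (C ^ 2 * W * y * 4) * (1 + \<bar>Im z\<bar>) powr - p"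
      if z: "a \<le> Re z" "Re z \<le> 1" "\<bar>Im z\<bar> \<ge> 1" for z
    proof -
      have "y powr Re z \<le> y powr 1" using z y by (intro powr_mono) auto
      then have 2: "norm (perron_kernel y z) \<le> y * (4 * (1 + \<bar>Im z\<bar>) powr - 2)"
        using y inverse_norm_kernel_le_Im[of z] z by (subst norm_perron_kernel) (auto intro!: mult_mono)
      have "norm (f z) \<le> (C ^ 2 * W * (1 + \<bar>Im z\<bar>) powr (2 * \<epsilon>)) * (y * (4 * (1 + \<bar>Im z\<bar>) powr - 2))"
        unfolding f_def norm_mult using Mb[OF z(1)] 2 W by (intro mult_mono) auto
      also have "\<dots> = (C ^ 2 * W * y * 4) * ((1 + \<bar>Im z\<bar>) powr (2 * \<epsilon>) * (1 + \<bar>Im z\<bar>) powr - 2)" by (simp add: mult_ac)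
      finally show ?thesis unfolding pp .
    qed
    have bound_a: "norm (f (Complex a t)) \<le> (C ^ 2 * W * y powr a * 64) * (1 + \<bar>t\<bar>) powr - p" for t
    proof -
      \<comment> \<open>As \<open>\<delta> < 1 / 4\<close>, the line keeps distance at least 1/4
        from both 0 and -1; this gives the factor 64.\<close>
      have "norm (1 / (Complex a t * (Complex a t + 1))) \<le> 4 / (1 / 4) ^ 2 * (1 + \<bar>Im (Complex a t)\<bar>) powr - 2"
        using \<delta> by (intro inverse_norm_kernel_le) (auto simp: a_def)
      then have 2: "norm (perron_kernel y (Complex a t)) \<le> y powr a * (64 * (1 + \<bar>t\<bar>) powr - 2)"
        using y by (subst norm_perron_kernel) (auto simp: power2_eq_square intro!: mult_mono)
      have "norm (f (Complex a t)) \<le> (C ^ 2 * W * (1 + \<bar>t\<bar>) powr (2 * \<epsilon>)) * (y powr a * (64 * (1 + \<bar>t\<bar>) powr - 2))"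
        unfolding f_def norm_mult using Mb[of "Complex a t"] 2 W by (intro mult_mono) auto
      also have "\<dots> = (C ^ 2 * W * y powr a * 64) * ((1 + \<bar>t\<bar>) powr (2 * \<epsilon>) * (1 + \<bar>t\<bar>) powr - 2)" by (simp add: mult_ac)
      finally show ?thesis unfolding pp .
    qed
    \<comment> \<open>The largest half-plane on which \<open>w + z\<close> stays right of 1/2. It
      leaves room beyond \<open>a\<close>, and \<open>\<delta> < 1 / 4\<close> keeps the pole -1 out
      of it.\<close>
    define U where "U = {z. Re z > - (1 / 2 + 2 * \<delta>)}"
    have U: "open U" "convex U" "{z. a \<le> Re z \<and> Re z \<le> 1} \<subseteq> U"
      using \<delta> by (auto simp: U_def a_def open_halfspace_Re_gt convex_halfspace_Re_gt)
    have Mh: "(\<lambda>z. M (w + z)) holomorphic_on U"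
    proof -
      have "(M \<circ> (\<lambda>z. w + z)) holomorphic_on U"
        unfolding M_def by (rule holomorphic_on_compose_gen[OF _ recip_zeta_holomorphic_RH[OF RH]])
          (use w in \<open>auto intro!: holomorphic_intros simp: U_def\<close>)
      then show ?thesis by (simp add: o_def)
    qed
    have m1: "- 1 \<notin> U" using \<delta> by (auto simp: U_def)
    have hol: "f holomorphic_on U - {0}"
      unfolding f_def using y m1
      by (intro holomorphic_intros holomorphic_on_subset[OF Mh] perron_kernel_holomorphic) auto
    have "residue f 0 = M w ^ 2"
    proof -
      have nz: "z + 1 \<noteq> 0" if "z \<in> U" for z using m1 that by (metis add_eq_0_iff2 minus_minus)
      have "residue (\<lambda>z. (M (w + z) ^ 2 * (of_real y powr z / (z + 1))) / (z - 0)) 0 = M (w + 0) ^ 2 * (of_real y powr 0 / (0 + 1))"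
      proof (rule residue_simple[OF U(1)])
        show "0 \<in> U" using \<delta> by (auto simp: U_def)
        show "(\<lambda>z. M (w + z) ^ 2 * (of_real y powr z / (z + 1))) holomorphic_on U"
          using y nz by (intro holomorphic_intros Mh) auto
      qed
      moreover have "f = (\<lambda>z. (M (w + z) ^ 2 * (of_real y powr z / (z + 1))) / (z - 0))"
        by (auto simp: f_def perron_kernel_def mult_ac)
      ultimately show ?thesis using y by simp
    qed
    moreover note shift = vline_integral_shift[where a = a and b = 1 and f = f and P = "{0}" and ?T0.0 = 1
        and C = "C ^ 2 * W * y * 4" and p = p, OF _ U _ _ hol p bound]
    ultimately have sh: "vline_integral f 1 - vline_integral f a = 2 * pi * M w ^ 2"
      using shift(3) \<delta> by (auto simp: a_def)
    have int_a: "integrable lborel (\<lambda>t. f (Complex a t))" using shift(1) \<delta> by (auto simp: a_def)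
    define b where "b = (\<lambda>n. of_int (mu_sq n) * of_nat n powr - w :: complex)"
    have w1: "Re w > 1" using w \<delta> by simp
    have "vline_integral f 1 = 2 * pi * (\<Sum>n. b n * of_real (max 0 (1 - real n / y)))"
      unfolding f_def
    proof (rule riesz_perron(2))
      show "b 0 = 0" by (simp add: b_def)
      show "summable (\<lambda>n. norm (b n) * real n powr - 1)"
      proof (rule summable_comparison_test[OF _ mu_sq_series(2)[OF w1]], intro exI allI impI)
        fix n
        have "real n powr - 1 \<le> 1" by (cases "n = 0") (auto simp: powr_minus_divide)
        then show "norm (norm (b n) * real n powr - 1) \<le> norm (of_int (mu_sq n) * of_nat n powr - w :: complex)"
          using mult_left_mono[of "real n powr - 1" 1 "norm (b n)"] by (simp add: b_def)
      qed
      fix t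
      have "Re (w + Complex 1 t) > 1" using w1 by simp
      from mu_sq_series(1)[OF this]
      show "(\<lambda>n. b n * of_nat n powr - Complex 1 t) sums M (w + Complex 1 t) ^ 2"
        by (simp add: b_def M_def powr_add[symmetric] mult.assoc)
    qed (use y in auto)
    moreover have "(\<Sum>n. b n * of_real (max 0 (1 - real n / y))) = M w ^ 2 - mu_sq_tail y w"
    proof -
      have s1: "b sums M w ^ 2" unfolding b_def M_def by (rule mu_sq_series(1)[OF w1])
      have s2: "(\<lambda>n. of_int (mu_sq n) * of_real (min 1 (real n / y)) * of_nat n powr - w) sums mu_sq_tail y w"
        unfolding mu_sq_tail_def using y by (intro summable_sums summable_norm_cancel[OF mu_sq_tail_summable[OF w1]]) auto
      have "b n - of_int (mu_sq n) * of_real (min 1 (real n / y)) * of_nat n powr - w = b n * of_real (max 0 (1 - real n / y))" for n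
      proof -
        have e: "max 0 (1 - real n / y) = 1 - min 1 (real n / y)" by auto
        show ?thesis unfolding e by (simp add: b_def algebra_simps)
      qed
      then show ?thesis using sums_diff[OF s1 s2] by (simp add: sums_iff)
    qed
    ultimately have "vline_integral f a = - (2 * pi * mu_sq_tail y w)" using sh by (simp add: algebra_simps eq_neg_iff_add_eq_0)
    then have "2 * pi * norm (mu_sq_tail y w) = norm (vline_integral f a)" by (simp add: norm_mult)
    also have "\<dots> \<le> (C ^ 2 * W * y powr a * 64) * J"
      unfolding J_def by (rule vline_integral_norm_le[OF p int_a bound_a])
    also have "\<dots> = B * y powr - (1 / 2 + \<delta>) * W" by (simp add: B_def a_def mult_ac)
    finally have "2 * pi * norm (mu_sq_tail y w) \<le> B * y powr - (1 / 2 + \<delta>) * W" .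
    moreover have "1 * norm (mu_sq_tail y w) \<le> 2 * pi * norm (mu_sq_tail y w)"
      using pi_gt3 by (intro mult_right_mono) auto
    ultimately show ?thesis by (simp add: W_def)
  qed
  have "B \<ge> 0" using J by (simp add: B_def)
  then show ?thesis using main by blast
qed

text \<open>The numerator \<open>(N + 1) powr (z + 1) - N powr (z + 1)\<close> has two bounds: the
  mean value theorem gives \<open>N powr c / \<bar>t\<bar>\<close> for the quotient, the triangle
  inequality \<open>N powr (c + 1) / t\<^sup>2\<close>. The first just fails to be integrable, the
  second loses a full power of \<open>N\<close>; interpolating buys convergence for
  \<open>N powr \<kappa>\<close>.\<close>

lemma perron_kernel_difference_bound:
  assumes N: "N > 0" and c: "1 / 2 \<le> c" and \<kappa>: "0 < \<kappa>" "\<kappa> \<le> 1"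
  shows "norm (of_real (N + 1) * perron_kernel (N + 1) (Complex c t) - of_real N * perron_kernel N (Complex c t))
    \<le> 12 * (N + 1) powr (c + \<kappa>) * (1 + \<bar>t\<bar>) powr - (1 + \<kappa>)"
proof -
  define z where "z = Complex c t"
  define D where "D = of_real (N + 1) powr (z + 1) - of_real N powr (z + 1)"
  have eq: "of_real (N + 1) * perron_kernel (N + 1) z - of_real N * perron_kernel N z = D / (z * (z + 1))"
    using N by (simp add: D_def perron_kernel_def powr_add diff_divide_distrib mult.commute del: of_real_add)
  have z: "1 + \<bar>t\<bar> \<le> 3 * norm z" "1 + \<bar>t\<bar> \<le> 2 * norm (z + 1)"
    using abs_Re_le_cmod[of z] abs_Im_le_cmod[of z] abs_Re_le_cmod[of "z + 1"] abs_Im_le_cmod[of "z + 1"] c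
    by (auto simp: z_def)
  have zpos: "norm z > 0" "norm (z + 1) > 0" using z by auto
  have D1: "norm D \<le> norm (z + 1) * (N + 1) powr c"
  proof -
    define S where "S = closed_segment (complex_of_real N) (of_real (N + 1))"
    have S_eq: "S = complex_of_real ` {N..N + 1}"
      unfolding S_def by (subst closed_segment_of_real) (simp add: closed_segment_eq_real_ivl)
    have "norm (of_real (N + 1) powr (z + 1) - of_real N powr (z + 1)) \<le> (norm (z + 1) * (N + 1) powr c) * norm (of_real (N + 1) - complex_of_real N)"
    proof (rule field_differentiable_bound[where S = S and f' = "\<lambda>x. (z + 1) * x powr z"])
      fix x assume "x \<in> S"
      then obtain r where r: "x = of_real r" "N \<le> r" "r \<le> N + 1" by (auto simp: S_eq)
      have "x \<notin> \<real>\<^sub>\<le>\<^sub>0" using r N by (auto simp: complex_nonpos_Reals_iff)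
      then have "((\<lambda>x. x powr (z + 1)) has_field_derivative (z + 1) * x powr ((z + 1) - 1)) (at x)"
        by (rule has_field_derivative_powr)
      then show "((\<lambda>x. x powr (z + 1)) has_field_derivative (z + 1) * x powr z) (at x within S)"
        by (simp add: has_field_derivative_at_within)
      have "r powr c \<le> (N + 1) powr c" using r N c by (intro powr_mono2) auto
      then show "norm ((z + 1) * x powr z) \<le> norm (z + 1) * (N + 1) powr c"
        using r N by (simp add: norm_mult norm_of_real_powr mult_left_mono z_def)
    qed (auto simp: S_def)
    then show ?thesis by (simp add: D_def)
  qed
  have D2: "norm D \<le> 2 * (N + 1) * (N + 1) powr c"
  proof -
    have "norm D \<le> (N + 1) powr (c + 1) + N powr (c + 1)"
      unfolding D_def by (rule order_trans[OF norm_triangle_ineq4])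
        (use N in \<open>simp add: norm_of_real_powr z_def del: of_real_add\<close>)
    also have "N powr (c + 1) \<le> (N + 1) powr (c + 1)" using N c by (intro powr_mono2) auto
    finally show ?thesis using N by (simp add: powr_add algebra_simps)
  qed
  \<comment> \<open>The ratio of the two bounds. Both branches below use
    \<open>min 1 x \<le> x powr \<kappa>\<close>.\<close>
  define x where "x = 4 * (N + 1) / (1 + \<bar>t\<bar>)"
  have x: "x > 0" using N by (simp add: x_def)
  have r1: "norm (D / (z * (z + 1))) \<le> 3 * (N + 1) powr c / (1 + \<bar>t\<bar>) * 1"
  proof -
    have "norm (D / (z * (z + 1))) = norm D / (norm z * norm (z + 1))" by (simp add: norm_divide norm_mult)
    also have "\<dots> \<le> norm (z + 1) * (N + 1) powr c / (norm z * norm (z + 1))"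
      using D1 by (intro divide_right_mono) auto
    also have "\<dots> = (N + 1) powr c / norm z" using zpos by simp
    also have "\<dots> \<le> (N + 1) powr c / ((1 + \<bar>t\<bar>) / 3)" using z zpos by (intro divide_left_mono mult_pos_pos) auto
    finally show ?thesis by (simp add: mult_ac)
  qed
  have r2: "norm (D / (z * (z + 1))) \<le> 3 * (N + 1) powr c / (1 + \<bar>t\<bar>) * x"
  proof -
    have "norm (D / (z * (z + 1))) = norm D / (norm z * norm (z + 1))" by (simp add: norm_divide norm_mult)
    also have "\<dots> \<le> 2 * (N + 1) * (N + 1) powr c / (((1 + \<bar>t\<bar>) / 3) * ((1 + \<bar>t\<bar>) / 2))"
      using D2 z zpos N by (intro frac_le mult_mono) auto
    also have "\<dots> = 3 * (N + 1) powr c / (1 + \<bar>t\<bar>) * x" by (simp add: x_def field_simps)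
    finally show ?thesis .
  qed
  have r3: "norm (D / (z * (z + 1))) \<le> 3 * (N + 1) powr c / (1 + \<bar>t\<bar>) * x powr \<kappa>"
  proof (cases "x \<ge> 1")
    case True
    then have "1 \<le> x powr \<kappa>" using \<kappa> by (intro ge_one_powr_ge_zero) auto
    then have "3 * (N + 1) powr c / (1 + \<bar>t\<bar>) * 1 \<le> 3 * (N + 1) powr c / (1 + \<bar>t\<bar>) * x powr \<kappa>"
      by (intro mult_left_mono) auto
    then show ?thesis using r1 by linarith
  next
    case False
    then have "x powr 1 \<le> x powr \<kappa>" using \<kappa> x by (intro powr_mono') auto
    then have "3 * (N + 1) powr c / (1 + \<bar>t\<bar>) * x \<le> 3 * (N + 1) powr c / (1 + \<bar>t\<bar>) * x powr \<kappa>"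
      using x by (intro mult_left_mono) auto
    then show ?thesis using r2 by linarith
  qed
  have xk: "x powr \<kappa> \<le> 4 * (N + 1) powr \<kappa> / (1 + \<bar>t\<bar>) powr \<kappa>"
  proof -
    have "(4 :: real) powr \<kappa> \<le> 4 powr 1" using \<kappa> by (intro powr_mono) auto
    moreover have "x powr \<kappa> = 4 powr \<kappa> * (N + 1) powr \<kappa> / (1 + \<bar>t\<bar>) powr \<kappa>"
    proof -
      have "x powr \<kappa> = (4 * (N + 1)) powr \<kappa> / (1 + \<bar>t\<bar>) powr \<kappa>"
        unfolding x_def by (rule powr_divide)
      also have "(4 * (N + 1)) powr \<kappa> = 4 powr \<kappa> * (N + 1) powr \<kappa>"
        by (rule powr_mult)
      finally show ?thesis .
    qed
    ultimately show ?thesis by (simp add: divide_right_mono mult_right_mono)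
  qed
  have "3 * (N + 1) powr c / (1 + \<bar>t\<bar>) * x powr \<kappa> \<le> 3 * (N + 1) powr c / (1 + \<bar>t\<bar>) * (4 * (N + 1) powr \<kappa> / (1 + \<bar>t\<bar>) powr \<kappa>)"
    by (rule mult_left_mono[OF xk]) auto
  then have "norm (D / (z * (z + 1))) \<le> 3 * (N + 1) powr c / (1 + \<bar>t\<bar>) * (4 * (N + 1) powr \<kappa> / (1 + \<bar>t\<bar>) powr \<kappa>)"
    using r3 by linarith
  also have "\<dots> = 12 * (N + 1) powr (c + \<kappa>) * (1 + \<bar>t\<bar>) powr - (1 + \<kappa>)"
    by (simp add: powr_add powr_minus powr_diff field_simps)
  finally show ?thesis unfolding z_def[symmetric] eq .
qed

text \<open>Each difference of \<open>\<Delta>\<close> is an integral over \<open>Re z = c\<close>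
  in which \<open>d\<close> enters only through \<open>d powr - (2 * z)\<close>. Summing over
  \<open>d\<close> under the integral assembles \<open>mu_sq_tail y (2 * z)\<close>, whose saving in
  \<open>y\<close> therefore carries over to the sum.\<close>

lemma mu_sq_weighted_sum_RH:
  assumes RH: Riemann_Hypothesis
  defines "\<Delta> \<equiv> \<lambda>u. divisor_sum1 u - divisor_main1 u"
  shows "\<exists>C\<ge>0. \<forall>y (N::real) a. y \<ge> 1 \<longrightarrow> N > 0 \<longrightarrow>
     a = (\<lambda>d. real_of_int (mu_sq d) * min 1 (real d / y) * (real d ^ 2 * (\<Delta> ((N + 1) / real d ^ 2) - \<Delta> (N / real d ^ 2)))) \<longrightarrow>
     summable a \<and> \<bar>suminf a\<bar> \<le> C * y powr - (51 / 100) * (N + 1) powr (52 / 100)"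
proof -
  \<comment> \<open>Here \<open>\<delta> = 1 / 100\<close>, so that \<open>2 * z\<close> has the
    real part \<open>1 + 2 * \<delta>\<close> at which the tail is bounded.\<close>
  define c :: real where "c = 51 / 100"
  have c: "1 / 2 < c" "c < 1" by (auto simp: c_def)
  obtain C1 where C1: "C1 \<ge> 0" "\<And>t. norm (zeta (Complex c t)) \<le> C1 * (1 + \<bar>t\<bar>) powr (1 / 1000)"
    using zeta_bound_line_RH[OF RH, of c "1 / 1000"] c by auto
  obtain C2 where C2: "C2 \<ge> 0" "\<And>y w. y \<ge> 1 \<Longrightarrow> Re w = 2 * c \<Longrightarrow>
      norm (mu_sq_tail y w) \<le> C2 * y powr - (51 / 100) * (1 + \<bar>Im w\<bar>) powr (1 / 500)"
    using mu_sq_tail_bound_RH[OF RH, of "1 / 100" "1 / 1000"] by (auto simp: c_def)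
  \<comment> \<open>The difference of kernels decays with exponent 1 + 1/100; \<open>zeta\<close>
    squared and the tail each take back 1/500.\<close>
  define p :: real where "p = 1006 / 1000"
  define J where "J = (LINT t|lborel. (1 + \<bar>t\<bar>) powr - p)"
  have J: "J \<ge> 0" unfolding J_def by (intro integral_nonneg_AE) auto
  define C where "C = C1 ^ 2 * C2 * 24 * J"
  have "summable a \<and> \<bar>suminf a\<bar> \<le> C * y powr - (51 / 100) * (N + 1) powr (52 / 100)"
    if y: "y \<ge> 1" and N: "N > 0" and a: "a = (\<lambda>d. real_of_int (mu_sq d) * min 1 (real d / y) *
       (real d ^ 2 * (\<Delta> ((N + 1) / real d ^ 2) - \<Delta> (N / real d ^ 2))))" for y N :: real and a
  proof -
    define Z where "Z = (\<lambda>t. Complex c t)"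
    define Q where "Q = (\<lambda>t. zeta (Z t) ^ 2 * (of_real (N + 1) * perron_kernel (N + 1) (Z t) - of_real N * perron_kernel N (Z t)))"
    define b where "b = (\<lambda>d t. of_int (mu_sq d) * of_real (min 1 (real d / y)) * of_nat d powr - (2 * Z t) :: complex)"
    define f where "f = (\<lambda>d t. b d t * Q t)"
    have kint: "integrable lborel (\<lambda>t. zeta (Z t) ^ 2 * perron_kernel u (Z t))" if "u > 0" for u
      unfolding Z_def using vline_integral_zeta_sq(1)[OF RH c that] .
    have Q: "integrable lborel Q"
    proof -
      have "integrable lborel (\<lambda>t. of_real (N + 1) * (zeta (Z t) ^ 2 * perron_kernel (N + 1) (Z t)) - of_real N * (zeta (Z t) ^ 2 * perron_kernel N (Z t)))"
        using N by (intro Bochner_Integration.integrable_diff integrable_mult_right kint) auto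
      then show ?thesis unfolding Q_def by (simp add: algebra_simps)
    qed
    \<comment> \<open>The factor \<open>d powr - (2 * z)\<close> rescales the kernel from
      \<open>X\<close> to \<open>X / d\<^sup>2\<close>.\<close>
    have ker: "of_nat d powr - (2 * z) * (of_real X * perron_kernel X z) =
        of_real (real d ^ 2) * (of_real (X / real d ^ 2) * perron_kernel (X / real d ^ 2) z)" if d: "d > 0" and X: "X > 0" for d X z
    proof -
      have "complex_of_real X = of_real (X / real d ^ 2) * of_real (real d ^ 2)" using d by (simp flip: of_real_mult)
      then have "of_real X powr z = of_real (X / real d ^ 2) powr z * of_real (real d ^ 2) powr z"
        using X d powr_times_real[of "of_real (X / real d ^ 2)" "of_real (real d ^ 2)" z] by simp
      also have "of_real (real d ^ 2) powr z = (of_nat d powr (2 * z) :: complex)"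
      proof -
        have "of_real (real d ^ 2) powr z = (of_nat d * of_nat d) powr z" by (simp add: power2_eq_square)
        also have "\<dots> = of_nat d powr z * of_nat d powr z" by (rule powr_times_real) auto
        finally show ?thesis by (simp add: powr_add[symmetric])
      qed
      finally have "of_nat d powr - (2 * z) * of_real X powr z = of_real (X / real d ^ 2) powr z"
        using d by (simp add: powr_minus)
      then show ?thesis using d by (simp add: perron_kernel_def)
    qed
    have int_f: "integral\<^sup>L lborel (f d) = of_real (2 * pi * a d)" and f_int: "integrable lborel (f d)" for d
    proof -
      have "integrable lborel (f d) \<and> integral\<^sup>L lborel (f d) = of_real (2 * pi * a d)"
      proof (cases "d = 0")
        case True
        then show ?thesis by (simp add: f_def b_def a)
      next
        case False
        define w where "w = complex_of_real (real_of_int (mu_sq d) * min 1 (real d / y) * real d ^ 2)"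
        define k where "k = (\<lambda>X t. of_real X * (zeta (Z t) ^ 2 * perron_kernel X (Z t)))"
        have "f d t = w * k ((N + 1) / real d ^ 2) t - w * k (N / real d ^ 2) t" for t
        proof -
          have "f d t = of_int (mu_sq d) * of_real (min 1 (real d / y)) * zeta (Z t) ^ 2 *
              (of_nat d powr - (2 * Z t) * (of_real (N + 1) * perron_kernel (N + 1) (Z t)) -
               of_nat d powr - (2 * Z t) * (of_real N * perron_kernel N (Z t)))"
            unfolding f_def b_def Q_def by (simp only: right_diff_distrib mult_ac)
          also have "\<dots> = w * k ((N + 1) / real d ^ 2) t - w * k (N / real d ^ 2) t"
            using False N by (subst (1 2) ker) (auto simp: w_def k_def right_diff_distrib mult_ac simp del: of_real_add of_real_divide)
          finally show ?thesis .
        qed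
        then have fd: "f d = (\<lambda>t. w * k ((N + 1) / real d ^ 2) t - w * k (N / real d ^ 2) t)" by auto
        have ki: "integrable lborel (k X)" and kv: "integral\<^sup>L lborel (k X) = of_real (2 * pi * \<Delta> X)" if "X > 0" for X
        proof -
          show "integrable lborel (k X)" unfolding k_def by (intro integrable_mult_right kint that)
          have "integral\<^sup>L lborel (k X) = of_real X * vline_integral (\<lambda>z. zeta z ^ 2 * perron_kernel X z) c"
            unfolding k_def vline_integral_def Z_def by simp
          then show "integral\<^sup>L lborel (k X) = of_real (2 * pi * \<Delta> X)"
            using vline_integral_zeta_sq(2)[OF RH c that] by (simp add: \<Delta>_def)
        qed
        have pos: "(N + 1) / real d ^ 2 > 0" "N / real d ^ 2 > 0" using False N by auto
        have i: "integrable lborel (\<lambda>t. w * k X t)" if "X > 0" for X using ki[OF that] by simp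
        have "integrable lborel (f d)" unfolding fd by (intro Bochner_Integration.integrable_diff i pos)
        moreover have "integral\<^sup>L lborel (f d) = w * of_real (2 * pi * \<Delta> ((N + 1) / real d ^ 2)) - w * of_real (2 * pi * \<Delta> (N / real d ^ 2))"
          unfolding fd using i[OF pos(1)] i[OF pos(2)] by (simp only: Bochner_Integration.integral_diff integral_mult_right_zero kv pos)
        moreover have "w * of_real (2 * pi * \<Delta> ((N + 1) / real d ^ 2)) - w * of_real (2 * pi * \<Delta> (N / real d ^ 2)) = of_real (2 * pi * a d)"
          unfolding w_def a of_real_mult[symmetric] of_real_diff[symmetric] by (simp only: right_diff_distrib mult_ac)
        ultimately show ?thesis by simp
      qed
      then show "integral\<^sup>L lborel (f d) = of_real (2 * pi * a d)" "integrable lborel (f d)" by auto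
    qed
    define B where "B = (\<lambda>d. \<bar>real_of_int (mu_sq d)\<bar> * min 1 (real d / y) * real d powr - (2 * c))"
    have nb: "norm (b d t) = B d" for d t
      using y by (cases "d = 0") (auto simp: b_def B_def norm_mult norm_of_nat_powr Z_def)
    have sB: "summable B"
    proof -
      have "B = (\<lambda>n. norm (b n 0))" using nb by auto
      then show ?thesis using mu_sq_tail_summable[of "2 * Z 0" y] c y by (simp only: b_def) (simp add: Z_def)
    qed
    have nf: "norm (f d t) = B d * norm (Q t)" for d t unfolding f_def norm_mult nb ..
    have s1: "AE t in lborel. summable (\<lambda>d. norm (f d t))"
      unfolding nf using sB by (intro AE_I2 summable_mult2)
    have s2: "summable (\<lambda>d. LINT t|lborel. norm (f d t))"
      unfolding nf using sB by (simp add: summable_mult2)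
    have sumf: "(\<Sum>d. f d t) = mu_sq_tail y (2 * Z t) * Q t" for t
    proof -
      have "summable (\<lambda>d. b d t)"
        unfolding b_def using c y by (intro summable_norm_cancel[OF mu_sq_tail_summable]) (auto simp: Z_def)
      then show ?thesis unfolding f_def mu_sq_tail_def b_def by (rule suminf_mult2[symmetric])
    qed
    have "summable (\<lambda>d. complex_of_real (2 * pi * a d))"
    proof (rule summable_comparison_test[OF _ s2], intro exI allI impI)
      fix d
      show "norm (complex_of_real (2 * pi * a d)) \<le> (LINT t|lborel. norm (f d t))"
        unfolding int_f[symmetric] by (rule integral_norm_bound)
    qed
    then have sa': "summable (\<lambda>d. 2 * pi * a d)" by (simp only: summable_complex_of_real)
    then have sa: "summable a" using summable_mult[OF sa', of "1 / (2 * pi)"] by simp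
    have "complex_of_real (2 * pi * suminf a) = (\<Sum>d. complex_of_real (2 * pi * a d))"
      using suminf_mult[OF sa, of "2 * pi"] suminf_of_real[OF sa', where 'a = complex] by simp
    also have "\<dots> = (LINT t|lborel. mu_sq_tail y (2 * Z t) * Q t)"
      using integral_suminf[OF f_int s1 s2] unfolding int_f sumf by simp
    finally have eq: "complex_of_real (2 * pi * suminf a) = (LINT t|lborel. mu_sq_tail y (2 * Z t) * Q t)" .
    have int: "integrable lborel (\<lambda>t. mu_sq_tail y (2 * Z t) * Q t)"
      using integrable_suminf[OF f_int s1 s2] unfolding sumf .
    define L where "L = C1 ^ 2 * C2 * 24 * y powr - (51 / 100) * (N + 1) powr (52 / 100)"
    have "norm (mu_sq_tail y (2 * Z t) * Q t) \<le> L * (1 + \<bar>t\<bar>) powr - p" for t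
    proof -
      have "norm (zeta (Z t)) ^ 2 \<le> (C1 * (1 + \<bar>t\<bar>) powr (1 / 1000)) ^ 2"
        unfolding Z_def by (intro power_mono C1) auto
      then have 1: "norm (zeta (Z t) ^ 2) \<le> C1 ^ 2 * (1 + \<bar>t\<bar>) powr (1 / 500)"
        by (simp add: norm_power power_mult_distrib powr_power)
      have 2: "norm (of_real (N + 1) * perron_kernel (N + 1) (Z t) - of_real N * perron_kernel N (Z t)) \<le>
          12 * (N + 1) powr (c + 1 / 100) * (1 + \<bar>t\<bar>) powr - (1 + 1 / 100)"
        unfolding Z_def using N c by (intro perron_kernel_difference_bound) auto
      have "norm (mu_sq_tail y (2 * Z t)) \<le> C2 * y powr - (51 / 100) * (1 + \<bar>Im (2 * Z t)\<bar>) powr (1 / 500)"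
        using y by (intro C2) (auto simp: Z_def)
      also have "\<dots> \<le> C2 * y powr - (51 / 100) * (2 * (1 + \<bar>t\<bar>) powr (1 / 500))"
      proof (intro mult_left_mono)
        have "(1 + \<bar>Im (2 * Z t)\<bar>) powr (1 / 500) \<le> (2 * (1 + \<bar>t\<bar>)) powr (1 / 500)"
          by (intro powr_mono2) (auto simp: Z_def)
        also have "\<dots> = 2 powr (1 / 500) * (1 + \<bar>t\<bar>) powr (1 / 500)" by (rule powr_mult; simp)
        also have "(2 :: real) powr (1 / 500) \<le> 2 powr 1" by (intro powr_mono) auto
        finally show "(1 + \<bar>Im (2 * Z t)\<bar>) powr (1 / 500) \<le> 2 * (1 + \<bar>t\<bar>) powr (1 / 500)" by (simp add: mult_right_mono)
      qed (use C2 in auto)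
      finally have 3: "norm (mu_sq_tail y (2 * Z t)) \<le> C2 * y powr - (51 / 100) * (2 * (1 + \<bar>t\<bar>) powr (1 / 500))" .
      have "norm (mu_sq_tail y (2 * Z t) * Q t) \<le> (C2 * y powr - (51 / 100) * (2 * (1 + \<bar>t\<bar>) powr (1 / 500))) *
          ((C1 ^ 2 * (1 + \<bar>t\<bar>) powr (1 / 500)) * (12 * (N + 1) powr (c + 1 / 100) * (1 + \<bar>t\<bar>) powr - (1 + 1 / 100)))"
        unfolding norm_mult Q_def using 1 2 3 C1 C2 by (intro mult_mono) auto
      also have "\<dots> = L * ((1 + \<bar>t\<bar>) powr (1 / 500) * (1 + \<bar>t\<bar>) powr (1 / 500) * (1 + \<bar>t\<bar>) powr - (1 + 1 / 100))"
        by (simp add: L_def c_def mult_ac)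
      also have "(1 + \<bar>t\<bar>) powr (1 / 500) * (1 + \<bar>t\<bar>) powr (1 / 500) * (1 + \<bar>t\<bar>) powr - (1 + 1 / 100) = (1 + \<bar>t\<bar>) powr - p"
        by (simp add: p_def flip: powr_add)
      finally show ?thesis .
    qed
    then have "norm (LINT t|lborel. mu_sq_tail y (2 * Z t) * Q t) \<le> (LINT t|lborel. L * (1 + \<bar>t\<bar>) powr - p)"
      using integrable_powr_decay[of p] int
      by (intro Bochner_Integration.integral_norm_bound_integral) (auto simp: p_def)
    then have "norm (complex_of_real (2 * pi * suminf a)) \<le> L * J" unfolding eq by (simp add: J_def)
    then have "2 * pi * \<bar>suminf a\<bar> \<le> L * J" by (simp only: norm_of_real abs_mult) simp
    moreover have "1 * \<bar>suminf a\<bar> \<le> 2 * pi * \<bar>suminf a\<bar>" using pi_gt3 by (intro mult_right_mono) auto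
    ultimately have "\<bar>suminf a\<bar> \<le> L * J" by linarith
    then show ?thesis using sa by (simp add: L_def C_def mult_ac)
  qed
  moreover have "C \<ge> 0" using C1 C2 J by (simp add: C_def)
  ultimately show ?thesis by blast
qed

section \<open>Assembling the bound\<close>

lemma divisor_sum1_eq_sum:
  assumes "0 < u" "u \<le> real M"
  shows "divisor_sum1 u = (\<Sum>n\<le>M. real (divisor_count n) * max 0 (u - real n))"
proof -
  have "max 0 (1 - real n / u) = 0" if "n \<notin> {..M}" for n using that assms by (simp add: field_simps)
  then have "(\<Sum>n. real (divisor_count n) * max 0 (1 - real n / u)) = (\<Sum>n\<in>{..M}. real (divisor_count n) * max 0 (1 - real n / u))"
    by (intro suminf_finite) auto
  moreover have "u * (real (divisor_count n) * max 0 (1 - real n / u)) = real (divisor_count n) * max 0 (u - real n)" for n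
  proof -
    have "u * max 0 (1 - real n / u) = max 0 (u - real n)"
      using assms by (simp add: max_mult_distrib_left right_diff_distrib)
    then show ?thesis by (simp only: mult.left_commute[of u])
  qed
  ultimately show ?thesis by (simp only: divisor_sum1_def sum_distrib_left)
qed

text \<open>As \<open>divisor_sum (x / d\<^sup>2)\<close> is a step function of \<open>x\<close> with jumps at integers only, it is an exact
  difference of its integral; this replaces the truncation in Perron's formula.\<close>

lemma divisor_sum_eq_difference:
  assumes d: "d > 0" and x: "real N \<le> x" "x < real N + 1" and N: "N > 0"
  shows "divisor_sum (x / real d ^ 2) =
    real d ^ 2 * (divisor_sum1 ((real N + 1) / real d ^ 2) - divisor_sum1 (real N / real d ^ 2))"
proof -
  have d1: "real d ^ 2 \<ge> 1" using d by simp
  have le: "X / real d ^ 2 \<le> real (N + 1)" if "X \<le> real N + 1" for X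
  proof -
    have "X / real d ^ 2 \<le> (real N + 1) / real d ^ 2" using that by (intro divide_right_mono) auto
    also have "\<dots> \<le> (real N + 1) / 1" using d1 d by (intro divide_left_mono) auto
    finally show ?thesis by simp
  qed
  have step: "real d ^ 2 * (max 0 ((real N + 1) / real d ^ 2 - real n) - max 0 (real N / real d ^ 2 - real n)) =
      (if real n \<le> x / real d ^ 2 then 1 else 0)" for n
  proof -
    define k where "k = n * d ^ 2"
    have "real d ^ 2 * max 0 (X / real d ^ 2 - real n) = max 0 (X - real k)" for X
      using d by (simp add: max_mult_distrib_left right_diff_distrib k_def mult.commute)
    then have "real d ^ 2 * (max 0 ((real N + 1) / real d ^ 2 - real n) - max 0 (real N / real d ^ 2 - real n)) =
        max 0 (real N + 1 - real k) - max 0 (real N - real k)"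
      by (simp only: right_diff_distrib)
    also have "\<dots> = (if k \<le> N then 1 else 0)" by (auto simp: max_def)
    also have "k \<le> N \<longleftrightarrow> real k \<le> x" using x by linarith
    also have "real k \<le> x \<longleftrightarrow> real n \<le> x / real d ^ 2" using d by (simp add: k_def field_simps)
    finally show ?thesis .
  qed
  have "divisor_sum (x / real d ^ 2) = (\<Sum>n\<le>N + 1. real (divisor_count n) * (if real n \<le> x / real d ^ 2 then 1 else 0))"
    using le[of x] x by (subst divisor_sum_eq_sum[of _ "N + 1"]) (auto intro!: sum.cong)
  also have "\<dots> = real d ^ 2 * ((\<Sum>n\<le>N + 1. real (divisor_count n) * max 0 ((real N + 1) / real d ^ 2 - real n)) -
      (\<Sum>n\<le>N + 1. real (divisor_count n) * max 0 (real N / real d ^ 2 - real n)))"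
    unfolding step[symmetric] by (simp add: sum_distrib_left sum_subtractf algebra_simps)
  also have "(\<Sum>n\<le>N + 1. real (divisor_count n) * max 0 ((real N + 1) / real d ^ 2 - real n)) = divisor_sum1 ((real N + 1) / real d ^ 2)"
    using d le[of "real N + 1"] by (intro divisor_sum1_eq_sum[symmetric]) auto
  also have "(\<Sum>n\<le>N + 1. real (divisor_count n) * max 0 (real N / real d ^ 2 - real n)) = divisor_sum1 (real N / real d ^ 2)"
    using d N le[of "real N"] by (intro divisor_sum1_eq_sum[symmetric]) auto
  finally show ?thesis .
qed

lemma divisor_main1_deriv:
  assumes "u > 0"
  shows "(divisor_main1 has_real_derivative divisor_main u) (at u)"
  unfolding divisor_main1_def[abs_def] divisor_main_def using assms
  by (auto intro!: derivative_eq_intros simp: field_simps power2_eq_square)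

lemma divisor_main_deriv:
  assumes "u > 0"
  shows "(divisor_main has_real_derivative ln u + 2 * euler_mascheroni) (at u)"
  unfolding divisor_main_def[abs_def] using assms
  by (auto intro!: derivative_eq_intros simp: field_simps)

text \<open>By the mean value theorem the scaled difference is \<open>divisor_main\<close> at some
  point between \<open>N / d\<^sup>2\<close> and \<open>(N + 1) / d\<^sup>2\<close>. The point
  \<open>x / d\<^sup>2\<close> lies in the same interval of length \<open>1 / d\<^sup>2\<close>, and
  \<open>divisor_main\<close> has a logarithmic derivative bound there.\<close>

lemma divisor_main_difference:
  assumes d: "d > 0" and x: "real N \<le> x" "x < real N + 1" and N: "N > 0"
  shows "\<bar>real d ^ 2 * (divisor_main1 ((real N + 1) / real d ^ 2) - divisor_main1 (real N / real d ^ 2))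
      - divisor_main (x / real d ^ 2)\<bar> \<le> (ln (x + 1) + 2 + 2 * ln (real d)) / real d ^ 2"
proof -
  define D where "D = real d ^ 2"
  have D: "D \<ge> 1" using d by (simp add: D_def)
  have lnD: "ln D = 2 * ln (real d)" using d by (simp add: D_def ln_realpow)
  define a where "a = real N / D"
  define b where "b = (real N + 1) / D"
  have ab: "0 < a" "a < b" "b - a = 1 / D" using N D by (auto simp: a_def b_def divide_strict_right_mono diff_divide_distrib[symmetric])
  have "\<exists>z>a. z < b \<and> divisor_main1 b - divisor_main1 a = (b - a) * divisor_main z"
    using ab by (intro MVT2) (auto intro!: divisor_main1_deriv)
  then obtain \<xi> where \<xi>: "a < \<xi>" "\<xi> < b" "divisor_main1 b - divisor_main1 a = (b - a) * divisor_main \<xi>" by auto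
  have e1: "D * (divisor_main1 b - divisor_main1 a) = divisor_main \<xi>" using \<xi>(3) ab D by simp
  define xx where "xx = x / D"
  have xx: "a \<le> xx" "xx < b" using x D by (auto simp: xx_def a_def b_def divide_right_mono divide_strict_right_mono)
  have lip: "\<bar>divisor_main s - divisor_main t\<bar> \<le> (ln (x + 1) + 2 + ln D) * \<bar>s - t\<bar>"
    if "s \<in> {a..b}" "t \<in> {a..b}" for s t
  proof -
    have "norm (divisor_main s - divisor_main t) \<le> (ln (x + 1) + 2 + ln D) * norm (s - t)"
    proof (rule field_differentiable_bound[where S = "{a..b}" and f' = "\<lambda>u. ln u + 2 * euler_mascheroni"])
      fix u assume u: "u \<in> {a..b}"
      then have u0: "u > 0" using ab by auto
      show "(divisor_main has_field_derivative ln u + 2 * euler_mascheroni) (at u within {a..b})"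
        using divisor_main_deriv[OF u0] by (rule has_field_derivative_at_within)
      have uD: "real N \<le> u * D" "u * D \<le> x + 1" using u D x by (auto simp: a_def b_def field_simps)
      \<comment> \<open>\<open>u\<close> may be tiny when \<open>d\<close> is large, but
        \<open>u * D\<close> lies between \<open>N\<close> and \<open>x + 1\<close>, which controls
        \<open>ln u\<close> from both sides.\<close>
      have lnu: "ln u = ln (u * D) - ln D" using u0 D by (simp add: ln_mult_pos)
      have 1: "0 \<le> ln (u * D)" using uD N by (intro ln_ge_zero) auto
      have 2: "ln (u * D) \<le> ln (x + 1)" using uD N u0 D by (intro ln_mono) auto
      have 3: "0 \<le> ln D" using D by simp
      have "\<bar>ln u + 2 * euler_mascheroni\<bar> \<le> ln (x + 1) + 2 + ln D"
        using 1 2 3 euler_mascheroni_pos euler_mascheroni_less_13_over_22 unfolding lnu by (auto simp: abs_le_iff)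
      then show "norm (ln u + 2 * euler_mascheroni) \<le> ln (x + 1) + 2 + ln D" by simp
    qed (use that in auto)
    then show ?thesis by simp
  qed
  have "\<bar>divisor_main \<xi> - divisor_main xx\<bar> \<le> (ln (x + 1) + 2 + ln D) * \<bar>\<xi> - xx\<bar>"
    using \<xi> xx by (intro lip) auto
  also have "\<dots> \<le> (ln (x + 1) + 2 + ln D) * (1 / D)"
  proof (intro mult_left_mono)
    show "\<bar>\<xi> - xx\<bar> \<le> 1 / D" using \<xi> xx ab(3) by auto
    show "0 \<le> ln (x + 1) + 2 + ln D" using x D by (intro add_nonneg_nonneg ln_ge_zero) auto
  qed
  finally show ?thesis using e1 unfolding lnD by (simp add: D_def a_def b_def xx_def)
qed

text \<open>The two constants of the main term: the value of \<open>(1 / zeta s) ^ 2\<close> at 2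
  and minus its derivative there.\<close>

lemma mu_sq_sums_at_2:
  shows "(\<lambda>d. real_of_int (mu_sq d) / real d ^ 2) sums (1 / (Re (zeta 2)) ^ 2)"
    and "(\<lambda>d. real_of_int (mu_sq d) * ln (real d) / real d ^ 2) sums (2 * Re (deriv zeta 2) / Re (zeta 2) ^ 3)"
proof -
  define z where "z = Re (zeta 2)"
  define z' where "z' = Re (deriv zeta 2)"
  have z: "zeta 2 = of_real z" using zeta_real[of 2] by (simp add: z_def complex_eq_iff complex_is_Real_iff)
  have z': "deriv zeta 2 = of_real z'" using deriv_zeta_real[of 2] by (simp add: z'_def complex_eq_iff complex_is_Real_iff)
  have nz: "zeta 2 \<noteq> 0" by (rule zeta_nonzero_Re_gt_1) simp
  have pw: "of_nat d powr - 2 = complex_of_real (1 / real d ^ 2)" for d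
  proof (cases "d = 0")
    case False
    have "of_nat d powr - 2 = (1 :: complex) / of_nat d powr 2" by (rule powr_minus_divide)
    also have "of_nat d powr 2 = (of_nat d :: complex) ^ 2" using False by (simp add: powr_numeral)
    finally show ?thesis by simp
  qed simp
  have "(\<lambda>d. of_int (mu_sq d) * of_nat d powr - 2) sums (1 / zeta 2) ^ 2" by (rule mu_sq_series(1)) simp
  then have "(\<lambda>d. complex_of_real (real_of_int (mu_sq d) / real d ^ 2)) sums of_real (1 / z ^ 2)"
    unfolding pw z by (simp add: power_divide)
  then show "(\<lambda>d. real_of_int (mu_sq d) / real d ^ 2) sums (1 / (Re (zeta 2)) ^ 2)"
    unfolding sums_of_real_iff z_def .
  have dF: "deriv (\<lambda>s. (1 / zeta s) ^ 2) 2 = of_real (- (2 * z' / z ^ 3))"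
  proof (rule DERIV_imp_deriv)
    have "(zeta has_field_derivative deriv zeta 2) (at 2)"
      by (rule holomorphic_derivI[OF zeta_holomorphic]) auto
    from DERIV_power[OF DERIV_divide[OF DERIV_const this nz], of 1 2]
    have "((\<lambda>s. (1 / zeta s) ^ 2) has_field_derivative
        (of_nat 2 * ((0 * zeta 2 - 1 * deriv zeta 2) / (zeta 2 * zeta 2) * (1 / zeta 2) ^ (2 - Suc 0)))) (at 2)" .
    moreover have "of_nat 2 * ((0 * zeta 2 - 1 * deriv zeta 2) / (zeta 2 * zeta 2) * (1 / zeta 2) ^ (2 - Suc 0)) =
        - (2 * deriv zeta 2 / zeta 2 ^ 3)"
      by (simp add: power3_eq_cube)
    ultimately have "((\<lambda>s. (1 / zeta s) ^ 2) has_field_derivative (- (2 * deriv zeta 2 / zeta 2 ^ 3))) (at 2)" by (simp only:)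
    then show "((\<lambda>s. (1 / zeta s) ^ 2) has_field_derivative of_real (- (2 * z' / z ^ 3))) (at 2)"
      unfolding z z' by simp
  qed
  have "(\<lambda>d. - (of_int (mu_sq d) * of_real (ln (real d)) * of_nat d powr - 2)) sums deriv (\<lambda>s. (1 / zeta s) ^ 2) 2"
  proof (rule dirichlet_series_deriv[where c = "3 / 2"])
    show "summable (\<lambda>n. norm (of_int (mu_sq n) :: complex) * real n powr - (3 / 2))"
      using mu_sq_summable_real[of "3 / 2"] by simp
    show "(\<lambda>n. of_int (mu_sq n) * of_nat n powr - w) sums (1 / zeta w) ^ 2" if "Re w > 3 / 2" for w
      using that by (intro mu_sq_series(1)) simp
  qed simp
  from sums_minus[OF this] have "(\<lambda>d. complex_of_real (real_of_int (mu_sq d) * ln (real d) / real d ^ 2)) sums of_real (2 * z' / z ^ 3)"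
    unfolding dF pw by simp
  then show "(\<lambda>d. real_of_int (mu_sq d) * ln (real d) / real d ^ 2) sums (2 * Re (deriv zeta 2) / Re (zeta 2) ^ 3)"
    unfolding sums_of_real_iff z_def z'_def .
qed

text \<open>For large \<open>d\<close> the divisor sums vanish but \<open>divisor_main\<close> does
  not; the infinite tail is what completes the main terms to the constants at 2.\<close>

lemma E_mu_sums:
  assumes x: "x > 0"
  shows "(\<lambda>d. real_of_int (mu_sq d) * (divisor_sum (x / real d ^ 2) - divisor_main (x / real d ^ 2))) sums E_mu x"
proof -
  define z where "z = Re (zeta 2)"
  define z' where "z' = Re (deriv zeta 2)"
  define N where "N = nat \<lceil>x\<rceil>"
  have xN: "x \<le> real N" unfolding N_def by linarith
  have zero: "divisor_sum (x / real d ^ 2) = 0" if "d > N" for d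
  proof -
    have d: "real d \<ge> 1" "x < real d" using that xN by auto
    have "real d \<le> real d ^ 2" using d by (intro self_le_power) auto
    then have "x < real d ^ 2" using d by linarith
    then have "x / real d ^ 2 < 1" using d by simp
    have "\<not> real (m * n) \<le> x / real d ^ 2" if "m > 0" "n > 0" for m n
    proof -
      have "1 \<le> m * n" using that by (simp add: Suc_le_eq)
      then have "1 \<le> real (m * n)" by (simp only: real_of_nat_ge_one_iff)
      then show ?thesis using \<open>x / real d ^ 2 < 1\<close> by linarith
    qed
    then have "{(m, n). m > 0 \<and> n > 0 \<and> real (m * n) \<le> x / real d ^ 2} = {}" by blast
    then show ?thesis unfolding divisor_sum_def by (simp only: card.empty of_nat_0)
  qed
  have "(\<lambda>d. real_of_int (mu_sq d) * divisor_sum (x / real d ^ 2)) sums (\<Sum>d\<in>{1..N}. real_of_int (mu_sq d) * divisor_sum (x / real d ^ 2))"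
  proof (rule sums_finite)
    fix d assume "d \<notin> {1..N}"
    then have "d = 0 \<or> d > N" by auto
    then show "real_of_int (mu_sq d) * divisor_sum (x / real d ^ 2) = 0" using zero by auto
  qed simp
  then have 1: "(\<lambda>d. real_of_int (mu_sq d) * divisor_sum (x / real d ^ 2)) sums of_int (S_mu x)"
    unfolding S_mu_eq_sum[OF xN] .
  have "(\<lambda>d. x * (ln x + 2 * euler_mascheroni - 1) * (real_of_int (mu_sq d) / real d ^ 2) - 2 * x * (real_of_int (mu_sq d) * ln (real d) / real d ^ 2))
      sums (x * (ln x + 2 * euler_mascheroni - 1) * (1 / z ^ 2) - 2 * x * (2 * z' / z ^ 3))"
    unfolding z_def z'_def by (intro sums_diff sums_mult mu_sq_sums_at_2)
  moreover have "x * (ln x + 2 * euler_mascheroni - 1) * (real_of_int (mu_sq d) / real d ^ 2) - 2 * x * (real_of_int (mu_sq d) * ln (real d) / real d ^ 2)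
      = real_of_int (mu_sq d) * divisor_main (x / real d ^ 2)" for d
  proof (cases "d = 0")
    case False
    then have l: "ln (x / real d ^ 2) = ln x - 2 * ln (real d)" using x by (simp add: ln_div ln_realpow)
    show ?thesis unfolding divisor_main_def l by (simp add: divide_inverse algebra_simps)
  qed simp
  ultimately have 2: "(\<lambda>d. real_of_int (mu_sq d) * divisor_main (x / real d ^ 2)) sums
      (x * (ln x + 2 * euler_mascheroni - 1) * (1 / z ^ 2) - 2 * x * (2 * z' / z ^ 3))" by simp
  have "E_mu x = of_int (S_mu x) - (x * (ln x + 2 * euler_mascheroni - 1) * (1 / z ^ 2) - 2 * x * (2 * z' / z ^ 3))"
    unfolding E_mu_def z_def[symmetric] z'_def[symmetric]
    by (simp add: algebra_simps diff_divide_distrib add_divide_distrib power2_eq_square power3_eq_cube)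
  then show ?thesis using sums_diff[OF 1 2] by (simp add: right_diff_distrib)
qed

text \<open>The loss for each \<open>d\<close> is \<open>O((ln (x + 1) + ln d) / d\<^sup>2)\<close>.
  Giving \<open>d powr (1 / 2)\<close> to the logarithm leaves \<open>d powr - (3 / 2)\<close>,
  against which \<open>mu_sq\<close> is absolutely summable.\<close>

lemma mu_sq_remainder_bound:
  "\<exists>C\<ge>0. \<forall>x y N r. N > 0 \<longrightarrow> real N \<le> x \<longrightarrow> x < real N + 1 \<longrightarrow> y \<ge> 1 \<longrightarrow>
    r = (\<lambda>d. real_of_int (mu_sq d) * min 1 (real d / y) * (real d ^ 2 *
        (divisor_main1 ((real N + 1) / real d ^ 2) - divisor_main1 (real N / real d ^ 2)) - divisor_main (x / real d ^ 2))) \<longrightarrow>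
    summable r \<and> \<bar>suminf r\<bar> \<le> C * (ln (x + 1) + 2)"
proof -
  have s2: "summable (\<lambda>d. \<bar>real_of_int (mu_sq d)\<bar> * real d powr - (3 / 2))" by (rule mu_sq_summable_real) simp
  define C where "C = 5 * (\<Sum>d. \<bar>real_of_int (mu_sq d)\<bar> * real d powr - (3 / 2))"
  have C0: "C \<ge> 0" unfolding C_def using suminf_nonneg[OF s2] by simp
  have "summable r \<and> \<bar>suminf r\<bar> \<le> C * (ln (x + 1) + 2)"
    if x: "N > 0" "real N \<le> x" "x < real N + 1" and y: "y \<ge> 1" and r: "r = (\<lambda>d. real_of_int (mu_sq d) * min 1 (real d / y) * (real d ^ 2 *
        (divisor_main1 ((real N + 1) / real d ^ 2) - divisor_main1 (real N / real d ^ 2)) - divisor_main (x / real d ^ 2)))"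
    for x y N r
  proof -
    define l where "l = ln (x + 1) + 2"
    have l: "l \<ge> 2" unfolding l_def using x by simp
    have rb: "norm (r d) \<le> 5 * l * (\<bar>real_of_int (mu_sq d)\<bar> * real d powr - (3 / 2))" for d
    proof (cases "d = 0")
      case False
      then have d: "real d \<ge> 1" by simp
      have "ln (real d) \<le> real d powr (1 / 2) / (1 / 2)" using d by (intro ln_powr_bound) auto
      then have ln: "ln (real d) \<le> 2 * real d powr (1 / 2)" by simp
      have one: "1 \<le> real d powr (1 / 2)" using d by (intro ge_one_powr_ge_zero) auto
      have "l + 2 * ln (real d) \<le> 5 * l * real d powr (1 / 2)"
      proof -
        have "l * 1 \<le> l * real d powr (1 / 2)" using one l by (intro mult_left_mono) auto
        moreover have "2 * real d powr (1 / 2) \<le> l * real d powr (1 / 2)" using l by (intro mult_right_mono) auto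
        ultimately have "l + 2 * ln (real d) \<le> 5 * (l * real d powr (1 / 2))" using ln l by linarith
        then show ?thesis by (simp only: mult.assoc)
      qed
      then have "(l + 2 * ln (real d)) / real d ^ 2 \<le> 5 * l * real d powr (1 / 2) / real d ^ 2"
        by (intro divide_right_mono) auto
      also have "5 * l * real d powr (1 / 2) / real d ^ 2 = 5 * l * real d powr - (3 / 2)"
      proof -
        have "real d powr - (3 / 2) = real d powr (1 / 2 - 2)" by simp
        also have "\<dots> = real d powr (1 / 2) / real d powr 2" by (rule powr_diff)
        also have "real d powr 2 = real d ^ 2" using d by (simp add: powr_numeral)
        finally show ?thesis by simp
      qed
      finally have b: "(l + 2 * ln (real d)) / real d ^ 2 \<le> 5 * l * real d powr - (3 / 2)" .
      have "\<bar>real d ^ 2 * (divisor_main1 ((real N + 1) / real d ^ 2) - divisor_main1 (real N / real d ^ 2))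
          - divisor_main (x / real d ^ 2)\<bar> \<le> (l + 2 * ln (real d)) / real d ^ 2"
        unfolding l_def using False x by (intro divisor_main_difference) auto
      with b have m: "\<bar>real d ^ 2 * (divisor_main1 ((real N + 1) / real d ^ 2) - divisor_main1 (real N / real d ^ 2))
          - divisor_main (x / real d ^ 2)\<bar> \<le> 5 * l * real d powr - (3 / 2)" by linarith
      have v: "\<bar>min 1 (real d / y)\<bar> \<le> 1" using y by auto
      have "norm (r d) = \<bar>real_of_int (mu_sq d)\<bar> * \<bar>min 1 (real d / y)\<bar> * \<bar>real d ^ 2 * (divisor_main1 ((real N + 1) / real d ^ 2) - divisor_main1 (real N / real d ^ 2))
          - divisor_main (x / real d ^ 2)\<bar>" by (simp only: r real_norm_def abs_mult)
      also have "\<dots> \<le> \<bar>real_of_int (mu_sq d)\<bar> * 1 * (5 * l * real d powr - (3 / 2))"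
        using m v by (intro mult_mono) auto
      finally show ?thesis by (simp add: mult_ac)
    qed (simp add: r)
    have sb: "summable (\<lambda>d. 5 * l * (\<bar>real_of_int (mu_sq d)\<bar> * real d powr - (3 / 2)))" using s2 by (rule summable_mult)
    have "summable r" using rb by (intro summable_comparison_test[OF _ sb]) auto
    moreover have "norm (suminf r) \<le> (\<Sum>d. 5 * l * (\<bar>real_of_int (mu_sq d)\<bar> * real d powr - (3 / 2)))"
      by (rule norm_suminf_le[OF rb sb])
    moreover have "\<dots> = C * l" unfolding C_def using suminf_mult[OF s2, of "5 * l"] by simp
    ultimately show ?thesis by (simp add: l_def)
  qed
  then show ?thesis using C0 by blast
qed

text \<open>The divisor bound gives \<open>d powr - (7 / 10)\<close>, split as
  \<open>d powr (35 / 100) * d powr - (105 / 100)\<close>: the first factor is at most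
  \<open>y powr (35 / 100)\<close>, the second makes the series of \<open>mu_sq\<close> converge
  absolutely, so no pointwise bound on \<open>mu_sq\<close> is used. By
  \<open>y\<^sup>2 \<le> x\<close> all arguments \<open>x / d\<^sup>2\<close> with
  \<open>d \<le> y\<close> are at least 1.\<close>

lemma mu_sq_initial_sum_bound:
  "\<exists>C\<ge>0. \<forall>x y s. y \<ge> 1 \<longrightarrow> y ^ 2 \<le> x \<longrightarrow>
    s = (\<lambda>d. real_of_int (mu_sq d) * max 0 (1 - real d / y) * (divisor_sum (x / real d ^ 2) - divisor_main (x / real d ^ 2))) \<longrightarrow>
    summable s \<and> \<bar>suminf s\<bar> \<le> C * x powr (7 / 20) * y powr (35 / 100)"
proof -
  obtain C where C: "C \<ge> 0" "\<And>u. u \<ge> 1 \<Longrightarrow> \<bar>divisor_sum u - divisor_main u\<bar> \<le> C * u powr (7 / 20)"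
    using divisor_problem_bound by blast
  have s2: "summable (\<lambda>d. \<bar>real_of_int (mu_sq d)\<bar> * real d powr - (105 / 100))" by (rule mu_sq_summable_real) simp
  define G where "G = (\<Sum>d. \<bar>real_of_int (mu_sq d)\<bar> * real d powr - (105 / 100))"
  have G0: "G \<ge> 0" unfolding G_def using suminf_nonneg[OF s2] by simp
  have "summable s \<and> \<bar>suminf s\<bar> \<le> C * G * x powr (7 / 20) * y powr (35 / 100)"
    if y: "y \<ge> 1" "y ^ 2 \<le> x" and s: "s = (\<lambda>d. real_of_int (mu_sq d) * max 0 (1 - real d / y) * (divisor_sum (x / real d ^ 2) - divisor_main (x / real d ^ 2)))"
    for x y s
  proof -
    define L where "L = C * x powr (7 / 20) * y powr (35 / 100)"
    have "1 \<le> y ^ 2" using y by (intro one_le_power)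
    then have x0: "x > 0" using y by linarith
    have sb: "norm (s d) \<le> L * (\<bar>real_of_int (mu_sq d)\<bar> * real d powr - (105 / 100))" for d
    proof (cases "d = 0 \<or> real d > y")
      case True
      then have "s d = 0"
      proof
        assume "real d > y"
        then have "max 0 (1 - real d / y) = 0" using y by (simp add: field_simps)
        then show ?thesis by (simp add: s)
      qed (simp add: s)
      then show ?thesis using C by (simp add: L_def)
    next
      case False
      then have d: "real d \<ge> 1" "real d \<le> y" by auto
      have "real d ^ 2 \<le> y ^ 2" using d by (intro power_mono) auto
      then have "real d ^ 2 \<le> x" using y by linarith
      then have xd: "x / real d ^ 2 \<ge> 1" using d by simp
      have "\<bar>divisor_sum (x / real d ^ 2) - divisor_main (x / real d ^ 2)\<bar> \<le> C * (x / real d ^ 2) powr (7 / 20)"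
        by (rule C(2)[OF xd])
      also have "(x / real d ^ 2) powr (7 / 20) = x powr (7 / 20) * real d powr - (7 / 10)"
      proof -
        have "(real d ^ 2) powr (7 / 20) = (real d powr 2) powr (7 / 20)" using d by (simp add: powr_numeral)
        also have "\<dots> = real d powr (7 / 10)" unfolding powr_powr by simp
        finally show ?thesis using d x0 by (simp add: powr_divide powr_minus_divide)
      qed
      also have "real d powr - (7 / 10) = real d powr (35 / 100) * real d powr - (105 / 100)"
        by (simp flip: powr_add)
      also have "C * (x powr (7 / 20) * (real d powr (35 / 100) * real d powr - (105 / 100))) \<le>
          C * (x powr (7 / 20) * (y powr (35 / 100) * real d powr - (105 / 100)))"
        using d C by (intro mult_left_mono mult_right_mono powr_mono2) auto
      finally have m: "\<bar>divisor_sum (x / real d ^ 2) - divisor_main (x / real d ^ 2)\<bar> \<le> L * real d powr - (105 / 100)"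
        by (simp add: L_def mult_ac)
      have v: "\<bar>max 0 (1 - real d / y)\<bar> \<le> 1" using y by auto
      have "norm (s d) = \<bar>real_of_int (mu_sq d)\<bar> * \<bar>max 0 (1 - real d / y)\<bar> * \<bar>divisor_sum (x / real d ^ 2) - divisor_main (x / real d ^ 2)\<bar>"
        by (simp only: s real_norm_def abs_mult)
      also have "\<dots> \<le> \<bar>real_of_int (mu_sq d)\<bar> * 1 * (L * real d powr - (105 / 100))"
        using m v by (intro mult_mono) auto
      finally show ?thesis by (simp add: mult_ac)
    qed
    have sm: "summable (\<lambda>d. L * (\<bar>real_of_int (mu_sq d)\<bar> * real d powr - (105 / 100)))" using s2 by (rule summable_mult)
    have "summable s" using sb by (intro summable_comparison_test[OF _ sm]) auto
    moreover have "norm (suminf s) \<le> (\<Sum>d. L * (\<bar>real_of_int (mu_sq d)\<bar> * real d powr - (105 / 100)))"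
      by (rule norm_suminf_le[OF sb sm])
    moreover have "\<dots> = L * G" unfolding G_def by (rule suminf_mult[OF s2])
    ultimately show ?thesis by (simp add: L_def mult_ac)
  qed
  moreover have "C * G \<ge> 0" using C G0 by simp
  ultimately show ?thesis by blast
qed

text \<open>With \<open>y = x powr (1 / 5)\<close> the exponents are
  \<open>7/20 + 7/100 = 42/100\<close> for the initial part and
  \<open>52/100 - 51/500 = 418/1000\<close> for the weighted tail; both are below 17/40.\<close>

theorem E_mu_bound_RH:
  assumes RH: Riemann_Hypothesis
  shows "\<exists>C\<ge>0. \<forall>x\<ge>1. \<bar>E_mu x\<bar> \<le> C * x powr (17 / 40)"
proof -
  define \<Delta> where "\<Delta> = (\<lambda>u. divisor_sum1 u - divisor_main1 u)"
  obtain C1 where C1: "C1 \<ge> 0" "\<And>x y s. y \<ge> 1 \<Longrightarrow> y ^ 2 \<le> x \<Longrightarrow>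
      s = (\<lambda>d. real_of_int (mu_sq d) * max 0 (1 - real d / y) * (divisor_sum (x / real d ^ 2) - divisor_main (x / real d ^ 2))) \<Longrightarrow>
      summable s \<and> \<bar>suminf s\<bar> \<le> C1 * x powr (7 / 20) * y powr (35 / 100)"
    using mu_sq_initial_sum_bound by blast
  obtain C2 where C2: "C2 \<ge> 0" "\<And>y N a. y \<ge> 1 \<Longrightarrow> N > 0 \<Longrightarrow>
      a = (\<lambda>d. real_of_int (mu_sq d) * min 1 (real d / y) * (real d ^ 2 * (\<Delta> ((N + 1) / real d ^ 2) - \<Delta> (N / real d ^ 2)))) \<Longrightarrow>
      summable a \<and> \<bar>suminf a\<bar> \<le> C2 * y powr - (51 / 100) * (N + 1) powr (52 / 100)"
    using mu_sq_weighted_sum_RH[OF RH] unfolding \<Delta>_def by blast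
  obtain C3 where C3: "C3 \<ge> 0" "\<And>x y N r. N > 0 \<Longrightarrow> real N \<le> x \<Longrightarrow> x < real N + 1 \<Longrightarrow> y \<ge> 1 \<Longrightarrow>
      r = (\<lambda>d. real_of_int (mu_sq d) * min 1 (real d / y) * (real d ^ 2 *
        (divisor_main1 ((real N + 1) / real d ^ 2) - divisor_main1 (real N / real d ^ 2)) - divisor_main (x / real d ^ 2))) \<Longrightarrow>
      summable r \<and> \<bar>suminf r\<bar> \<le> C3 * (ln (x + 1) + 2)"
    using mu_sq_remainder_bound by blast
  have "\<bar>E_mu x\<bar> \<le> (C1 + 2 * C2 + 9 * C3) * x powr (17 / 40)" if x: "x \<ge> 1" for x
  proof -
    define N where "N = nat \<lfloor>x\<rfloor>"
    have N: "N > 0" "real N \<le> x" "x < real N + 1" using x unfolding N_def by linarith+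
    define y where "y = x powr (1 / 5)"
    have y: "y \<ge> 1" unfolding y_def using x by (intro ge_one_powr_ge_zero) auto
    have "y ^ 2 = x powr (2 / 5)" unfolding y_def using x by (simp add: powr_power)
    also have "\<dots> \<le> x powr 1" using x by (intro powr_mono) auto
    finally have y2: "y ^ 2 \<le> x" using x by simp
    define s where "s = (\<lambda>d. real_of_int (mu_sq d) * max 0 (1 - real d / y) * (divisor_sum (x / real d ^ 2) - divisor_main (x / real d ^ 2)))"
    define a where "a = (\<lambda>d. real_of_int (mu_sq d) * min 1 (real d / y) * (real d ^ 2 * (\<Delta> ((real N + 1) / real d ^ 2) - \<Delta> (real N / real d ^ 2))))"
    define r where "r = (\<lambda>d. real_of_int (mu_sq d) * min 1 (real d / y) * (real d ^ 2 *
        (divisor_main1 ((real N + 1) / real d ^ 2) - divisor_main1 (real N / real d ^ 2)) - divisor_main (x / real d ^ 2)))"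
    have S: "summable s" "\<bar>suminf s\<bar> \<le> C1 * x powr (7 / 20) * y powr (35 / 100)" using C1(2)[OF y y2 s_def] by auto
    have A: "summable a" "\<bar>suminf a\<bar> \<le> C2 * y powr - (51 / 100) * (real N + 1) powr (52 / 100)"
      using C2(2)[OF y _ a_def] N by auto
    have R: "summable r" "\<bar>suminf r\<bar> \<le> C3 * (ln (x + 1) + 2)" using C3(2)[OF N y r_def] by auto
    \<comment> \<open>The complementary weights add up to 1. On the tail the divisor sum is
      rewritten as a difference of its integral: \<open>a\<close> carries the error of that
      integral, \<open>r\<close> the mismatch of the main terms.\<close>
    have "s d + (a d + r d) = real_of_int (mu_sq d) * (divisor_sum (x / real d ^ 2) - divisor_main (x / real d ^ 2))" for d
    proof (cases "d = 0")
      case False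
      define v where "v = min 1 (real d / y)"
      have w: "max 0 (1 - real d / y) = 1 - v" by (auto simp: v_def)
      have D: "divisor_sum (x / real d ^ 2) =
          real d ^ 2 * (divisor_sum1 ((real N + 1) / real d ^ 2) - divisor_sum1 (real N / real d ^ 2))"
        using False N by (intro divisor_sum_eq_difference) auto
      show ?thesis unfolding s_def a_def r_def w v_def[symmetric] D \<Delta>_def by (simp add: algebra_simps)
    qed (simp add: s_def a_def r_def)
    then have "(\<lambda>d. s d + (a d + r d)) sums E_mu x" using E_mu_sums[of x] x by simp
    moreover have "(\<lambda>d. s d + (a d + r d)) sums (suminf s + (suminf a + suminf r))"
      using S A R by (intro sums_add summable_sums)
    ultimately have "E_mu x = suminf s + (suminf a + suminf r)" by (rule sums_unique2)
    then have E: "\<bar>E_mu x\<bar> \<le> C1 * x powr (7 / 20) * y powr (35 / 100) + C2 * y powr - (51 / 100) * (real N + 1) powr (52 / 100) + C3 * (ln (x + 1) + 2)"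
      using S A R by linarith
    have p: "x powr e \<le> x powr (17 / 40)" if "e \<le> 17 / 40" for e using that x by (intro powr_mono) auto
    have 1: "C1 * x powr (7 / 20) * y powr (35 / 100) \<le> C1 * x powr (17 / 40)"
    proof -
      have "x powr (7 / 20) * y powr (35 / 100) = x powr (42 / 100)" unfolding y_def by (simp add: powr_powr flip: powr_add)
      then show ?thesis using p[of "42 / 100"] C1 by (simp add: mult.assoc mult_left_mono)
    qed
    have 2: "C2 * y powr - (51 / 100) * (real N + 1) powr (52 / 100) \<le> 2 * C2 * x powr (17 / 40)"
    proof -
      have "(real N + 1) powr (52 / 100) \<le> (2 * x) powr (52 / 100)" using N x by (intro powr_mono2) auto
      also have "\<dots> = 2 powr (52 / 100) * x powr (52 / 100)" using x by (simp add: powr_mult)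
      also have "(2 :: real) powr (52 / 100) \<le> 2 powr 1" by (intro powr_mono) auto
      finally have "(real N + 1) powr (52 / 100) \<le> 2 * x powr (52 / 100)" by (simp add: mult_right_mono)
      then have "y powr - (51 / 100) * (real N + 1) powr (52 / 100) \<le> y powr - (51 / 100) * (2 * x powr (52 / 100))"
        by (intro mult_left_mono) auto
      also have "\<dots> = 2 * (x powr - (51 / 500) * x powr (52 / 100))" unfolding y_def by (simp add: powr_powr)
      also have "x powr - (51 / 500) * x powr (52 / 100) = x powr (418 / 1000)" by (simp flip: powr_add)
      also have "2 * x powr (418 / 1000) \<le> 2 * x powr (17 / 40)" using p[of "418 / 1000"] by simp
      finally have "C2 * (y powr - (51 / 100) * (real N + 1) powr (52 / 100)) \<le> C2 * (2 * x powr (17 / 40))"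
        by (rule mult_left_mono[OF _ C2(1)])
      then show ?thesis by (simp only: mult_ac)
    qed
    have 3: "C3 * (ln (x + 1) + 2) \<le> 9 * C3 * x powr (17 / 40)"
    proof -
      have "ln (x + 1) \<le> ln (2 * x)" using x by (intro ln_mono) auto
      also have "\<dots> = ln 2 + ln x" using x by (simp add: ln_mult_pos)
      also have "ln x \<le> x powr (17 / 40) / (17 / 40)" using x by (intro ln_powr_bound) auto
      finally have "ln (x + 1) + 2 \<le> 3 + 40 / 17 * x powr (17 / 40)" using ln2_le_25_over_36 by simp
      also have "\<dots> \<le> 9 * x powr (17 / 40)" using x ge_one_powr_ge_zero[of x "17 / 40"] by simp
      finally have "C3 * (ln (x + 1) + 2) \<le> C3 * (9 * x powr (17 / 40))"
        by (rule mult_left_mono[OF _ C3(1)])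
      then show ?thesis by (simp only: mult_ac)
    qed
    show ?thesis using E 1 2 3 by (simp add: algebra_simps)
  qed
  then show ?thesis using C1 C2 C3 by (intro exI[of _ "C1 + 2 * C2 + 9 * C3"]) auto
qed

theorem corollary1:
  assumes "Riemann_Hypothesis"
  shows "\<forall>\<epsilon>::real. \<epsilon> > 0 \<longrightarrow>
           (\<exists>C::real. \<forall>x::real. x > 5 \<longrightarrow> \<bar>E_mu x\<bar> \<le> C * x powr (439 / 1032 + \<epsilon>))"
proof (intro allI impI)
  fix \<epsilon> :: real assume \<epsilon>: "\<epsilon> > 0"
  obtain C where C: "C \<ge> 0" "\<And>x. x \<ge> 1 \<Longrightarrow> \<bar>E_mu x\<bar> \<le> C * x powr (17 / 40)"
    using E_mu_bound_RH[OF assms] by blast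
  have "\<bar>E_mu x\<bar> \<le> C * x powr (439 / 1032 + \<epsilon>)" if x: "x > 5" for x
  proof -
    have "\<bar>E_mu x\<bar> \<le> C * x powr (17 / 40)" using x by (intro C) auto
    also have "\<dots> \<le> C * x powr (439 / 1032 + \<epsilon>)"
      using x \<epsilon> C(1) by (intro mult_left_mono powr_mono) auto
    finally show ?thesis .
  qed
  then show "\<exists>C::real. \<forall>x::real. x > 5 \<longrightarrow> \<bar>E_mu x\<bar> \<le> C * x powr (439 / 1032 + \<epsilon>)" by blast
qed

end
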